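(* Let $(\mathbb{R}^n,\Sigma,\mathbb{R}^d)$ be a real cut and project scheme with an almost canonical window $W$ and hull $\mathbb{X}$. Write each $\Lambda\in\mathbb{X}$ as the couple $(z,\mathfrak{c})=(z_\Lambda,\mathfrak{c}_\Lambda)$ and each $\mathsf{g}\in E(\mathbb{X},\mathbb{R}^d)$ as the couple $(z',\mathfrak{t})=(z_{\mathsf g},\mathfrak{t}_{\mathsf g})$. Then the Ellis action $\mathbb{X}\times E(\mathbb{X},\mathbb{R}^d)\to\mathbb{X}$, $(\Lambda,\mathsf g)\mapsto\Lambda.\mathsf g$, is given by $$(z,\mathfrak{c}).(z',\mathfrak{t})=(z+z',\mathfrak{c}'),\qquad \mathfrak{c}'(H)=\begin{cases}(\mathfrak{c}.\mathfrak{t})(H)&\text{if }H\in\mathfrak{H}_{z+z'},\\ \infty&\text{otherwise,}\end{cases}$$ where for $H\in\mathfrak{H}_W$ one sets $(\mathfrak{c}.\mathfrak{t})(H)=\mathfrak{c}(H)$ if $\mathfrak{t}(H)=0$ and $(\mathfrak{c}.\mathfrak{t})(H)=\mathfrak{t}(H)$ otherwise.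
   Context: **Cut and project scheme.** A real cut and project scheme $(\mathbb{R}^n,\Sigma,\mathbb{R}^d)$: $\Sigma$ is a lattice (discrete cocompact subgroup) in $\mathbb{R}^n\times\mathbb{R}^d$, the projection to $\mathbb{R}^d$ is injective on $\Sigma$ with image $\Gamma$, and the projection of $\Sigma$ to $\mathbb{R}^n$ is a dense subgroup $\Gamma^*$. For $\gamma\in\Gamma$, $\gamma^*\in\mathbb{R}^n$ is the unique element with $(\gamma^*,\gamma)\in\Sigma$. $[\mathbb{R}^{n+d}]_\Sigma=(\mathbb{R}^n\times\mathbb{R}^d)/\Sigma$, with classes $[w,t]_\Sigma$. The window $W\subset\mathbb{R}^n$ is an $n$-dimensional compact convex polytope; for $A\subset\mathbb{R}^n$, $\mathfrak{P}(A)=\{\gamma\in\Gamma:\gamma^*\in A\}$. **Hull.** $NS=(\Gamma^*-\partial W)^c\subset\mathbb{R}^n$. For $w\in NS$, $t\in\mathbb{R}^d$, the sets $\mathfrak{P}(w+W)-t=\mathfrak{P}(w+\mathring{W})-t$ are the nonsingular model sets; they all have the same language $\mathcal{L}_{NS}$, where $\mathcal{L}_\Lambda=\{(\Lambda-x)\cap B(0,R):x\in\Lambda,R>0\}$. The hull is $\mathbb{X}=\{\Lambda\subset\mathbb{R}^d:\mathcal{L}_\Lambda=\mathcal{L}_{NS}\}$, with neighborhood bases $\{\Lambda'\in\mathbb{X}:\exists |t|,|t'|<\varepsilon,\ (\Lambda-t)\cap K=(\Lambda'-t')\cap K\}$, $K\subset\mathbb{R}^d$ compact, $\varepsilon>0$;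 it is compact metrizable, and $\mathbb{R}^d$ acts by $\Lambda.t=\Lambda-t$. Each $\Lambda\in\mathbb{X}$ satisfies $\mathfrak{P}(w_\Lambda+\mathring W)-t_\Lambda\subseteq\Lambda\subseteq\mathfrak{P}(w_\Lambda+W)-t_\Lambda$ with $(w_\Lambda,t_\Lambda)$ unique modulo $\Sigma$; $\pi(\Lambda)=z_\Lambda=[w_\Lambda,t_\Lambda]_\Sigma$ defines a factor map $\pi:\mathbb{X}\to[\mathbb{R}^{n+d}]_\Sigma$ (with $[w,t]_\Sigma.s=[w,t+s]_\Sigma$). **Internal system.** $\Xi^\Gamma=\{\Lambda\in\mathbb{X}:\Lambda\subset\Gamma\}$ with neighborhood bases $\{\Lambda'\in\Xi^\Gamma:\Lambda\cap K=\Lambda'\cap K\}$, $K\subset\mathbb{R}^d$ compact; $\Gamma$ acts by $\Lambda.\gamma=\Lambda+\gamma$. For $\Lambda\in\Xi^\Gamma$ there is a unique $\Pi(\Lambda)=w_\Lambda\in\mathbb{R}^n$ with $\mathfrak{P}(w_\Lambda+\mathring W)\subseteq\Lambda\subseteq\mathfrak{P}(w_\Lambda+W)$. Identifying $w\in NS$ with $\mathfrak{P}(w+W)\in\Xi^\Gamma$, set $[A]_\Xi=\overline{A\cap NS}^{\,\Xi^\Gamma}$ for $A\subset\mathbb{R}^n$. **Almost canonical.** Let $M=-W$. For an $(n-1)$-dimensional face $f$ of $M$: $A_f$ is its affine span, $H_f$ the parallel linear hyperplane, $H_f^{\pm}$ the two open half-spaces bounded by $H_f$ (a fixed orientation for each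 linear hyperplane), $A_f^\pm$ the corresponding translates bounded by $A_f$. $Stab_\Gamma(A_f)=\{\gamma\in\Gamma:\gamma^*\in H_f\}$. $W$ is almost canonical if (1) $Stab_\Gamma(A_f)^*+f$ covers $A_f$ for every face $f$, and (2) $[\gamma^*+A_f^\pm]_\Xi$ is clopen in $\Xi^\Gamma$ for every $\gamma\in\Gamma$, every face $f$ and each sign. $\mathfrak{H}_W$ is the finite set of all $H_f$; $H^0:=H$ for $H\in\mathfrak{H}_W$. **Cut types and cone types.** For $w\in\mathbb{R}^n$, $\mathfrak{H}_w=\{H\in\mathfrak{H}_W: w\in\Gamma^*+A_f\text{ for some face }f\text{ with }H_f=H\}$; for $z=[w,t]_\Sigma$, $\mathfrak{H}_z:=\mathfrak{H}_w$ (well defined). For $\Lambda\in\Xi^\Gamma$, $\mathfrak{c}_\Lambda:\mathfrak{H}_W\to\{-,+,\infty\}$ is defined as follows: for $H\in\mathfrak{H}_{w_\Lambda}$, $[H^++w_\Lambda]_\Xi$ and $[H^-+w_\Lambda]_\Xi$ are complementary clopen sets and $\mathfrak{c}_\Lambda(H)$ is the sign of the one containing $\Lambda$; otherwise $\mathfrak{c}_\Lambda(H)=\infty$. For $\Lambda_0\in\mathbb{X}$, write $\Lambda_0=\Lambda-t$ with $\Lambda\in\Xi^\Gamma$, $t\in\mathbb{R}^d$, and set $\mathfrak{c}_{\Lambda_0}=\mathfrak{c}_\Lambda$ (well defined). The map $\Lambda\mapsto(z_\Lambda,\mathfrak{c}_\Lambda)$ is injective on $\mathbb{X}$, with image the couples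 $(z,\mathfrak c)$ such that $\mathfrak c$ takes values in $\{-,+\}$ exactly on $\mathfrak{H}_z$ and $\bigcap_{H\in\mathfrak{H}_z}H^{\mathfrak{c}(H)}\neq\emptyset$. **Ellis semigroups.** $E(X,T)$ is the closure of (the image of) $T$ in $X^X$ for pointwise convergence. There is a continuous onto morphism $\Pi^*:E(\Xi^\Gamma,\Gamma)\to\mathbb{R}^n$ with $\Pi(\Lambda.g)=\Pi(\Lambda)+\Pi^*(g)$; $w_g:=\Pi^*(g)$. There is a continuous onto morphism $\pi^*:E(\mathbb{X},\mathbb{R}^d)\to[\mathbb{R}^{n+d}]_\Sigma$ with $\pi(\Lambda.\mathsf{g})=\pi(\Lambda)+\pi^*(\mathsf{g})$; $z_{\mathsf g}:=\pi^*(\mathsf g)$. For $A\subset\mathbb{R}^n$, $[A]_E$ is the closure in $E(\Xi^\Gamma,\Gamma)$ of $\{\gamma\in\Gamma:\gamma^*\in A\}$. For $g\in E(\Xi^\Gamma,\Gamma)$ and $H\in\mathfrak{H}_W$ there is exactly one symbol $\mathfrak{t}_g(H)\in\{-,0,+\}$ with $g\in[H^{\mathfrak{t}_g(H)}+w_g]_E$. Each $g\in E(\Xi^\Gamma,\Gamma)$ extends to $\widetilde g:\mathbb{X}\to\mathbb{X}$ by $(\Lambda-t).\widetilde g=\Lambda.g-t$, and each $\mathsf g\in E(\mathbb{X},\mathbb{R}^d)$ can be written $\mathsf g=\widetilde g-s$ with $s\in\mathbb{R}^d$ and $g$ unique up to an element of $\Gamma$; set $\mathfrak{t}_{\mathsf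 g}=\mathfrak{t}_g$. The map $\mathsf g\mapsto(z_{\mathsf g},\mathfrak t_{\mathsf g})$ is injective. *)

theory Defs
  imports "HOL-Analysis.Analysis"
begin

section \<open>Topological preliminaries\<close>

text \<open>The topology on \<open>X\<close> in which the sets in \<open>N x\<close> form a neighborhood basis at \<open>x\<close>.\<close>

definition nbhd_topology :: "'a set \<Rightarrow> ('a \<Rightarrow> 'a set set) \<Rightarrow> 'a topology" where
  "nbhd_topology X N = topology (\<lambda>U. U \<subseteq> X \<and> (\<forall>x\<in>U. \<exists>B\<in>N x. B \<subseteq> U))"

lemma openin_nbhd_topology:
  assumes "\<forall>x. \<forall>A\<in>N x. \<forall>B\<in>N x. \<exists>C\<in>N x. C \<subseteq> A \<inter> B"
  shows "openin (nbhd_topology X N) U \<longleftrightarrow> U \<subseteq> X \<and> (\<forall>x\<in>U. \<exists>B\<in>N x. B \<subseteq> U)"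
proof -
  have "istopology (\<lambda>U. U \<subseteq> X \<and> (\<forall>x\<in>U. \<exists>B\<in>N x. B \<subseteq> U))"
    unfolding istopology_def
  proof (intro conjI allI impI ballI)
    fix S T x
    assume S: "S \<subseteq> X \<and> (\<forall>x\<in>S. \<exists>B\<in>N x. B \<subseteq> S)" and T: "T \<subseteq> X \<and> (\<forall>x\<in>T. \<exists>B\<in>N x. B \<subseteq> T)"
    then show "S \<inter> T \<subseteq> X" by blast
    assume x: "x \<in> S \<inter> T"
    then obtain A where A: "A \<in> N x" "A \<subseteq> S" using S by blast
    from x obtain B where B: "B \<in> N x" "B \<subseteq> T" using T by blast
    obtain C where "C \<in> N x" "C \<subseteq> A \<inter> B" using assms A(1) B(1) by metis
    then show "\<exists>B\<in>N x. B \<subseteq> S \<inter> T" using A(2) B(2) by blast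
  next
    fix \<U> assume U: "\<forall>K\<in>\<U>. K \<subseteq> X \<and> (\<forall>x\<in>K. \<exists>B\<in>N x. B \<subseteq> K)"
    then show "\<Union>\<U> \<subseteq> X" by blast
    fix x assume "x \<in> \<Union>\<U>"
    then obtain K where K: "K \<in> \<U>" "x \<in> K" by blast
    then obtain B where "B \<in> N x" "B \<subseteq> K" using U by metis
    then show "\<exists>B\<in>N x. B \<subseteq> \<Union>\<U>" using K by blast
  qed
  then show ?thesis
    by (simp add: nbhd_topology_def topology_inverse')
qed

lemma topspace_nbhd_topology:
  assumes "\<forall>x. \<forall>A\<in>N x. \<forall>B\<in>N x. \<exists>C\<in>N x. C \<subseteq> A \<inter> B"
    and "\<And>x. N x \<noteq> {}" and "\<And>x B. B \<in> N x \<Longrightarrow> B \<subseteq> X"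
  shows "topspace (nbhd_topology X N) = X"
proof
  show "topspace (nbhd_topology X N) \<subseteq> X"
    using openin_topspace[of "nbhd_topology X N"] unfolding openin_nbhd_topology[OF assms(1)] by simp
  have "openin (nbhd_topology X N) X"
    unfolding openin_nbhd_topology[OF assms(1)] using assms(2,3) by (meson all_not_in_conv order_refl)
  then show "X \<subseteq> topspace (nbhd_topology X N)"
    by (rule openin_subset)
qed

text \<open>Elements of the Ellis semigroup are maps of \<open>topspace X\<close> that are \<open>undefined\<close>
  outside \<open>topspace X\<close>, as are all points of \<^const>\<open>product_topology\<close>.\<close>

definition ellis_semigroup :: "'x topology \<Rightarrow> ('t \<Rightarrow> 'x \<Rightarrow> 'x) \<Rightarrow> 't set \<Rightarrow> ('x \<Rightarrow> 'x) set" where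
  "ellis_semigroup X act T =
     product_topology (\<lambda>_. X) (topspace X) closure_of ((\<lambda>t. restrict (act t) (topspace X)) ` T)"

definition ellis_topology :: "'x topology \<Rightarrow> ('t \<Rightarrow> 'x \<Rightarrow> 'x) \<Rightarrow> 't set \<Rightarrow> ('x \<Rightarrow> 'x) topology" where
  "ellis_topology X act T =
     subtopology (product_topology (\<lambda>_. X) (topspace X)) (ellis_semigroup X act T)"


section \<open>Cut and project schemes\<close>

definition torus_class :: "('a::ab_group_add \<times> 'b::ab_group_add) set \<Rightarrow> 'a \<Rightarrow> 'b \<Rightarrow> ('a \<times> 'b) set" where
  "torus_class \<Sigma> w t = {(w, t) + \<sigma> |\<sigma>. \<sigma> \<in> \<Sigma>}"

definition torus :: "('a::ab_group_add \<times> 'b::ab_group_add) set \<Rightarrow> ('a \<times> 'b) set set" where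
  "torus \<Sigma> = {torus_class \<Sigma> w t |w t. True}"

definition torus_add :: "('a::ab_group_add \<times> 'b::ab_group_add) set \<Rightarrow> ('a \<times> 'b) set \<Rightarrow> ('a \<times> 'b) set" where
  "torus_add z z' = {p + q |p q. p \<in> z \<and> q \<in> z'}"

text \<open>The quotient topology.\<close>

definition torus_topology :: "('a::euclidean_space \<times> 'b::euclidean_space) set \<Rightarrow> ('a \<times> 'b) set topology" where
  "torus_topology \<Sigma> =
     topology (\<lambda>U. U \<subseteq> torus \<Sigma> \<and> open {(w, t). torus_class \<Sigma> w t \<in> U})"

lemma openin_torus_topology:
  "openin (torus_topology \<Sigma>) U \<longleftrightarrow> U \<subseteq> torus \<Sigma> \<and> open {(w, t). torus_class \<Sigma> w t \<in> U}"
proof -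
  have "istopology (\<lambda>U. U \<subseteq> torus \<Sigma> \<and> open {(w, t). torus_class \<Sigma> w t \<in> U})"
    unfolding istopology_def
  proof (intro conjI allI impI)
    fix S T
    assume S: "S \<subseteq> torus \<Sigma> \<and> open {(w, t). torus_class \<Sigma> w t \<in> S}"
      and T: "T \<subseteq> torus \<Sigma> \<and> open {(w, t). torus_class \<Sigma> w t \<in> T}"
    show "S \<inter> T \<subseteq> torus \<Sigma>" using S by blast
    have "{(w, t). torus_class \<Sigma> w t \<in> S \<inter> T} =
        {(w, t). torus_class \<Sigma> w t \<in> S} \<inter> {(w, t). torus_class \<Sigma> w t \<in> T}" by blast
    then show "open {(w, t). torus_class \<Sigma> w t \<in> S \<inter> T}" using S T by (simp add: open_Int)
  next
    fix \<U>
    assume U: "\<forall>K\<in>\<U>. K \<subseteq> torus \<Sigma> \<and> open {(w, t). torus_class \<Sigma> w t \<in> K}"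
    show "\<Union>\<U> \<subseteq> torus \<Sigma>" using U by blast
    have "{(w, t). torus_class \<Sigma> w t \<in> \<Union>\<U>} = (\<Union>K\<in>\<U>. {(w, t). torus_class \<Sigma> w t \<in> K})" by blast
    then show "open {(w, t). torus_class \<Sigma> w t \<in> \<Union>\<U>}" using U by (simp add: open_UN)
  qed
  then show ?thesis by (simp add: torus_topology_def topology_inverse')
qed

definition lattice_subgroup :: "('a::euclidean_space \<times> 'b::euclidean_space) set \<Rightarrow> bool" where
  "lattice_subgroup \<Sigma> \<longleftrightarrow>
     0 \<in> \<Sigma> \<and> (\<forall>x\<in>\<Sigma>. \<forall>y\<in>\<Sigma>. x - y \<in> \<Sigma>) \<and> discrete \<Sigma> \<and> compact_space (torus_topology \<Sigma>)"

text \<open>In a pair belonging to \<open>\<Sigma>\<close>, the first component is the internal one and the second the physical one.\<close>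

definition cut_and_project :: "((real^'n) \<times> (real^'d)) set \<Rightarrow> bool" where
  "cut_and_project \<Sigma> \<longleftrightarrow>
     lattice_subgroup \<Sigma> \<and> inj_on snd \<Sigma> \<and> closure (fst ` \<Sigma>) = UNIV"

definition Gam :: "((real^'n) \<times> (real^'d)) set \<Rightarrow> (real^'d) set" where
  "Gam \<Sigma> = snd ` \<Sigma>"

definition star :: "((real^'n) \<times> (real^'d)) set \<Rightarrow> real^'d \<Rightarrow> real^'n" where
  "star \<Sigma> \<gamma> = (THE w. (w, \<gamma>) \<in> \<Sigma>)"

definition Gam_star :: "((real^'n) \<times> (real^'d)) set \<Rightarrow> (real^'n) set" where
  "Gam_star \<Sigma> = star \<Sigma> ` Gam \<Sigma>"

definition point_set :: "((real^'n) \<times> (real^'d)) set \<Rightarrow> (real^'n) set \<Rightarrow> (real^'d) set" where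
  "point_set \<Sigma> A = {\<gamma> \<in> Gam \<Sigma>. star \<Sigma> \<gamma> \<in> A}"

definition translate :: "'a::ab_group_add set \<Rightarrow> 'a \<Rightarrow> 'a set" where
  "translate A x = (\<lambda>y. y + x) ` A"

definition window :: "(real^'n) set \<Rightarrow> bool" where
  "window W \<longleftrightarrow> polytope W \<and> aff_dim W = int CARD('n)"


section \<open>The hull\<close>

definition NS :: "((real^'n) \<times> (real^'d)) set \<Rightarrow> (real^'n) set \<Rightarrow> (real^'n) set" where
  "NS \<Sigma> W = - {x - y |x y. x \<in> Gam_star \<Sigma> \<and> y \<in> frontier W}"

definition language :: "(real^'d) set \<Rightarrow> (real^'d) set set" where
  "language \<Lambda> = {translate \<Lambda> (- x) \<inter> ball 0 R |x R. x \<in> \<Lambda> \<and> R > 0}"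

text \<open>All nonsingular model sets have the same language, so the union is the language of each of them.\<close>

definition language_NS :: "((real^'n) \<times> (real^'d)) set \<Rightarrow> (real^'n) set \<Rightarrow> (real^'d) set set" where
  "language_NS \<Sigma> W =
     (\<Union>w\<in>NS \<Sigma> W. \<Union>t. language (translate (point_set \<Sigma> (translate W w)) (- t)))"

definition hull_space :: "((real^'n) \<times> (real^'d)) set \<Rightarrow> (real^'n) set \<Rightarrow> (real^'d) set set" where
  "hull_space \<Sigma> W = {\<Lambda>. language \<Lambda> = language_NS \<Sigma> W}"

definition hull_nbhds :: "((real^'n) \<times> (real^'d)) set \<Rightarrow> (real^'n) set \<Rightarrow> (real^'d) set \<Rightarrow> (real^'d) set set set" where
  "hull_nbhds \<Sigma> W \<Lambda> =
     {{\<Lambda>' \<in> hull_space \<Sigma> W. \<exists>t t'. norm t < \<epsilon> \<and> norm t' < \<epsilon> \<and>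
         translate \<Lambda> (- t) \<inter> K = translate \<Lambda>' (- t') \<inter> K} |K \<epsilon>. compact K \<and> \<epsilon> > 0}"

definition hull_topology :: "((real^'n) \<times> (real^'d)) set \<Rightarrow> (real^'n) set \<Rightarrow> (real^'d) set topology" where
  "hull_topology \<Sigma> W = nbhd_topology (hull_space \<Sigma> W) (hull_nbhds \<Sigma> W)"

lemma hull_nbhds_directed:
  "\<forall>\<Lambda>. \<forall>A\<in>hull_nbhds \<Sigma> W \<Lambda>. \<forall>B\<in>hull_nbhds \<Sigma> W \<Lambda>. \<exists>C\<in>hull_nbhds \<Sigma> W \<Lambda>. C \<subseteq> A \<inter> B"
proof (intro allI ballI)
  fix \<Lambda> A B
  assume AB: "A \<in> hull_nbhds \<Sigma> W \<Lambda>" "B \<in> hull_nbhds \<Sigma> W \<Lambda>"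
  define N where "N K \<epsilon> = {\<Lambda>' \<in> hull_space \<Sigma> W. \<exists>t t'. norm t < \<epsilon> \<and> norm t' < \<epsilon> \<and>
         translate \<Lambda> (- t) \<inter> K = translate \<Lambda>' (- t') \<inter> K}" for K and \<epsilon> :: real
  obtain K \<epsilon> L \<delta> where *: "compact K" "\<epsilon> > 0" "A = N K \<epsilon>" "compact L" "\<delta> > 0" "B = N L \<delta>"
    using AB unfolding hull_nbhds_def N_def by blast
  have "N (K \<union> L) (min \<epsilon> \<delta>) \<in> hull_nbhds \<Sigma> W \<Lambda>"
    unfolding hull_nbhds_def N_def using * by (intro CollectI exI[of _ "K \<union> L"] exI[of _ "min \<epsilon> \<delta>"]) auto
  moreover have "N (K \<union> L) (min \<epsilon> \<delta>) \<subseteq> N K \<epsilon> \<inter> N L \<delta>"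
  proof
    fix \<Lambda>' assume "\<Lambda>' \<in> N (K \<union> L) (min \<epsilon> \<delta>)"
    then obtain t t' where "\<Lambda>' \<in> hull_space \<Sigma> W" "norm t < \<epsilon>" "norm t < \<delta>" "norm t' < \<epsilon>" "norm t' < \<delta>"
      and "translate \<Lambda> (- t) \<inter> (K \<union> L) = translate \<Lambda>' (- t') \<inter> (K \<union> L)"
      unfolding N_def by auto
    moreover from this(6) have "translate \<Lambda> (- t) \<inter> K = translate \<Lambda>' (- t') \<inter> K"
      and "translate \<Lambda> (- t) \<inter> L = translate \<Lambda>' (- t') \<inter> L" by blast+
    ultimately show "\<Lambda>' \<in> N K \<epsilon> \<inter> N L \<delta>" unfolding N_def by blast
  qed
  ultimately show "\<exists>C\<in>hull_nbhds \<Sigma> W \<Lambda>. C \<subseteq> A \<inter> B" using * by blast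
qed

lemmas openin_hull_topology =
  openin_nbhd_topology[of "hull_nbhds \<Sigma> W" "hull_space \<Sigma> W" for \<Sigma> W,
    OF hull_nbhds_directed, folded hull_topology_def]

lemma topspace_hull_topology: "topspace (hull_topology \<Sigma> W) = hull_space \<Sigma> W"
  unfolding hull_topology_def
proof (rule topspace_nbhd_topology[OF hull_nbhds_directed])
  show "hull_nbhds \<Sigma> W x \<noteq> {}" for x
    unfolding hull_nbhds_def using compact_empty zero_less_one by blast
qed (auto simp: hull_nbhds_def)

definition hull_param :: "((real^'n) \<times> (real^'d)) set \<Rightarrow> (real^'n) set \<Rightarrow> (real^'d) set \<Rightarrow> ((real^'n) \<times> (real^'d)) set" where
  "hull_param \<Sigma> W \<Lambda> = (THE z. \<exists>w t. z = torus_class \<Sigma> w t \<and>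
     translate (point_set \<Sigma> (translate (interior W) w)) (- t) \<subseteq> \<Lambda> \<and>
     \<Lambda> \<subseteq> translate (point_set \<Sigma> (translate W w)) (- t))"


section \<open>The internal system\<close>

definition Xi :: "((real^'n) \<times> (real^'d)) set \<Rightarrow> (real^'n) set \<Rightarrow> (real^'d) set set" where
  "Xi \<Sigma> W = {\<Lambda> \<in> hull_space \<Sigma> W. \<Lambda> \<subseteq> Gam \<Sigma>}"

definition Xi_nbhds :: "((real^'n) \<times> (real^'d)) set \<Rightarrow> (real^'n) set \<Rightarrow> (real^'d) set \<Rightarrow> (real^'d) set set set" where
  "Xi_nbhds \<Sigma> W \<Lambda> = {{\<Lambda>' \<in> Xi \<Sigma> W. \<Lambda> \<inter> K = \<Lambda>' \<inter> K} |K. compact K}"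

definition Xi_topology :: "((real^'n) \<times> (real^'d)) set \<Rightarrow> (real^'n) set \<Rightarrow> (real^'d) set topology" where
  "Xi_topology \<Sigma> W = nbhd_topology (Xi \<Sigma> W) (Xi_nbhds \<Sigma> W)"

lemma Xi_nbhds_directed:
  "\<forall>\<Lambda>. \<forall>A\<in>Xi_nbhds \<Sigma> W \<Lambda>. \<forall>B\<in>Xi_nbhds \<Sigma> W \<Lambda>. \<exists>C\<in>Xi_nbhds \<Sigma> W \<Lambda>. C \<subseteq> A \<inter> B"
proof (intro allI ballI)
  fix \<Lambda> A B
  assume AB: "A \<in> Xi_nbhds \<Sigma> W \<Lambda>" "B \<in> Xi_nbhds \<Sigma> W \<Lambda>"
  obtain K L where *: "compact K" "A = {\<Lambda>' \<in> Xi \<Sigma> W. \<Lambda> \<inter> K = \<Lambda>' \<inter> K}"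
      "compact L" "B = {\<Lambda>' \<in> Xi \<Sigma> W. \<Lambda> \<inter> L = \<Lambda>' \<inter> L}"
    using AB unfolding Xi_nbhds_def by blast
  have "{\<Lambda>' \<in> Xi \<Sigma> W. \<Lambda> \<inter> (K \<union> L) = \<Lambda>' \<inter> (K \<union> L)} \<in> Xi_nbhds \<Sigma> W \<Lambda>"
    unfolding Xi_nbhds_def using * by (intro CollectI exI[of _ "K \<union> L"]) auto
  moreover have "{\<Lambda>' \<in> Xi \<Sigma> W. \<Lambda> \<inter> (K \<union> L) = \<Lambda>' \<inter> (K \<union> L)} \<subseteq> A \<inter> B"
    unfolding * by blast
  ultimately show "\<exists>C\<in>Xi_nbhds \<Sigma> W \<Lambda>. C \<subseteq> A \<inter> B" by blast
qed

lemmas openin_Xi_topology =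
  openin_nbhd_topology[of "Xi_nbhds \<Sigma> W" "Xi \<Sigma> W" for \<Sigma> W,
    OF Xi_nbhds_directed, folded Xi_topology_def]

lemma topspace_Xi_topology: "topspace (Xi_topology \<Sigma> W) = Xi \<Sigma> W"
  unfolding Xi_topology_def
proof (rule topspace_nbhd_topology[OF Xi_nbhds_directed])
  show "Xi_nbhds \<Sigma> W x \<noteq> {}" for x
    unfolding Xi_nbhds_def using compact_empty by blast
qed (auto simp: Xi_nbhds_def)

definition Xi_param :: "((real^'n) \<times> (real^'d)) set \<Rightarrow> (real^'n) set \<Rightarrow> (real^'d) set \<Rightarrow> real^'n" where
  "Xi_param \<Sigma> W \<Lambda> = (THE w. point_set \<Sigma> (translate (interior W) w) \<subseteq> \<Lambda> \<and>
     \<Lambda> \<subseteq> point_set \<Sigma> (translate W w))"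

definition Xi_closure :: "((real^'n) \<times> (real^'d)) set \<Rightarrow> (real^'n) set \<Rightarrow> (real^'n) set \<Rightarrow> (real^'d) set set" where
  "Xi_closure \<Sigma> W A =
     Xi_topology \<Sigma> W closure_of ((\<lambda>w. point_set \<Sigma> (translate W w)) ` (A \<inter> NS \<Sigma> W))"


section \<open>Almost canonical windows\<close>

definition window_facets :: "(real^'n) set \<Rightarrow> (real^'n) set set" where
  "window_facets W = {f. f facet_of (uminus ` W)}"

definition facet_dir :: "(real^'n) set \<Rightarrow> (real^'n) set" where
  "facet_dir f = {x - y |x y. x \<in> affine hull f \<and> y \<in> affine hull f}"

definition hyperplanes :: "(real^'n) set \<Rightarrow> (real^'n) set set" where
  "hyperplanes W = facet_dir ` window_facets W"

text \<open>An orientation of the linear hyperplanes is given by choosing a normal vector, pointing to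
  the positive side, for each of them.\<close>

definition orientation :: "((real^'n) set \<Rightarrow> real^'n) \<Rightarrow> bool" where
  "orientation \<nu> \<longleftrightarrow>
     (\<forall>H. subspace H \<and> dim H + 1 = CARD('n) \<longrightarrow> \<nu> H \<noteq> 0 \<and> H = {x. \<nu> H \<bullet> x = 0})"

datatype symb = S_minus | S_zero | S_plus | S_inf

text \<open>The symbol \<^const>\<open>S_inf\<close> only occurs as a value of cut types; the last equation is a placeholder that no definition uses.\<close>

fun half :: "((real^'n) set \<Rightarrow> real^'n) \<Rightarrow> (real^'n) set \<Rightarrow> symb \<Rightarrow> (real^'n) set" where
  "half \<nu> H S_minus = {x. \<nu> H \<bullet> x < 0}"
| "half \<nu> H S_zero = H"
| "half \<nu> H S_plus = {x. \<nu> H \<bullet> x > 0}"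
| "half \<nu> H S_inf = UNIV"

definition affine_half :: "((real^'n) set \<Rightarrow> real^'n) \<Rightarrow> (real^'n) set \<Rightarrow> symb \<Rightarrow> (real^'n) set" where
  "affine_half \<nu> f s = {a + x |a x. a \<in> affine hull f \<and> x \<in> half \<nu> (facet_dir f) s}"

definition Stab :: "((real^'n) \<times> (real^'d)) set \<Rightarrow> (real^'n) set \<Rightarrow> (real^'d) set" where
  "Stab \<Sigma> f = {\<gamma> \<in> Gam \<Sigma>. star \<Sigma> \<gamma> \<in> facet_dir f}"

definition almost_canonical ::
  "((real^'n) \<times> (real^'d)) set \<Rightarrow> (real^'n) set \<Rightarrow> ((real^'n) set \<Rightarrow> real^'n) \<Rightarrow> bool" where
  "almost_canonical \<Sigma> W \<nu> \<longleftrightarrow>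
     (\<forall>f\<in>window_facets W. affine hull f \<subseteq> {star \<Sigma> \<gamma> + x |\<gamma> x. \<gamma> \<in> Stab \<Sigma> f \<and> x \<in> f}) \<and>
     (\<forall>\<gamma>\<in>Gam \<Sigma>. \<forall>f\<in>window_facets W. \<forall>s\<in>{S_minus, S_plus}.
        openin (Xi_topology \<Sigma> W) (Xi_closure \<Sigma> W (translate (affine_half \<nu> f s) (star \<Sigma> \<gamma>))) \<and>
        closedin (Xi_topology \<Sigma> W) (Xi_closure \<Sigma> W (translate (affine_half \<nu> f s) (star \<Sigma> \<gamma>))))"


section \<open>Cut types\<close>

definition cuts :: "((real^'n) \<times> (real^'d)) set \<Rightarrow> (real^'n) set \<Rightarrow> real^'n \<Rightarrow> (real^'n) set set" where
  "cuts \<Sigma> W w = {H \<in> hyperplanes W. \<exists>f\<in>window_facets W. facet_dir f = H \<and>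
     w \<in> {x + a |x a. x \<in> Gam_star \<Sigma> \<and> a \<in> affine hull f}}"

definition torus_cuts ::
  "((real^'n) \<times> (real^'d)) set \<Rightarrow> (real^'n) set \<Rightarrow> ((real^'n) \<times> (real^'d)) set \<Rightarrow> (real^'n) set set" where
  "torus_cuts \<Sigma> W z = (THE C. \<exists>w t. z = torus_class \<Sigma> w t \<and> C = cuts \<Sigma> W w)"

definition Xi_cut_type ::
  "((real^'n) \<times> (real^'d)) set \<Rightarrow> (real^'n) set \<Rightarrow> ((real^'n) set \<Rightarrow> real^'n) \<Rightarrow>
   (real^'d) set \<Rightarrow> (real^'n) set \<Rightarrow> symb" where
  "Xi_cut_type \<Sigma> W \<nu> \<Lambda> H =
     (if H \<in> cuts \<Sigma> W (Xi_param \<Sigma> W \<Lambda>)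
      then THE s. s \<in> {S_minus, S_plus} \<and>
             \<Lambda> \<in> Xi_closure \<Sigma> W (translate (half \<nu> H s) (Xi_param \<Sigma> W \<Lambda>))
      else S_inf)"

definition hull_cut_type ::
  "((real^'n) \<times> (real^'d)) set \<Rightarrow> (real^'n) set \<Rightarrow> ((real^'n) set \<Rightarrow> real^'n) \<Rightarrow>
   (real^'d) set \<Rightarrow> (real^'n) set \<Rightarrow> symb" where
  "hull_cut_type \<Sigma> W \<nu> \<Lambda>\<^sub>0 H =
     (THE s. \<exists>\<Lambda>\<in>Xi \<Sigma> W. \<exists>t. \<Lambda>\<^sub>0 = translate \<Lambda> (- t) \<and> s = Xi_cut_type \<Sigma> W \<nu> \<Lambda> H)"


section \<open>Ellis semigroups\<close>

text \<open>The two actions have opposite sign conventions: \<open>\<Lambda>.t = \<Lambda> - t\<close> for \<open>t\<close> in the physical space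
  acting on the hull, and \<open>\<Lambda>.\<gamma> = \<Lambda> + \<gamma>\<close> on the internal system.\<close>

definition hull_ellis :: "((real^'n) \<times> (real^'d)) set \<Rightarrow> (real^'n) set \<Rightarrow> ((real^'d) set \<Rightarrow> (real^'d) set) set" where
  "hull_ellis \<Sigma> W = ellis_semigroup (hull_topology \<Sigma> W) (\<lambda>t \<Lambda>. translate \<Lambda> (- t)) UNIV"

definition Xi_ellis :: "((real^'n) \<times> (real^'d)) set \<Rightarrow> (real^'n) set \<Rightarrow> ((real^'d) set \<Rightarrow> (real^'d) set) set" where
  "Xi_ellis \<Sigma> W = ellis_semigroup (Xi_topology \<Sigma> W) (\<lambda>\<gamma> \<Lambda>. translate \<Lambda> \<gamma>) (Gam \<Sigma>)"

definition ellis_closure ::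
  "((real^'n) \<times> (real^'d)) set \<Rightarrow> (real^'n) set \<Rightarrow> (real^'n) set \<Rightarrow> ((real^'d) set \<Rightarrow> (real^'d) set) set" where
  "ellis_closure \<Sigma> W A =
     ellis_topology (Xi_topology \<Sigma> W) (\<lambda>\<gamma> \<Lambda>. translate \<Lambda> \<gamma>) (Gam \<Sigma>) closure_of
       ((\<lambda>\<gamma>. restrict (\<lambda>\<Lambda>. translate \<Lambda> \<gamma>) (Xi \<Sigma> W)) ` {\<gamma> \<in> Gam \<Sigma>. star \<Sigma> \<gamma> \<in> A})"

text \<open>The morphisms from the Ellis semigroups onto the internal space and onto the torus are
  determined by their equivariance.\<close>

definition Xi_ellis_param ::
  "((real^'n) \<times> (real^'d)) set \<Rightarrow> (real^'n) set \<Rightarrow> ((real^'d) set \<Rightarrow> (real^'d) set) \<Rightarrow> real^'n" where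
  "Xi_ellis_param \<Sigma> W g = (THE w. \<forall>\<Lambda>\<in>Xi \<Sigma> W. Xi_param \<Sigma> W (g \<Lambda>) = Xi_param \<Sigma> W \<Lambda> + w)"

definition hull_ellis_param ::
  "((real^'n) \<times> (real^'d)) set \<Rightarrow> (real^'n) set \<Rightarrow> ((real^'d) set \<Rightarrow> (real^'d) set) \<Rightarrow>
   ((real^'n) \<times> (real^'d)) set" where
  "hull_ellis_param \<Sigma> W g = (THE z. z \<in> torus \<Sigma> \<and>
     (\<forall>\<Lambda>\<in>hull_space \<Sigma> W. hull_param \<Sigma> W (g \<Lambda>) = torus_add (hull_param \<Sigma> W \<Lambda>) z))"

definition Xi_cone_type ::
  "((real^'n) \<times> (real^'d)) set \<Rightarrow> (real^'n) set \<Rightarrow> ((real^'n) set \<Rightarrow> real^'n) \<Rightarrow>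
   ((real^'d) set \<Rightarrow> (real^'d) set) \<Rightarrow> (real^'n) set \<Rightarrow> symb" where
  "Xi_cone_type \<Sigma> W \<nu> g H = (THE s. s \<in> {S_minus, S_zero, S_plus} \<and>
     g \<in> ellis_closure \<Sigma> W (translate (half \<nu> H s) (Xi_ellis_param \<Sigma> W g)))"

definition ellis_extend ::
  "((real^'n) \<times> (real^'d)) set \<Rightarrow> (real^'n) set \<Rightarrow> ((real^'d) set \<Rightarrow> (real^'d) set) \<Rightarrow>
   (real^'d) set \<Rightarrow> (real^'d) set" where
  "ellis_extend \<Sigma> W g = (\<lambda>\<Lambda>\<^sub>0\<in>hull_space \<Sigma> W.
     THE \<Lambda>\<^sub>1. \<exists>\<Lambda>\<in>Xi \<Sigma> W. \<exists>t. \<Lambda>\<^sub>0 = translate \<Lambda> (- t) \<and> \<Lambda>\<^sub>1 = translate (g \<Lambda>) (- t))"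

definition hull_cone_type ::
  "((real^'n) \<times> (real^'d)) set \<Rightarrow> (real^'n) set \<Rightarrow> ((real^'n) set \<Rightarrow> real^'n) \<Rightarrow>
   ((real^'d) set \<Rightarrow> (real^'d) set) \<Rightarrow> (real^'n) set \<Rightarrow> symb" where
  "hull_cone_type \<Sigma> W \<nu> g H = (THE s. \<exists>h\<in>Xi_ellis \<Sigma> W. \<exists>r.
     g = (\<lambda>\<Lambda>\<in>hull_space \<Sigma> W. translate (ellis_extend \<Sigma> W h \<Lambda>) (- r)) \<and> s = Xi_cone_type \<Sigma> W \<nu> h H)"

definition symb_mult :: "((real^'n) set \<Rightarrow> symb) \<Rightarrow> ((real^'n) set \<Rightarrow> symb) \<Rightarrow> (real^'n) set \<Rightarrow> symb" where
  "symb_mult c t H = (if t H = S_zero then c H else t H)"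

end

theory Submission
  imports Defs "HOL-Complex_Analysis.Great_Picard"
begin

text \<open>Every element of the hull is, up to translation, a local limit of nonsingular model sets
  \<open>\<PP>(v + W)\<close> with \<open>v \<rightarrow> w\<close>, and closures in \<open>\<Xi>\<^sup>\<Gamma>\<close> and in its Ellis semigroup can be tested on finitely
  many points and one compact set. If \<open>\<gamma> \<rightarrow> g\<close> with \<open>\<gamma>\<^sup>* \<in> w\<^sub>g + H\<^sup>\<plusminus>\<close>, then \<open>\<Lambda> + \<gamma>\<close> has its parameter in the open
  half-space \<open>w\<^sub>\<Lambda> + w\<^sub>g + H\<^sup>\<plusminus>\<close>, so the limit \<open>\<Lambda>.g\<close> has cut type \<open>\<plusminus>\<close> at \<open>H\<close>; if \<open>\<gamma>\<^sup>* \<in> w\<^sub>g + H\<close>, translating by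
  \<open>\<gamma>\<close> preserves the side of \<open>H\<close> on which \<open>\<Lambda>\<close> lies, so the cut type of \<open>\<Lambda>\<close> survives. An element of the Ellis
  semigroup of the hull is reduced to this case by splitting it as \<open>g - r\<close>; uniform continuity of the
  parameter, from cocompactness of \<open>\<Sigma>\<close>, and discreteness of \<open>\<Sigma>\<close> provide the splitting.\<close>

section \<open>Cut and project schemes\<close>

text \<open>Every invariant in the statement is a definite description, so it carries information
  only once the described object is known to exist and to be unique. For parameters, uniqueness is
  the rigidity of a compact set under translation. For cut types it is the fact that the two
  closures at a cut exhaust \<open>Xi\<close> and are disjoint; the first condition of
  \<open>almost_canonical\<close> gives exhaustion, the second disjointness. For cone types it is a
  test on a suitable point, and for whatever is read off a representative modulo \<Sigma> or off a
  decomposition \<open>translate L (- t)\<close> it is invariance under \<Gamma>.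

  The inclusions \<open>sandwich\<close> fix the parameter but leave open which points over the
  boundary of the window belong to \<Lambda>, and the cut type depends on precisely these. This is
  why elements of the hull are handled through the stronger relation \<open>approx\<close>.

  On the internal system one \<gamma> imitates an Ellis element exactly on finitely many points and
  a compact set. On the hull the imitating translation may be wrong by a different small vector at
  each point; getting rid of these individual errors is the point of the splitting
  \<open>g = h - r\<close>.\<close>

lemma mem_translate: "y \<in> translate A x \<longleftrightarrow> y - x \<in> A" for A :: "'a::ab_group_add set"
  unfolding translate_def by (force simp: image_iff)

lemma translate_translate [simp]: "translate (translate A x) y = translate A (x + y)"
  by (auto simp: mem_translate algebra_simps)

lemma translate_0 [simp]: "translate A 0 = A"
  by (auto simp: mem_translate)

locale cut_project =
  fixes \<Sigma> :: "((real^'n) \<times> (real^'d)) set"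
  assumes cps: "cut_and_project \<Sigma>"
begin

section \<open>Group structure of the lattice and the star map\<close>

lemma Sigma_zero: "0 \<in> \<Sigma>" and Sigma_diff: "\<And>x y. x \<in> \<Sigma> \<Longrightarrow> y \<in> \<Sigma> \<Longrightarrow> x - y \<in> \<Sigma>"
  and Sigma_discrete: "discrete \<Sigma>" and compact_torus: "compact_space (torus_topology \<Sigma>)"
  and inj_snd: "inj_on snd \<Sigma>" and dense_fst: "closure (fst ` \<Sigma>) = UNIV"
  using cps unfolding cut_and_project_def lattice_subgroup_def by auto

lemma Sigma_minus: "x \<in> \<Sigma> \<Longrightarrow> - x \<in> \<Sigma>"
  using Sigma_diff[OF Sigma_zero] by fastforce

lemma Sigma_add: "x \<in> \<Sigma> \<Longrightarrow> y \<in> \<Sigma> \<Longrightarrow> x + y \<in> \<Sigma>"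
  using Sigma_diff[OF _ Sigma_minus] by fastforce

lemma star_eq: "(w, \<gamma>) \<in> \<Sigma> \<Longrightarrow> star \<Sigma> \<gamma> = w"
  unfolding star_def using inj_onD[OF inj_snd, of "(w, \<gamma>)"] by (intro the_equality) force+

lemma Gam_iff: "\<gamma> \<in> Gam \<Sigma> \<longleftrightarrow> (star \<Sigma> \<gamma>, \<gamma>) \<in> \<Sigma>"
  unfolding Gam_def using star_eq by force

lemma Gam_zero [simp]: "0 \<in> Gam \<Sigma>" and star_zero [simp]: "star \<Sigma> 0 = 0"
  using Sigma_zero star_eq[of 0 0] unfolding Gam_iff by (auto simp: zero_prod_def)

lemma
  assumes "\<gamma> \<in> Gam \<Sigma>" "\<delta> \<in> Gam \<Sigma>"
  shows Gam_diff [simp]: "\<gamma> - \<delta> \<in> Gam \<Sigma>" and star_diff: "star \<Sigma> (\<gamma> - \<delta>) = star \<Sigma> \<gamma> - star \<Sigma> \<delta>"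
proof -
  have "(star \<Sigma> \<gamma> - star \<Sigma> \<delta>, \<gamma> - \<delta>) \<in> \<Sigma>"
    using Sigma_diff assms unfolding Gam_iff by fastforce
  then show "\<gamma> - \<delta> \<in> Gam \<Sigma>" "star \<Sigma> (\<gamma> - \<delta>) = star \<Sigma> \<gamma> - star \<Sigma> \<delta>"
    using star_eq unfolding Gam_iff by auto
qed

lemma
  assumes "\<gamma> \<in> Gam \<Sigma>"
  shows Gam_minus [simp]: "- \<gamma> \<in> Gam \<Sigma>" and star_minus: "star \<Sigma> (- \<gamma>) = - star \<Sigma> \<gamma>"
  using Gam_diff[OF Gam_zero assms] star_diff[OF Gam_zero assms] by auto

lemma
  assumes "\<gamma> \<in> Gam \<Sigma>" "\<delta> \<in> Gam \<Sigma>"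
  shows Gam_add [simp]: "\<gamma> + \<delta> \<in> Gam \<Sigma>" and star_add: "star \<Sigma> (\<gamma> + \<delta>) = star \<Sigma> \<gamma> + star \<Sigma> \<delta>"
  using Gam_diff[OF assms(1) Gam_minus[OF assms(2)]] star_diff[OF assms(1) Gam_minus[OF assms(2)]]
    star_minus[OF assms(2)] by auto

lemma Sigma_separated: obtains e where "e > 0" "\<And>x. x \<in> \<Sigma> \<Longrightarrow> norm x < e \<Longrightarrow> x = 0"
proof -
  have "0 isolated_in \<Sigma>"
    using Sigma_discrete Sigma_zero unfolding discrete_def by blast
  then obtain e where "e > 0" "\<forall>y\<in>\<Sigma>. dist 0 y < e \<longrightarrow> y = 0"
    unfolding isolated_in_dist_Ex_iff by blast
  then show ?thesis using that by simp
qed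

lemma Sigma_uniform_discrete: "uniform_discrete \<Sigma>"
proof -
  obtain e where e: "e > 0" "\<And>x. x \<in> \<Sigma> \<Longrightarrow> norm x < e \<Longrightarrow> x = 0" using Sigma_separated by blast
  then have "\<forall>x\<in>\<Sigma>. \<forall>y\<in>\<Sigma>. dist x y < e \<longrightarrow> x = y"
    using Sigma_diff unfolding dist_norm by (metis right_minus_eq)
  then show ?thesis unfolding uniform_discrete_def using e by blast
qed

lemma closed_Sigma: "closed \<Sigma>"
  using Sigma_uniform_discrete uniform_discrete_imp_closed by blast

text \<open>An infinite bounded piece of \<Sigma> would accumulate somewhere, and necessarily at a
  point of \<Sigma> because \<Sigma> is closed; discreteness excludes this.\<close>

lemma finite_Sigma_bounded: assumes "bounded A" shows "finite (\<Sigma> \<inter> A)"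
proof (rule ccontr)
  assume inf: "infinite (\<Sigma> \<inter> A)"
  have "compact (closure A)" using assms by simp
  moreover have "\<Sigma> \<inter> A \<subseteq> closure A" using closure_subset by blast
  ultimately obtain x where "x islimpt (\<Sigma> \<inter> A)"
    using Heine_Borel_imp_Bolzano_Weierstrass inf by metis
  then have "x islimpt \<Sigma>" using islimpt_subset by blast
  moreover have "x \<in> \<Sigma>" using closed_Sigma \<open>x islimpt \<Sigma>\<close> closed_limpt by blast
  ultimately show False using Sigma_discrete unfolding discrete_def isolated_in_islimpt_iff by blast
qed

lemma finite_Gam_bounded:
  assumes "bounded A" "bounded B" shows "finite {\<gamma> \<in> Gam \<Sigma>. \<gamma> \<in> B \<and> star \<Sigma> \<gamma> \<in> A}"
proof -
  have "{\<gamma> \<in> Gam \<Sigma>. \<gamma> \<in> B \<and> star \<Sigma> \<gamma> \<in> A} \<subseteq> snd ` (\<Sigma> \<inter> A \<times> B)"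
    unfolding Gam_iff by force
  moreover have "finite (snd ` (\<Sigma> \<inter> A \<times> B))"
    by (intro finite_imageI finite_Sigma_bounded bounded_Times assms)
  ultimately show ?thesis by (rule finite_subset)
qed

text \<open>Serves the null set argument of \<open>NS_dense\<close> and the diagonal subsequence of
  \<open>Xi_limit_of_models\<close>.\<close>

lemma countable_Gam: "countable (Gam \<Sigma>)"
proof -
  have "\<Sigma> = (\<Union>k::nat. \<Sigma> \<inter> ball 0 (real k))"
    by (auto simp: reals_Archimedean2)
  moreover have "countable (\<Union>k::nat. \<Sigma> \<inter> ball 0 (real k))"
    by (intro countable_UN) (auto intro: countable_finite finite_Sigma_bounded)
  ultimately show ?thesis unfolding Gam_def by simp
qed

lemma star_dense: assumes "open U" "U \<noteq> {}" obtains \<gamma> where "\<gamma> \<in> Gam \<Sigma>" "star \<Sigma> \<gamma> \<in> U"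
proof -
  have "U \<inter> fst ` \<Sigma> \<noteq> {}"
    using open_Int_closure_eq_empty[OF assms(1), of "fst ` \<Sigma>"] dense_fst assms(2) by simp
  then obtain w \<gamma> where "(w, \<gamma>) \<in> \<Sigma>" "w \<in> U" by force
  then show ?thesis using that[of \<gamma>] star_eq[of w \<gamma>] Gam_iff[of \<gamma>] by simp
qed

lemma star_dense_ball: assumes "e > 0" obtains \<gamma> where "\<gamma> \<in> Gam \<Sigma>" "norm (star \<Sigma> \<gamma> - w) < e"
proof -
  have "ball w e \<noteq> {}" using assms by simp
  then obtain \<gamma> where "\<gamma> \<in> Gam \<Sigma>" "star \<Sigma> \<gamma> \<in> ball w e" using star_dense[OF open_ball] by blast
  then show ?thesis using that[of \<gamma>] by (simp add: dist_norm norm_minus_commute)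
qed

section \<open>Torus classes and cocompactness\<close>

lemma torus_class_eq_iff: "torus_class \<Sigma> w t = torus_class \<Sigma> w' t' \<longleftrightarrow> (w - w', t - t') \<in> \<Sigma>"
proof
  assume "torus_class \<Sigma> w t = torus_class \<Sigma> w' t'"
  moreover have "(w, t) \<in> torus_class \<Sigma> w t" unfolding torus_class_def using Sigma_zero by force
  ultimately obtain \<sigma> where "\<sigma> \<in> \<Sigma>" "(w, t) = (w', t') + \<sigma>" unfolding torus_class_def by auto
  then show "(w - w', t - t') \<in> \<Sigma>" by (cases \<sigma>) auto
next
  assume *: "(w - w', t - t') \<in> \<Sigma>"
  have "torus_class \<Sigma> w t \<subseteq> torus_class \<Sigma> w' t'"
  proof
    fix x assume "x \<in> torus_class \<Sigma> w t"
    then obtain \<sigma> where "\<sigma> \<in> \<Sigma>" "x = (w, t) + \<sigma>" unfolding torus_class_def by auto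
    then have "x = (w', t') + ((w - w', t - t') + \<sigma>)" "(w - w', t - t') + \<sigma> \<in> \<Sigma>"
      using Sigma_add[OF * \<open>\<sigma> \<in> \<Sigma>\<close>] by (simp_all add: prod_eq_iff)
    then show "x \<in> torus_class \<Sigma> w' t'" unfolding torus_class_def by blast
  qed
  moreover have "torus_class \<Sigma> w' t' \<subseteq> torus_class \<Sigma> w t"
  proof
    fix x assume "x \<in> torus_class \<Sigma> w' t'"
    then obtain \<sigma> where "\<sigma> \<in> \<Sigma>" "x = (w', t') + \<sigma>" unfolding torus_class_def by auto
    then have "x = (w, t) + (\<sigma> - (w - w', t - t'))" "\<sigma> - (w - w', t - t') \<in> \<Sigma>"
      using Sigma_diff[OF \<open>\<sigma> \<in> \<Sigma>\<close> *] by (simp_all add: prod_eq_iff)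
    then show "x \<in> torus_class \<Sigma> w t" unfolding torus_class_def by blast
  qed
  ultimately show "torus_class \<Sigma> w t = torus_class \<Sigma> w' t'" by blast
qed

lemma torus_add_class:
  "torus_add (torus_class \<Sigma> w t) (torus_class \<Sigma> w' t') = torus_class \<Sigma> (w + w') (t + t')"
proof
  show "torus_add (torus_class \<Sigma> w t) (torus_class \<Sigma> w' t') \<subseteq> torus_class \<Sigma> (w + w') (t + t')"
  proof
    fix x assume "x \<in> torus_add (torus_class \<Sigma> w t) (torus_class \<Sigma> w' t')"
    then obtain \<sigma> \<tau> where "\<sigma> \<in> \<Sigma>" "\<tau> \<in> \<Sigma>" "x = ((w, t) + \<sigma>) + ((w', t') + \<tau>)"
      unfolding torus_add_def torus_class_def by blast
    moreover from this have "x = (w + w', t + t') + (\<sigma> + \<tau>)" by (auto simp: prod_eq_iff)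
    ultimately show "x \<in> torus_class \<Sigma> (w + w') (t + t')"
      unfolding torus_class_def using Sigma_add by blast
  qed
  show "torus_class \<Sigma> (w + w') (t + t') \<subseteq> torus_add (torus_class \<Sigma> w t) (torus_class \<Sigma> w' t')"
  proof
    fix x assume "x \<in> torus_class \<Sigma> (w + w') (t + t')"
    then obtain \<sigma> where "\<sigma> \<in> \<Sigma>" "x = (w + w', t + t') + \<sigma>" unfolding torus_class_def by auto
    moreover from this have "x = ((w, t) + 0) + ((w', t') + \<sigma>)" by (auto simp: prod_eq_iff)
    ultimately show "x \<in> torus_add (torus_class \<Sigma> w t) (torus_class \<Sigma> w' t')"
      unfolding torus_add_def torus_class_def using Sigma_zero by blast
  qed
qed

text \<open>Cocompactness makes the density of \<open>Gam_star \<Sigma>\<close> quantitative: one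
  bound \<open>k\<close> on the physical norm works for all targets \<open>w\<close> at once. All
  uniform statements about \<open>Xi\<close> rest on this.\<close>

lemma relatively_dense:
  assumes "\<eta> > 0"
  obtains k where "\<And>w. \<exists>\<gamma>\<in>Gam \<Sigma>. norm \<gamma> < k \<and> norm (star \<Sigma> \<gamma> - w) < \<eta>"
proof -
  \<comment> \<open>\<open>V k\<close> is the image in the torus of a box with fixed internal radius
    \<eta> and growing physical radius \<open>k\<close>. Its preimage is a union of lattice
    translates of the box, hence open, and density of \<open>Gam_star \<Sigma>\<close> makes these
    images cover the torus.\<close>
  define V where "V k = {z \<in> torus \<Sigma>. \<exists>w t. z = torus_class \<Sigma> w t \<and> norm w < \<eta> \<and> norm t < real k}" for k :: nat
  have op: "openin (torus_topology \<Sigma>) (V k)" for k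
  proof -
    have "{(w, t). torus_class \<Sigma> w t \<in> V k} = (\<Union>\<sigma>\<in>\<Sigma>. (+) \<sigma> ` (ball 0 \<eta> \<times> ball 0 (real k)))" (is "?L = ?R")
    proof
      show "?L \<subseteq> ?R"
      proof
        fix p assume p: "p \<in> ?L"
        obtain w t where [simp]: "p = (w, t)" by (cases p)
        obtain w' t' where *: "torus_class \<Sigma> w t = torus_class \<Sigma> w' t'" "norm w' < \<eta>" "norm t' < k"
          using p unfolding V_def by auto
        then have "p = (w - w', t - t') + (w', t')" "(w - w', t - t') \<in> \<Sigma>"
          "(w', t') \<in> ball 0 \<eta> \<times> ball 0 (real k)"
          using torus_class_eq_iff by auto
        then show "p \<in> ?R" by blast
      qed
      show "?R \<subseteq> ?L"
      proof
        fix p assume "p \<in> ?R"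
        then obtain \<sigma> w' t' where *: "\<sigma> \<in> \<Sigma>" "p = \<sigma> + (w', t')" "norm w' < \<eta>" "norm t' < k" by auto
        obtain w t where [simp]: "p = (w, t)" by (cases p)
        have "(w - w', t - t') = \<sigma>" using * by (auto simp: prod_eq_iff)
        then have "torus_class \<Sigma> w t = torus_class \<Sigma> w' t'" using torus_class_eq_iff *(1) by simp
        then show "p \<in> ?L" unfolding V_def torus_def using *(3,4) by simp blast
      qed
    qed
    then have "open {(w, t). torus_class \<Sigma> w t \<in> V k}"
      by (simp only:) (intro open_UN ballI open_translation open_Times open_ball)
    then show ?thesis unfolding openin_torus_topology V_def by blast
  qed
  have cover: "torus \<Sigma> \<subseteq> (\<Union>k. V k)"
  proof
    fix z assume z: "z \<in> torus \<Sigma>"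
    then obtain w t where wt: "z = torus_class \<Sigma> w t" unfolding torus_def by blast
    obtain \<gamma> where \<gamma>: "\<gamma> \<in> Gam \<Sigma>" "norm (star \<Sigma> \<gamma> - w) < \<eta>" using star_dense_ball[OF assms] by blast
    obtain k :: nat where "norm (t - \<gamma>) < k" using reals_Archimedean2 by blast
    moreover have "z = torus_class \<Sigma> (w - star \<Sigma> \<gamma>) (t - \<gamma>)"
      unfolding wt torus_class_eq_iff using \<gamma> Gam_iff by simp
    moreover have "norm (w - star \<Sigma> \<gamma>) < \<eta>" using \<gamma> by (simp add: norm_minus_commute)
    ultimately have "z \<in> V k" using z unfolding V_def by blast
    then show "z \<in> (\<Union>k. V k)" by blast
  qed
  have ts: "topspace (torus_topology \<Sigma>) = torus \<Sigma>"
  proof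
    show "topspace (torus_topology \<Sigma>) \<subseteq> torus \<Sigma>"
      using openin_topspace openin_torus_topology by blast
    have "{(w, t). torus_class \<Sigma> w t \<in> torus \<Sigma>} = UNIV" unfolding torus_def by auto
    then have "openin (torus_topology \<Sigma>) (torus \<Sigma>)" unfolding openin_torus_topology by simp
    then show "torus \<Sigma> \<subseteq> topspace (torus_topology \<Sigma>)" by (rule openin_subset)
  qed
  have "\<And>U. U \<in> range V \<Longrightarrow> openin (torus_topology \<Sigma>) U" using op by blast
  moreover have "topspace (torus_topology \<Sigma>) \<subseteq> \<Union>(range V)" using cover ts by simp
  ultimately obtain \<F> where \<F>: "finite \<F>" "\<F> \<subseteq> range V" "torus \<Sigma> \<subseteq> \<Union>\<F>"
    using compact_torus[unfolded compact_space_alt, rule_format, of "range V"] unfolding ts by blast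
  obtain I where I: "finite I" "\<F> = V ` I" using finite_subset_image[OF \<F>(1,2)] by blast
  have "\<exists>\<gamma>\<in>Gam \<Sigma>. norm \<gamma> < real (Max I) \<and> norm (star \<Sigma> \<gamma> - w) < \<eta>" for w
  proof -
    have "torus_class \<Sigma> w 0 \<in> \<Union>\<F>" using \<F> unfolding torus_def by blast
    then obtain i w' t' where i: "i \<in> I" "torus_class \<Sigma> w 0 = torus_class \<Sigma> w' t'" "norm w' < \<eta>" "norm t' < real i"
      unfolding I V_def by auto
    \<comment> \<open>The class of \<open>(w, 0)\<close> has a representative
      \<open>(w', t')\<close> in the box; the lattice vector between the two supplies the required
      element \<open>- t'\<close> of \<Gamma>.\<close>
    then have "(w - w', - t') \<in> \<Sigma>" using torus_class_eq_iff by force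
    then have "star \<Sigma> (- t') = w - w'" "- t' \<in> Gam \<Sigma>" using star_eq Gam_iff by simp_all
    moreover have "norm (- t') < real (Max I)" using i Max_ge[OF I(1) i(1)] by simp
    ultimately show ?thesis using i by (intro bexI[of _ "- t'"]) auto
  qed
  then show ?thesis using that by blast
qed

end

section \<open>Model sets and the hull\<close>

locale cut_project_window = cut_project \<Sigma> for \<Sigma> :: "((real^'n) \<times> (real^'d)) set" +
  fixes W :: "(real^'n) set"
  assumes win: "window W"
begin

section \<open>The window, its model sets and the nonsingular parameters\<close>

lemma compact_W: "compact W" and convex_W: "convex W" and aff_dim_W: "aff_dim W = int CARD('n)"
  using win polytope_imp_compact polytope_imp_convex unfolding window_def by auto

lemma interior_W: "interior W \<noteq> {}"
proof -
  have "W \<noteq> {}" using aff_dim_W by auto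
  moreover have "affine hull W = UNIV" using aff_dim_W aff_dim_eq_full[of W] by simp
  ultimately show ?thesis
    using rel_interior_interior rel_interior_eq_empty[OF convex_W] by metis
qed

lemma closure_interior_W: "closure (interior W) = W"
  using convex_closure_interior[OF convex_W interior_W] compact_W compact_imp_closed closure_closed by metis

lemma frontier_W: "frontier W = W - interior W"
  using compact_W compact_imp_closed unfolding frontier_def by (metis closure_closed)

lemma bound_W: obtains b where "\<And>x. x \<in> W \<Longrightarrow> norm x \<le> b" "b > 0"
  using compact_imp_bounded[OF compact_W] unfolding bounded_pos by blast

definition model :: "real^'n \<Rightarrow> (real^'d) set" where
  "model v = point_set \<Sigma> (translate W v)"

lemma mem_model: "\<gamma> \<in> model v \<longleftrightarrow> \<gamma> \<in> Gam \<Sigma> \<and> star \<Sigma> \<gamma> - v \<in> W"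
  unfolding model_def point_set_def by (simp add: mem_translate)

lemma model_Gam: "model v \<subseteq> Gam \<Sigma>"
  using mem_model by blast

text \<open>The body is literally the condition under the description in
  \<open>Xi_param_def\<close>, so that it can be folded there.\<close>

definition sandwich :: "real^'n \<Rightarrow> (real^'d) set \<Rightarrow> bool" where
  "sandwich w \<Lambda> \<longleftrightarrow> point_set \<Sigma> (translate (interior W) w) \<subseteq> \<Lambda> \<and> \<Lambda> \<subseteq> point_set \<Sigma> (translate W w)"

lemma sandwich_iff: "sandwich w \<Lambda> \<longleftrightarrow>
  (\<forall>\<gamma>\<in>Gam \<Sigma>. star \<Sigma> \<gamma> - w \<in> interior W \<longrightarrow> \<gamma> \<in> \<Lambda>) \<and> (\<forall>\<gamma>\<in>\<Lambda>. \<gamma> \<in> Gam \<Sigma> \<and> star \<Sigma> \<gamma> - w \<in> W)"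
  unfolding sandwich_def point_set_def by (auto simp: mem_translate)

lemma sandwich_model: "sandwich v (model v)"
  using interior_subset by (auto simp: sandwich_iff mem_model)

lemma NS_iff: "v \<in> NS \<Sigma> W \<longleftrightarrow> (\<forall>\<gamma>\<in>Gam \<Sigma>. star \<Sigma> \<gamma> - v \<notin> frontier W)"
proof -
  have "(\<exists>x y. v = x - y \<and> x \<in> Gam_star \<Sigma> \<and> y \<in> frontier W) \<longleftrightarrow> (\<exists>\<gamma>\<in>Gam \<Sigma>. star \<Sigma> \<gamma> - v \<in> frontier W)"
    unfolding Gam_star_def by (metis (no_types, opaque_lifting) diff_diff_eq2 add_diff_cancel_left' imageE imageI)
  then show ?thesis unfolding NS_def by blast
qed

lemma NS_shift: assumes "v \<in> NS \<Sigma> W" "\<delta> \<in> Gam \<Sigma>" shows "v + star \<Sigma> \<delta> \<in> NS \<Sigma> W"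
  unfolding NS_iff
proof
  fix \<gamma> assume "\<gamma> \<in> Gam \<Sigma>"
  then have "star \<Sigma> (\<gamma> - \<delta>) - v \<notin> frontier W" using assms NS_iff by simp
  then show "star \<Sigma> \<gamma> - (v + star \<Sigma> \<delta>) \<notin> frontier W"
    using star_diff \<open>\<gamma> \<in> Gam \<Sigma>\<close> assms by (simp add: algebra_simps)
qed

text \<open>The singular parameters form a countable union of translates of the boundary of the
  convex set \<open>- W\<close>. Such a boundary is a null set, and a nonempty open set is
  not.\<close>

lemma NS_dense: assumes "open U" "U \<noteq> {}" obtains v where "v \<in> NS \<Sigma> W" "v \<in> U"
proof -
  have "negligible (uminus ` frontier W)"
  proof -
    have "uminus ` frontier W = frontier (uminus ` W)"
      using closed_negations[OF compact_imp_closed[OF compact_W]]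
      by (simp add: frontier_W) (simp add: frontier_def interior_negations image_set_diff closure_closed)
    then show ?thesis using negligible_convex_frontier convex_negations[OF convex_W] by metis
  qed
  then have "negligible (\<Union>\<gamma>\<in>Gam \<Sigma>. (+) (star \<Sigma> \<gamma>) ` uminus ` frontier W)"
    using countable_Gam by (intro negligible_countable_Union) (auto intro: negligible_translation simp del: image_image)
  then obtain v where v: "v \<in> U" "v \<notin> (\<Union>\<gamma>\<in>Gam \<Sigma>. (+) (star \<Sigma> \<gamma>) ` uminus ` frontier W)"
    using open_not_negligible[OF assms] negligible_subset by blast
  have "v \<in> NS \<Sigma> W"
    unfolding NS_iff
  proof (intro ballI notI)
    fix \<gamma> assume *: "\<gamma> \<in> Gam \<Sigma>" "star \<Sigma> \<gamma> - v \<in> frontier W"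
    have "v = star \<Sigma> \<gamma> + - (star \<Sigma> \<gamma> - v)" by simp
    then show False using v(2) * by blast
  qed
  then show ?thesis using that v by blast
qed

text \<open>Only finitely many \<gamma> in the ball can matter, and for nonsingular \<open>v\<close>
  each \<open>star \<Sigma> \<gamma> - v\<close> lies in one of the open sets
  \<open>interior W\<close> and \<open>- W\<close>, where it stays for \<open>u\<close> near
  \<open>v\<close>. As it lands in the interior or outside \<open>W\<close>, never on the boundary,
  the conclusion covers every \<Lambda> squeezed at \<open>u\<close> and not only
  \<open>model u\<close>.\<close>

lemma model_locally_constant:
  assumes "v \<in> NS \<Sigma> W"
  obtains e where "e > 0"
    "\<And>u \<Lambda>. norm (u - v) < e \<Longrightarrow> sandwich u \<Lambda> \<Longrightarrow> \<Lambda> \<inter> ball 0 R = model v \<inter> ball 0 R"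
proof -
  obtain b where b: "\<And>x. x \<in> W \<Longrightarrow> norm x \<le> b" using bound_W by blast
  \<comment> \<open>The radius adds to the bound \<open>b\<close> of the window the largest
    displacement, 1, that \<open>u\<close> is later allowed (\<open>d \<le> 1\<close>).\<close>
  define F where "F = {\<gamma> \<in> Gam \<Sigma>. \<gamma> \<in> ball 0 R \<and> star \<Sigma> \<gamma> \<in> cball v (b + 1)}"
  have finF: "finite F" unfolding F_def by (intro finite_Gam_bounded) auto
  have "\<exists>e>0. \<forall>u. norm (u - v) < e \<longrightarrow>
      (star \<Sigma> \<gamma> - v \<in> W \<longrightarrow> star \<Sigma> \<gamma> - u \<in> interior W) \<and> (star \<Sigma> \<gamma> - v \<notin> W \<longrightarrow> star \<Sigma> \<gamma> - u \<notin> W)"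
    if "\<gamma> \<in> F" for \<gamma>
  proof -
    have nf: "star \<Sigma> \<gamma> - v \<notin> frontier W" using that assms unfolding F_def NS_iff by blast
    define T where "T = (if star \<Sigma> \<gamma> - v \<in> W then interior W else - W)"
    have "open T" unfolding T_def using compact_W compact_imp_closed by auto
    moreover have "star \<Sigma> \<gamma> - v \<in> T" unfolding T_def using nf frontier_W by auto
    ultimately obtain e where e: "e > 0" "ball (star \<Sigma> \<gamma> - v) e \<subseteq> T" using open_contains_ball by blast
    have "star \<Sigma> \<gamma> - u \<in> T" if "norm (u - v) < e" for u
      using e that by (intro subsetD[OF e(2)]) (simp add: dist_norm)
    then show ?thesis using e(1) unfolding T_def by (metis ComplD)
  qed
  then obtain e where e: "\<And>\<gamma>. \<gamma> \<in> F \<Longrightarrow> e \<gamma> > 0"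
    "\<And>\<gamma> u. \<gamma> \<in> F \<Longrightarrow> norm (u - v) < e \<gamma> \<Longrightarrow>
      (star \<Sigma> \<gamma> - v \<in> W \<longrightarrow> star \<Sigma> \<gamma> - u \<in> interior W) \<and> (star \<Sigma> \<gamma> - v \<notin> W \<longrightarrow> star \<Sigma> \<gamma> - u \<notin> W)"
    by metis
  define d where "d = Min (insert 1 (e ` F))"
  have d: "d > 0" "d \<le> 1" "\<And>\<gamma>. \<gamma> \<in> F \<Longrightarrow> d \<le> e \<gamma>"
    unfolding d_def using finF e(1) by auto
  have "\<Lambda> \<inter> ball 0 R = model v \<inter> ball 0 R" if u: "norm (u - v) < d" "sandwich u \<Lambda>" for u \<Lambda>
  proof -
    have near: "\<gamma> \<in> F" if "\<gamma> \<in> Gam \<Sigma>" "\<gamma> \<in> ball 0 R" "star \<Sigma> \<gamma> - x \<in> W" "norm (x - v) \<le> 1" for \<gamma> x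
    proof -
      have "norm (star \<Sigma> \<gamma> - v) \<le> norm (star \<Sigma> \<gamma> - x) + norm (x - v)"
        using norm_triangle_ineq[of "star \<Sigma> \<gamma> - x" "x - v"] by simp
      then have "norm (star \<Sigma> \<gamma> - v) \<le> b + 1" using b[OF that(3)] that(4) by linarith
      then show ?thesis unfolding F_def using that by (simp add: dist_norm norm_minus_commute)
    qed
    have "\<gamma> \<in> \<Lambda> \<longleftrightarrow> \<gamma> \<in> model v" if \<gamma>: "\<gamma> \<in> ball 0 R" for \<gamma>
    proof
      assume "\<gamma> \<in> \<Lambda>"
      then have *: "\<gamma> \<in> Gam \<Sigma>" "star \<Sigma> \<gamma> - u \<in> W" using u(2) sandwich_iff by auto
      then have "\<gamma> \<in> F" using near \<gamma> u(1) d(2) by fastforce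
      then have "star \<Sigma> \<gamma> - v \<in> W" using e(2)[of \<gamma> u] d(3)[of \<gamma>] u(1) *(2) by force
      then show "\<gamma> \<in> model v" using mem_model * by blast
    next
      assume "\<gamma> \<in> model v"
      then have *: "\<gamma> \<in> Gam \<Sigma>" "star \<Sigma> \<gamma> - v \<in> W" using mem_model by auto
      then have "\<gamma> \<in> F" using near \<gamma> by fastforce
      then have "star \<Sigma> \<gamma> - u \<in> interior W" using e(2)[of \<gamma> u] d(3)[of \<gamma>] u(1) *(2) by force
      then show "\<gamma> \<in> \<Lambda>" using u(2) * sandwich_iff by blast
    qed
    then show ?thesis by blast
  qed
  then show ?thesis using that d(1) by blast
qed

lemma translate_model: assumes "\<gamma> \<in> Gam \<Sigma>" shows "translate (model v) \<gamma> = model (v + star \<Sigma> \<gamma>)"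
proof -
  have "y - \<gamma> \<in> model v \<longleftrightarrow> y \<in> model (v + star \<Sigma> \<gamma>)" for y
  proof -
    have "y - \<gamma> \<in> Gam \<Sigma> \<longleftrightarrow> y \<in> Gam \<Sigma>" using assms Gam_add[of "y - \<gamma>" \<gamma>] by auto
    moreover have "star \<Sigma> (y - \<gamma>) - v = star \<Sigma> y - (v + star \<Sigma> \<gamma>)" if "y \<in> Gam \<Sigma>"
      using star_diff[OF that assms] by (simp add: algebra_simps)
    ultimately show ?thesis unfolding mem_model by metis
  qed
  then show ?thesis by (simp add: set_eq_iff mem_translate)
qed

lemma translate_sandwich: assumes "sandwich w \<Lambda>" "\<gamma> \<in> Gam \<Sigma>"
  shows "sandwich (w + star \<Sigma> \<gamma>) (translate \<Lambda> \<gamma>)"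
  unfolding sandwich_iff
proof (intro conjI ballI impI)
  fix \<delta> assume *: "\<delta> \<in> Gam \<Sigma>" "star \<Sigma> \<delta> - (w + star \<Sigma> \<gamma>) \<in> interior W"
  then have "star \<Sigma> (\<delta> - \<gamma>) - w \<in> interior W" "\<delta> - \<gamma> \<in> Gam \<Sigma>"
    using star_diff[OF *(1) assms(2)] assms(2) by (simp_all add: diff_diff_eq add.commute)
  then show "\<delta> \<in> translate \<Lambda> \<gamma>" using assms(1) sandwich_iff by (auto simp: mem_translate)
next
  fix \<delta> assume "\<delta> \<in> translate \<Lambda> \<gamma>"
  then have *: "\<delta> - \<gamma> \<in> Gam \<Sigma>" "star \<Sigma> (\<delta> - \<gamma>) - w \<in> W"
    using assms(1) sandwich_iff by (auto simp: mem_translate)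
  then show "\<delta> \<in> Gam \<Sigma>" using Gam_add[OF *(1) assms(2)] by simp
  then show "star \<Sigma> \<delta> - (w + star \<Sigma> \<gamma>) \<in> W"
    using *(2) star_diff[OF _ assms(2), of \<delta>] by (simp add: algebra_simps)
qed

text \<open>Moving the centre of a pattern to the origin shifts the parameter by an element of
  \<open>Gam_star \<Sigma>\<close>, which preserves \<open>NS\<close>. The condition
  \<open>- v \<in> W\<close> says that the new centre 0 belongs to \<open>model v\<close>; it also
  confines \<open>v\<close> to a compact set, which \<open>hull_approx\<close> exploits.\<close>

lemma language_NS_iff:
  "p \<in> language_NS \<Sigma> W \<longleftrightarrow> (\<exists>v\<in>NS \<Sigma> W. \<exists>R>0. - v \<in> W \<and> p = model v \<inter> ball 0 R)"
proof
  assume "p \<in> language_NS \<Sigma> W"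
  then obtain w t x R where w: "w \<in> NS \<Sigma> W" "x \<in> translate (model w) (- t)" "R > 0"
    "p = translate (translate (model w) (- t)) (- x) \<inter> ball 0 R"
    unfolding language_NS_def language_def model_def[symmetric] by auto
  have \<gamma>: "x + t \<in> model w" using w(2) by (simp add: mem_translate)
  then have g: "x + t \<in> Gam \<Sigma>" "- (x + t) \<in> Gam \<Sigma>" using mem_model Gam_minus by blast+
  have "translate (translate (model w) (- t)) (- x) = translate (model w) (- (x + t))" by (simp add: algebra_simps)
  also have "\<dots> = model (w - star \<Sigma> (x + t))" using translate_model[OF g(2)] star_minus[OF g(1)] by simp
  finally show "\<exists>v\<in>NS \<Sigma> W. \<exists>R>0. - v \<in> W \<and> p = model v \<inter> ball 0 R"
    using NS_shift[OF w(1) g(2)] star_minus[OF g(1)] w \<gamma> mem_model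
    by (intro bexI[of _ "w - star \<Sigma> (x + t)"]) auto
next
  assume "\<exists>v\<in>NS \<Sigma> W. \<exists>R>0. - v \<in> W \<and> p = model v \<inter> ball 0 R"
  then obtain v R where v: "v \<in> NS \<Sigma> W" "R > 0" "- v \<in> W" "p = model v \<inter> ball 0 R" by blast
  have "0 \<in> model v" using v(3) by (simp add: mem_model)
  then have "p \<in> language (translate (model v) (- 0))"
    unfolding language_def using v(2,4) by (auto intro!: exI[of _ "0::real^'d"] exI[of _ R])
  then show "p \<in> language_NS \<Sigma> W" unfolding language_NS_def model_def[symmetric] using v(1) by blast
qed

text \<open>Density of \<open>Gam_star \<Sigma>\<close> lets a translation by \<Gamma> bring the
  parameter \<open>w\<close> as close as desired to \<open>v\<close>, where patterns are locally
  constant.\<close>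

lemma language_superset: assumes "sandwich w \<Lambda>" shows "language_NS \<Sigma> W \<subseteq> language \<Lambda>"
proof
  fix p assume "p \<in> language_NS \<Sigma> W"
  then obtain v R where v: "v \<in> NS \<Sigma> W" "R > 0" "- v \<in> W" "p = model v \<inter> ball 0 R"
    using language_NS_iff by blast
  obtain e where e: "e > 0" "\<And>u \<Lambda>. norm (u - v) < e \<Longrightarrow> sandwich u \<Lambda> \<Longrightarrow> \<Lambda> \<inter> ball 0 R = model v \<inter> ball 0 R"
    using model_locally_constant[OF v(1)] by metis
  obtain \<delta> where \<delta>: "\<delta> \<in> Gam \<Sigma>" "norm (star \<Sigma> \<delta> - (w - v)) < e" using star_dense_ball[OF e(1)] by blast
  have "norm ((w + star \<Sigma> (- \<delta>)) - v) < e"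
    using \<delta> norm_minus_commute[of "star \<Sigma> \<delta>" "w - v"] by (simp add: star_minus algebra_simps)
  then have *: "translate \<Lambda> (- \<delta>) \<inter> ball 0 R = p"
    using e(2) translate_sandwich[OF assms Gam_minus[OF \<delta>(1)]] v(4) by blast
  \<comment> \<open>A pattern must be centred at a point of the set; that \<delta> is one follows
    from 0 being in the pattern.\<close>
  have "0 \<in> p" unfolding v(4) using v(2,3) by (simp add: mem_model)
  then have "\<delta> \<in> \<Lambda>" using * by (auto simp: mem_translate)
  then show "p \<in> language \<Lambda>" unfolding language_def using * v(2) by blast
qed

text \<open>The radius and the distance of parameters are controlled by the same \<open>v\<close>:
  \<Lambda> is a limit of nonsingular model sets whose parameters converge to \<open>w\<close> at
  the same time.\<close>

definition approx :: "real^'n \<Rightarrow> (real^'d) set \<Rightarrow> bool" where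
  "approx w \<Lambda> \<longleftrightarrow> \<Lambda> \<subseteq> Gam \<Sigma> \<and>
     (\<forall>R. \<forall>e>0. \<exists>v\<in>NS \<Sigma> W. norm (v - w) < e \<and> \<Lambda> \<inter> ball 0 R = model v \<inter> ball 0 R)"

text \<open>Membership in the interior is an open condition and membership in \<open>W\<close> a
  closed one; they give the lower and the upper inclusion. The radius
  \<open>norm \<gamma> + 1\<close> only ensures that \<gamma> itself is inside the ball.\<close>

lemma approx_sandwich: assumes "approx w \<Lambda>" shows "sandwich w \<Lambda>"
  unfolding sandwich_iff
proof (intro conjI ballI impI)
  fix \<gamma> assume \<gamma>: "\<gamma> \<in> Gam \<Sigma>" "star \<Sigma> \<gamma> - w \<in> interior W"
  then obtain e where e: "e > 0" "ball (star \<Sigma> \<gamma> - w) e \<subseteq> W"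
    unfolding mem_interior by blast
  obtain v where v: "norm (v - w) < e" "\<Lambda> \<inter> ball 0 (norm \<gamma> + 1) = model v \<inter> ball 0 (norm \<gamma> + 1)"
    using assms e(1) unfolding approx_def by blast
  have "star \<Sigma> \<gamma> - v \<in> W" using v(1) by (intro subsetD[OF e(2)]) (simp add: dist_norm)
  then have "\<gamma> \<in> model v \<inter> ball 0 (norm \<gamma> + 1)" using \<gamma> by (simp add: mem_model)
  then show "\<gamma> \<in> \<Lambda>" using v(2) by blast
next
  fix \<gamma> assume \<gamma>: "\<gamma> \<in> \<Lambda>"
  then show "\<gamma> \<in> Gam \<Sigma>" using assms unfolding approx_def by blast
  have "star \<Sigma> \<gamma> - w \<in> closure W"
    unfolding closure_approachable
  proof (intro allI impI)
    fix e :: real assume "e > 0"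
    then obtain v where v: "norm (v - w) < e" "\<Lambda> \<inter> ball 0 (norm \<gamma> + 1) = model v \<inter> ball 0 (norm \<gamma> + 1)"
      using assms unfolding approx_def by blast
    have "\<gamma> \<in> \<Lambda> \<inter> ball 0 (norm \<gamma> + 1)" using \<gamma> by simp
    then have "star \<Sigma> \<gamma> - v \<in> W" using v(2) mem_model by blast
    then show "\<exists>y\<in>W. dist y (star \<Sigma> \<gamma> - w) < e"
      using v(1) by (intro bexI) (simp_all add: dist_norm norm_minus_commute)
  qed
  then show "star \<Sigma> \<gamma> - w \<in> W" using compact_W compact_imp_closed closure_closed by metis
qed

text \<open>Each pattern of \<Lambda> is seen in a nonsingular model set, and the opposite inclusion
  of languages already follows from the squeezing.\<close>

lemma approx_Xi: assumes "approx w \<Lambda>" shows "\<Lambda> \<in> Xi \<Sigma> W"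
proof -
  have "language \<Lambda> \<subseteq> language_NS \<Sigma> W"
  proof
    fix p assume "p \<in> language \<Lambda>"
    then obtain x r where x: "x \<in> \<Lambda>" "r > 0" "p = translate \<Lambda> (- x) \<inter> ball 0 r" unfolding language_def by blast
    \<comment> \<open>The ball of radius \<open>r\<close> about \<open>x\<close> fits into the ball
      of radius \<open>norm x + r\<close> about 0.\<close>
    obtain v where v: "v \<in> NS \<Sigma> W" "\<Lambda> \<inter> ball 0 (norm x + r) = model v \<inter> ball 0 (norm x + r)"
      using assms unfolding approx_def by (metis zero_less_one)
    have in_ball: "y + x \<in> ball 0 (norm x + r)" if "y \<in> ball 0 r" for y
      using that norm_triangle_ineq[of y x] by simp
    have "x \<in> \<Lambda> \<inter> ball 0 (norm x + r)" using x(1,2) by simp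
    then have xv: "x \<in> model v" using v(2) by blast
    then have xG: "x \<in> Gam \<Sigma>" using mem_model by blast
    have "p = translate (model v) (- x) \<inter> ball 0 r"
    proof -
      have "y + x \<in> \<Lambda> \<longleftrightarrow> y + x \<in> model v" if "y \<in> ball 0 r" for y
        using in_ball[OF that] v(2) by blast
      then show ?thesis unfolding x(3) by (simp add: set_eq_iff mem_translate conj_commute cong: conj_cong)
    qed
    then have "p = model (v - star \<Sigma> x) \<inter> ball 0 r"
      using translate_model[OF Gam_minus[OF xG]] star_minus[OF xG] by simp
    moreover have "v - star \<Sigma> x \<in> NS \<Sigma> W" using NS_shift[OF v(1) Gam_minus[OF xG]] star_minus[OF xG] by simp
    moreover have "- (v - star \<Sigma> x) \<in> W" using xv mem_model by simp
    ultimately show "p \<in> language_NS \<Sigma> W" unfolding language_NS_iff using x(2) by blast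
  qed
  then show ?thesis
    using language_superset[OF approx_sandwich[OF assms]] assms
    unfolding Xi_def hull_space_def approx_def by blast
qed

lemma approx_model: assumes "v \<in> NS \<Sigma> W" shows "approx v (model v)"
  using assms model_Gam by (auto simp: approx_def intro!: bexI[of _ v])

lemma model_Xi: "v \<in> NS \<Sigma> W \<Longrightarrow> model v \<in> Xi \<Sigma> W"
  using approx_model approx_Xi by blast

lemma translate_approx: assumes "approx w \<Lambda>" "\<gamma> \<in> Gam \<Sigma>"
  shows "approx (w + star \<Sigma> \<gamma>) (translate \<Lambda> \<gamma>)"
  unfolding approx_def
proof (intro conjI allI impI)
  show "translate \<Lambda> \<gamma> \<subseteq> Gam \<Sigma>"
    using translate_sandwich[OF approx_sandwich[OF assms(1)] assms(2)] sandwich_iff by blast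
  fix R e :: real assume "e > 0"
  then obtain v where v: "v \<in> NS \<Sigma> W" "norm (v - w) < e"
    "\<Lambda> \<inter> ball 0 (R + norm \<gamma>) = model v \<inter> ball 0 (R + norm \<gamma>)"
    using assms(1) unfolding approx_def by blast
  have "y \<in> translate \<Lambda> \<gamma> \<longleftrightarrow> y \<in> model (v + star \<Sigma> \<gamma>)" if "y \<in> ball 0 R" for y
  proof -
    have "y - \<gamma> \<in> ball 0 (R + norm \<gamma>)" using that norm_triangle_ineq4[of y \<gamma>] by simp
    then have "y - \<gamma> \<in> \<Lambda> \<longleftrightarrow> y - \<gamma> \<in> model v" using v(3) by blast
    then show ?thesis using translate_model[OF assms(2)] by (metis mem_translate)
  qed
  then have "translate \<Lambda> \<gamma> \<inter> ball 0 R = model (v + star \<Sigma> \<gamma>) \<inter> ball 0 R" by blast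
  moreover have "norm (v + star \<Sigma> \<gamma> - (w + star \<Sigma> \<gamma>)) < e" using v(2) by simp
  ultimately show "\<exists>u\<in>NS \<Sigma> W. norm (u - (w + star \<Sigma> \<gamma>)) < e \<and> translate \<Lambda> \<gamma> \<inter> ball 0 R = model u \<inter> ball 0 R"
    using NS_shift[OF v(1) assms(2)] by blast
qed

text \<open>Deleting finitely many points from \<open>w + interior W\<close> leaves a nonempty open
  set, which density fills with a further star image.\<close>

lemma sandwich_infinite: assumes "sandwich w \<Lambda>" shows "infinite \<Lambda>"
proof
  assume fin: "finite \<Lambda>"
  define U where "U = (+) w ` interior W"
  have U: "open U" "U \<noteq> {}" unfolding U_def using interior_W by (auto simp: open_translation)
  then have "infinite U" using finite_imp_not_open by blast
  then have "U - star \<Sigma> ` \<Lambda> \<noteq> {}" using fin by (metis finite_imageI finite.emptyI finite_Diff2)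
  moreover have "open (U - star \<Sigma> ` \<Lambda>)" using U fin by (intro open_Diff finite_imp_closed) auto
  ultimately obtain \<gamma> where \<gamma>: "\<gamma> \<in> Gam \<Sigma>" "star \<Sigma> \<gamma> \<in> U - star \<Sigma> ` \<Lambda>" using star_dense by blast
  then have "star \<Sigma> \<gamma> - w \<in> interior W" unfolding U_def by auto
  then show False using \<gamma> assms sandwich_iff by blast
qed

lemma sandwich_nonempty: "sandwich w \<Lambda> \<Longrightarrow> \<Lambda> \<noteq> {}"
  using sandwich_infinite by auto

lemma finite_model_ball: "finite (model v \<inter> ball 0 R)"
proof -
  have "finite {\<gamma> \<in> Gam \<Sigma>. \<gamma> \<in> ball 0 R \<and> star \<Sigma> \<gamma> \<in> (+) v ` W}"
    by (intro finite_Gam_bounded) (auto intro: bounded_translation compact_imp_bounded[OF compact_W])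
  moreover have "model v \<inter> ball 0 R \<subseteq> {\<gamma> \<in> Gam \<Sigma>. \<gamma> \<in> ball 0 R \<and> star \<Sigma> \<gamma> \<in> (+) v ` W}"
    unfolding mem_model[abs_def] by (force simp: mem_model)
  ultimately show ?thesis by (rule rev_finite_subset)
qed

text \<open>Patterns of a finite set have bounded cardinality, whereas those of nonsingular model
  sets do not.\<close>

lemma hull_infinite: assumes "\<Lambda> \<in> hull_space \<Sigma> W" shows "infinite \<Lambda>"
proof
  assume fin: "finite \<Lambda>"
  \<comment> \<open>Choosing \<open>v\<close> in \<open>- interior W\<close> puts 0 into
    \<open>model v\<close>, so that balls about 0 cut out patterns of the language.\<close>
  have "uminus ` interior W \<noteq> {}" "open (uminus ` interior W)" using interior_W open_negations by auto
  then obtain v where "v \<in> NS \<Sigma> W" "v \<in> uminus ` interior W" using NS_dense by blast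
  then have v: "v \<in> NS \<Sigma> W" "- v \<in> W" using interior_subset[of W] by auto
  obtain F where F: "F \<subseteq> model v" "finite F" "card F = Suc (card \<Lambda>)"
    using infinite_arbitrarily_large sandwich_infinite[OF sandwich_model] by metis
  obtain R where R: "R > 0" "F \<subseteq> ball 0 R"
    using bounded_subset_ballD[OF finite_imp_bounded[OF F(2)]] by blast
  have "model v \<inter> ball 0 R \<in> language \<Lambda>"
    using assms v R language_NS_iff unfolding hull_space_def by blast
  then obtain x r where x: "model v \<inter> ball 0 R = translate \<Lambda> (- x) \<inter> ball 0 r" unfolding language_def by blast
  have "Suc (card \<Lambda>) \<le> card (model v \<inter> ball 0 R)"
    using card_mono[OF finite_model_ball] F R by (metis Int_subset_iff)
  also have "\<dots> \<le> card (translate \<Lambda> (- x))"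
    unfolding x using fin by (intro card_mono) (auto simp: translate_def)
  also have "\<dots> \<le> card \<Lambda>" unfolding translate_def using card_image_le[OF fin] .
  finally show False by simp
qed

text \<open>The patterns of \<Lambda> about \<open>x\<close> of radius \<open>k + 1\<close> come
  from nonsingular parameters in the compact set \<open>- W\<close>; a limit of a subsequence of
  these is the parameter.\<close>

lemma hull_approx: assumes "\<Lambda> \<in> hull_space \<Sigma> W" "x \<in> \<Lambda>" shows "\<exists>w. approx w (translate \<Lambda> (- x))"
proof -
  let ?L = "translate \<Lambda> (- x)"
  have inf: "infinite ?L" using hull_infinite[OF assms(1)] unfolding translate_def by (simp add: finite_image_iff)
  \<comment> \<open>The elements of \<^const>\<open>language\<close> do not record their radius, so \<open>R\<close> may be smaller than \<open>Suc k\<close>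
    here; that this cannot happen for all large \<open>k\<close> follows from the infinity of \<open>\<Lambda>\<close>.\<close>
  have pat: "\<exists>v\<in>NS \<Sigma> W. \<exists>R. - v \<in> W \<and> ?L \<inter> ball 0 (real (Suc k)) = model v \<inter> ball 0 R" for k
  proof -
    have "?L \<inter> ball 0 (real (Suc k)) \<in> language_NS \<Sigma> W"
      using assms unfolding hull_space_def language_def by force
    then show ?thesis unfolding language_NS_iff by blast
  qed
  have "\<exists>v\<in>NS \<Sigma> W. - v \<in> W \<and> ?L \<inter> ball 0 (real (Suc k)) = model v \<inter> ball 0 (real (Suc k))" for k
  proof (rule ccontr)
    assume neg: "\<not> ?thesis"
    \<comment> \<open>If the radii fail to match at \<open>k\<close>, then every larger pattern is
      cut out by some \<open>R < Suc k\<close>. Each point of \<open>?L\<close> lies in such a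
      pattern, so all of \<open>?L\<close> is in the ball of radius \<open>Suc k\<close> and would
      be finite.\<close>
    have "?L \<subseteq> ?L \<inter> ball 0 (real (Suc k))"
    proof
      fix y assume y: "y \<in> ?L"
      obtain m where m: "norm y < real m" using reals_Archimedean2 by blast
      obtain v R where v: "v \<in> NS \<Sigma> W" "- v \<in> W"
        "?L \<inter> ball 0 (real (Suc (max k m))) = model v \<inter> ball 0 R" using pat by blast
      have sub: "ball (0::real^'d) (real (Suc k)) \<subseteq> ball 0 (real (Suc (max k m)))"
        by (intro subset_ball) simp
      have "R < real (Suc k)"
      proof (rule ccontr)
        assume "\<not> R < real (Suc k)"
        then have "ball (0::real^'d) (real (Suc k)) \<subseteq> ball 0 R" by (intro subset_ball) simp
        then have "?L \<inter> ball 0 (real (Suc k)) = model v \<inter> ball 0 (real (Suc k))"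
          using v(3) sub by blast
        then show False using neg v by blast
      qed
      moreover have "y \<in> ball 0 (real (Suc (max k m)))" using m by simp
      then have "y \<in> ball 0 R" using v(3) y by blast
      ultimately show "y \<in> ?L \<inter> ball 0 (real (Suc k))" using y by simp
    qed
    moreover have "finite (?L \<inter> ball 0 (real (Suc k)))"
      using pat[of k] finite_model_ball by metis
    ultimately show False using inf finite_subset by blast
  qed
  then obtain v where v: "\<And>k. v k \<in> NS \<Sigma> W" "\<And>k. - v k \<in> W"
    "\<And>k. ?L \<inter> ball 0 (real (Suc k)) = model (v k) \<inter> ball 0 (real (Suc k))" by metis
  obtain l r where l: "strict_mono (r :: nat \<Rightarrow> nat)" "((\<lambda>k. - v k) \<circ> r) \<longlonglongrightarrow> l"
    using compact_W v(2) unfolding compact_def by metis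
  have "?L \<subseteq> Gam \<Sigma>"
  proof
    fix y assume y: "y \<in> ?L"
    obtain k where "norm y < real k" using reals_Archimedean2 by blast
    then have "y \<in> ?L \<inter> ball 0 (real (Suc k))" using y by simp
    then show "y \<in> Gam \<Sigma>" using v(3) mem_model by blast
  qed
  moreover have "\<exists>u\<in>NS \<Sigma> W. norm (u - (- l)) < e \<and> ?L \<inter> ball 0 R = model u \<inter> ball 0 R" if e: "e > 0" for R e
  proof -
    obtain N where N: "\<And>k. k \<ge> N \<Longrightarrow> norm (- v (r k) - l) < e"
      using LIMSEQ_D[OF l(2) e] by auto
    obtain m where "R < real m" using reals_Archimedean2 by blast
    then have m: "ball (0::real^'d) R \<subseteq> ball 0 (real (Suc (r (max N m))))"
      using seq_suble[OF l(1), of "max N m"] by (intro subset_ball) linarith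
    have "?L \<inter> ball 0 R = model (v (r (max N m))) \<inter> ball 0 R"
      using v(3)[of "r (max N m)"] m by blast
    moreover have "norm (v (r (max N m)) - (- l)) < e"
      using N[of "max N m"] by (metis max.cobounded1 minus_diff_minus norm_minus_cancel minus_minus)
    ultimately show ?thesis using v(1) by blast
  qed
  ultimately show ?thesis unfolding approx_def by blast
qed

end

section \<open>Parameters\<close>

context cut_project_window begin

section \<open>The hull as translates of the internal system\<close>

lemma language_translate: "language (translate \<Lambda> t) = language \<Lambda>" for \<Lambda> :: "(real^'d) set"
proof -
  have "language \<Lambda> \<subseteq> language (translate \<Lambda> t)" for \<Lambda> and t :: "real^'d"
  proof
    fix p assume "p \<in> language \<Lambda>"
    then obtain x R where x: "x \<in> \<Lambda>" "R > 0" "p = translate \<Lambda> (- x) \<inter> ball 0 R" unfolding language_def by blast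
    then have "x + t \<in> translate \<Lambda> t" "p = translate (translate \<Lambda> t) (- (x + t)) \<inter> ball 0 R"
      by (simp_all add: mem_translate)
    then show "p \<in> language (translate \<Lambda> t)" unfolding language_def using x(2) by blast
  qed
  from this[of \<Lambda> t] this[of "translate \<Lambda> t" "- t"] show ?thesis by simp
qed

lemma hull_translate: "translate \<Lambda> t \<in> hull_space \<Sigma> W \<longleftrightarrow> \<Lambda> \<in> hull_space \<Sigma> W" for \<Lambda> :: "(real^'d) set"
  unfolding hull_space_def by (simp add: language_translate)

lemma Xi_hull: "\<Lambda> \<in> Xi \<Sigma> W \<Longrightarrow> \<Lambda> \<in> hull_space \<Sigma> W" and Xi_Gam: "\<Lambda> \<in> Xi \<Sigma> W \<Longrightarrow> \<Lambda> \<subseteq> Gam \<Sigma>"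
  unfolding Xi_def by auto

lemma Xi_nonempty: "\<Lambda> \<in> Xi \<Sigma> W \<Longrightarrow> \<Lambda> \<noteq> {}"
  using hull_infinite Xi_hull by fastforce

lemma hull_decomp: assumes "\<Lambda> \<in> hull_space \<Sigma> W" obtains L t where "L \<in> Xi \<Sigma> W" "\<Lambda> = translate L (- t)"
proof -
  obtain x where "x \<in> \<Lambda>" using hull_infinite[OF assms] by fastforce
  then have "translate \<Lambda> (- x) \<in> Xi \<Sigma> W" using hull_approx assms approx_Xi by blast
  then show ?thesis using that[of "translate \<Lambda> (- x)" "- x"] by simp
qed

lemma Xi_approx: assumes "\<Lambda> \<in> Xi \<Sigma> W" obtains w where "approx w \<Lambda>"
proof -
  obtain x where x: "x \<in> \<Lambda>" using Xi_nonempty[OF assms] by blast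
  then obtain w where "approx w (translate \<Lambda> (- x))" using hull_approx Xi_hull[OF assms] by blast
  then have "approx (w + star \<Sigma> x) (translate (translate \<Lambda> (- x)) x)"
    using translate_approx Xi_Gam[OF assms] x by blast
  then show ?thesis using that by simp
qed

lemma translate_Xi: assumes "\<Lambda> \<in> Xi \<Sigma> W" "\<gamma> \<in> Gam \<Sigma>" shows "translate \<Lambda> \<gamma> \<in> Xi \<Sigma> W"
  using Xi_approx[OF assms(1)] translate_approx[OF _ assms(2)] approx_Xi by metis

text \<open>This makes all descriptions over decompositions \<open>translate L (- t)\<close>
  single-valued: two decompositions of one set differ by an element of \<Gamma>.\<close>

lemma translate_eq_Gam:
  assumes "\<Lambda> \<in> Xi \<Sigma> W" "\<Lambda>' \<in> Xi \<Sigma> W" "\<Lambda>' = translate \<Lambda> t" shows "t \<in> Gam \<Sigma>"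
proof -
  obtain x where "x \<in> \<Lambda>'" using Xi_nonempty assms by blast
  moreover from this have "x - t \<in> \<Lambda>" using assms(3) mem_translate by blast
  ultimately have "x \<in> Gam \<Sigma>" "x - t \<in> Gam \<Sigma>" using assms Xi_Gam by blast+
  then show ?thesis using Gam_diff[of x "x - t"] by simp
qed

text \<open>A compact set is not contained in a proper translate of itself.\<close>

lemma sandwich_determined:
  assumes "\<And>\<gamma>. \<gamma> \<in> Gam \<Sigma> \<Longrightarrow> star \<Sigma> \<gamma> - w \<in> interior W \<Longrightarrow> star \<Sigma> \<gamma> - w' \<in> W"
  shows "w' = w"
proof -
  define c where "c = w - w'"
  have sub: "x + c \<in> W" if "x \<in> W" for x
  proof -
    have "interior W \<subseteq> {x. x + c \<in> W}"
    proof
      fix x assume x: "x \<in> interior W"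
      \<comment> \<open>The hypothesis concerns only star images; they are dense in
        \<open>w + interior W\<close>, and \<open>W\<close> is closed.\<close>
      have "x + c \<in> closure W"
        unfolding closure_approachable
      proof (intro allI impI)
        fix e :: real assume "e > 0"
        then have "open ((+) w ` (interior W \<inter> ball x e))" "(+) w ` (interior W \<inter> ball x e) \<noteq> {}"
          using x by (auto intro!: open_translation)
        then obtain \<gamma> where \<gamma>: "\<gamma> \<in> Gam \<Sigma>" "star \<Sigma> \<gamma> \<in> (+) w ` (interior W \<inter> ball x e)"
          using star_dense by blast
        then have "star \<Sigma> \<gamma> - w \<in> interior W" "dist x (star \<Sigma> \<gamma> - w) < e" by auto
        moreover from this have "star \<Sigma> \<gamma> - w' \<in> W" using assms \<gamma> by blast
        moreover have "dist (star \<Sigma> \<gamma> - w') (x + c) = dist x (star \<Sigma> \<gamma> - w)"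
          unfolding c_def dist_norm by (simp add: algebra_simps norm_minus_commute)
        ultimately show "\<exists>y\<in>W. dist y (x + c) < e" by force
      qed
      then show "x \<in> {x. x + c \<in> W}" using compact_W compact_imp_closed closure_closed by blast
    qed
    moreover have "closed {x. x + c \<in> W}"
      using continuous_closed_vimage[of W "\<lambda>x. x + c"] compact_imp_closed[OF compact_W]
      by (simp add: vimage_def)
    ultimately have "closure (interior W) \<subseteq> {x. x + c \<in> W}" by (rule closure_minimal)
    then show ?thesis using that closure_interior_W by blast
  qed
  have "W \<noteq> {}" using interior_W interior_subset by blast
  moreover have "continuous_on W (\<lambda>x. c \<bullet> x)" by (intro continuous_intros)
  \<comment> \<open>Translation by \<open>c\<close> raises the functional
    \<open>c \<bullet> x\<close> by \<open>c \<bullet> c\<close>. At a maximum over \<open>W\<close>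
    there is no room for that unless \<open>c = 0\<close>.\<close>
  ultimately obtain m where m: "m \<in> W" "\<And>x. x \<in> W \<Longrightarrow> c \<bullet> x \<le> c \<bullet> m"
    using continuous_attains_sup[OF compact_W] by blast
  have "c \<bullet> (m + c) \<le> c \<bullet> m" using m(2)[OF sub[OF m(1)]] .
  then have "c = 0" by (metis add_le_same_cancel1 inner_add_right inner_gt_zero_iff not_less)
  then show ?thesis unfolding c_def by simp
qed

lemma sandwich_unique: "sandwich w \<Lambda> \<Longrightarrow> sandwich w' \<Lambda> \<Longrightarrow> w' = w"
  using sandwich_determined[of w w'] unfolding sandwich_iff by blast

lemma Xi_param_eq: "sandwich w \<Lambda> \<Longrightarrow> Xi_param \<Sigma> W \<Lambda> = w"
  unfolding Xi_param_def sandwich_def[symmetric] using sandwich_unique by blast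

lemma Xi_param_approx: "\<Lambda> \<in> Xi \<Sigma> W \<Longrightarrow> approx (Xi_param \<Sigma> W \<Lambda>) \<Lambda>"
  using Xi_approx Xi_param_eq approx_sandwich by metis

lemma Xi_param_sandwich: "\<Lambda> \<in> Xi \<Sigma> W \<Longrightarrow> sandwich (Xi_param \<Sigma> W \<Lambda>) \<Lambda>"
  using Xi_param_approx approx_sandwich by blast

lemma Xi_param_translate:
  "\<Lambda> \<in> Xi \<Sigma> W \<Longrightarrow> \<gamma> \<in> Gam \<Sigma> \<Longrightarrow> Xi_param \<Sigma> W (translate \<Lambda> \<gamma>) = Xi_param \<Sigma> W \<Lambda> + star \<Sigma> \<gamma>"
  using Xi_param_sandwich translate_sandwich Xi_param_eq by blast

lemma Xi_param_model: "v \<in> NS \<Sigma> W \<Longrightarrow> Xi_param \<Sigma> W (model v) = v"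
  using sandwich_model Xi_param_eq by blast

text \<open>Any other pair \<open>(w, t')\<close> squeezing the set forces \<open>t' - t\<close>
  into \<Gamma>, since a common point is in \<Gamma> before and after the shift; uniqueness on
  \<open>Xi\<close> then identifies \<open>w\<close> up to the corresponding star image.\<close>

lemma hull_param_eq:
  assumes "L \<in> Xi \<Sigma> W" shows "hull_param \<Sigma> W (translate L (- t)) = torus_class \<Sigma> (Xi_param \<Sigma> W L) t"
proof -
  let ?w = "Xi_param \<Sigma> W L"
  have sub: "translate A x \<subseteq> translate B x \<longleftrightarrow> A \<subseteq> B" for A B and x :: "real^'d"
    unfolding translate_def by (simp add: inj_image_subset_iff)
  show ?thesis
    unfolding hull_param_def
  proof (rule the_equality)
    show "\<exists>w t'. torus_class \<Sigma> ?w t = torus_class \<Sigma> w t' \<and>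
        translate (point_set \<Sigma> (translate (interior W) w)) (- t') \<subseteq> translate L (- t) \<and>
        translate L (- t) \<subseteq> translate (point_set \<Sigma> (translate W w)) (- t')"
      using Xi_param_sandwich[OF assms] unfolding sandwich_def by (intro exI[of _ ?w] exI[of _ t]) (simp add: sub)
  next
    fix z assume "\<exists>w t'. z = torus_class \<Sigma> w t' \<and>
        translate (point_set \<Sigma> (translate (interior W) w)) (- t') \<subseteq> translate L (- t) \<and>
        translate L (- t) \<subseteq> translate (point_set \<Sigma> (translate W w)) (- t')"
    then obtain w t' where z: "z = torus_class \<Sigma> w t'"
      and "translate (point_set \<Sigma> (translate (interior W) w)) (- t') \<subseteq> translate L (- t)"
        "translate L (- t) \<subseteq> translate (point_set \<Sigma> (translate W w)) (- t')" by blast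
    then have s: "sandwich w (translate L (t' - t))"
      unfolding sandwich_def
      using sub[of "translate (point_set \<Sigma> (translate (interior W) w)) (- t')" t' "translate L (- t)"]
        sub[of "translate L (- t)" t' "translate (point_set \<Sigma> (translate W w)) (- t')"]
      by (simp add: add.commute)
    obtain x where x: "x \<in> translate L (t' - t)" using sandwich_nonempty[OF s] by blast
    then have "x \<in> Gam \<Sigma>" using s unfolding sandwich_iff by blast
    moreover have "x - (t' - t) \<in> Gam \<Sigma>" using x Xi_Gam[OF assms] mem_translate by blast
    ultimately
    have d: "t' - t \<in> Gam \<Sigma>" using Gam_diff[of x "x - (t' - t)"] by simp
    have "w = ?w + star \<Sigma> (t' - t)"
      using sandwich_unique[OF translate_sandwich[OF Xi_param_sandwich[OF assms] d] s] .
    then show "z = torus_class \<Sigma> ?w t"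
      unfolding z torus_class_eq_iff using d Gam_iff by simp
  qed
qed

lemma model_translate_W: "point_set \<Sigma> (translate W v) = model v"
  by (simp add: model_def)

section \<open>Closures of parameter sets and finite tests for the parameter\<close>

lemma in_Xi_closure:
  "\<Lambda> \<in> Xi_closure \<Sigma> W A \<longleftrightarrow>
    \<Lambda> \<in> Xi \<Sigma> W \<and> (\<forall>K. compact K \<longrightarrow> (\<exists>v\<in>A \<inter> NS \<Sigma> W. \<Lambda> \<inter> K = model v \<inter> K))"
  unfolding Xi_closure_def in_closure_of topspace_Xi_topology model_translate_W
proof (intro conj_cong refl iffI allI impI)
  fix K :: "(real^'d) set"
  assume L: "\<Lambda> \<in> Xi \<Sigma> W" and K: "compact K"
    and *: "\<forall>T. \<Lambda> \<in> T \<and> openin (Xi_topology \<Sigma> W) T \<longrightarrow> (\<exists>y. y \<in> model ` (A \<inter> NS \<Sigma> W) \<and> y \<in> T)"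
  have "openin (Xi_topology \<Sigma> W) {\<Lambda>' \<in> Xi \<Sigma> W. \<Lambda> \<inter> K = \<Lambda>' \<inter> K}"
    unfolding openin_Xi_topology Xi_nbhds_def using K by blast
  then obtain y where "y \<in> model ` (A \<inter> NS \<Sigma> W)" "y \<in> {\<Lambda>' \<in> Xi \<Sigma> W. \<Lambda> \<inter> K = \<Lambda>' \<inter> K}"
    using *[rule_format, of "{\<Lambda>' \<in> Xi \<Sigma> W. \<Lambda> \<inter> K = \<Lambda>' \<inter> K}"] L by auto
  then show "\<exists>v\<in>A \<inter> NS \<Sigma> W. \<Lambda> \<inter> K = model v \<inter> K" by auto
next
  fix T
  assume L: "\<Lambda> \<in> Xi \<Sigma> W" and *: "\<forall>K. compact K \<longrightarrow> (\<exists>v\<in>A \<inter> NS \<Sigma> W. \<Lambda> \<inter> K = model v \<inter> K)"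
    and T: "\<Lambda> \<in> T \<and> openin (Xi_topology \<Sigma> W) T"
  then obtain K where K: "compact K" "{\<Lambda>' \<in> Xi \<Sigma> W. \<Lambda> \<inter> K = \<Lambda>' \<inter> K} \<subseteq> T"
    unfolding openin_Xi_topology Xi_nbhds_def by blast
  then obtain v where v: "v \<in> A \<inter> NS \<Sigma> W" "\<Lambda> \<inter> K = model v \<inter> K" using *[rule_format, OF K(1)] by blast
  then have "model v \<in> T" using subsetD[OF K(2), of "model v"] model_Xi by simp
  then show "\<exists>y. y \<in> model ` (A \<inter> NS \<Sigma> W) \<and> y \<in> T" using v by blast
qed

text \<open>The nonsingular parameters approximating the one of \<Lambda> eventually enter the open
  set \<open>A\<close>.\<close>

lemma open_param_Xi_closure:
  assumes "\<Lambda> \<in> Xi \<Sigma> W" "open A" "Xi_param \<Sigma> W \<Lambda> \<in> A" shows "\<Lambda> \<in> Xi_closure \<Sigma> W A"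
  unfolding in_Xi_closure
proof (intro conjI allI impI)
  fix K :: "(real^'d) set" assume "compact K"
  then obtain R where R: "K \<subseteq> ball 0 R" using compact_imp_bounded bounded_subset_ballD by blast
  obtain e where e: "e > 0" "ball (Xi_param \<Sigma> W \<Lambda>) e \<subseteq> A" using assms open_contains_ball by blast
  obtain v where v: "v \<in> NS \<Sigma> W" "norm (v - Xi_param \<Sigma> W \<Lambda>) < e" "\<Lambda> \<inter> ball 0 R = model v \<inter> ball 0 R"
    using Xi_param_approx[OF assms(1)] e(1) unfolding approx_def by blast
  have "v \<in> A" using v(2) by (intro subsetD[OF e(2)]) (simp add: dist_norm norm_minus_commute)
  then show "\<exists>v\<in>A \<inter> NS \<Sigma> W. \<Lambda> \<inter> K = model v \<inter> K" using v R by blast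
qed (rule assms(1))

text \<open>The compact sets \<open>\<gamma>\<^sup>* - W\<close>, for \<open>\<gamma>\<^sup>* \<in> w + interior W\<close>, intersect in \<open>w\<close> only.\<close>

lemma finite_determining_set:
  assumes "e > 0"
  obtains F where "finite F" "F \<subseteq> Gam \<Sigma>" "\<And>\<gamma>. \<gamma> \<in> F \<Longrightarrow> star \<Sigma> \<gamma> - w \<in> interior W"
    "\<And>v. (\<And>\<gamma>. \<gamma> \<in> F \<Longrightarrow> star \<Sigma> \<gamma> - v \<in> W) \<Longrightarrow> norm (v - w) < e"
proof -
  define G where "G = {\<gamma> \<in> Gam \<Sigma>. star \<Sigma> \<gamma> - w \<in> interior W}"
  define C where "C \<gamma> = {v. star \<Sigma> \<gamma> - v \<in> W}" for \<gamma>
  obtain \<gamma>0 where g0: "\<gamma>0 \<in> G"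
  proof -
    have "open ((+) w ` interior W)" "(+) w ` interior W \<noteq> {}" using interior_W by (auto simp: open_translation)
    then obtain \<gamma> where "\<gamma> \<in> Gam \<Sigma>" "star \<Sigma> \<gamma> \<in> (+) w ` interior W" using star_dense by blast
    then show ?thesis using that unfolding G_def by force
  qed
  have clC: "closed (C \<gamma>)" for \<gamma>
    using continuous_closed_vimage[of W "\<lambda>v. star \<Sigma> \<gamma> - v"] compact_imp_closed[OF compact_W]
    unfolding C_def by (simp add: vimage_def)
  have "C \<gamma>0 = (\<lambda>x. star \<Sigma> \<gamma>0 - x) ` W" unfolding C_def by (force simp: image_iff)
  then have "compact (C \<gamma>0)"
    using compact_continuous_image[OF _ compact_W, of "\<lambda>x. star \<Sigma> \<gamma>0 - x"] by (simp add: continuous_intros)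
  \<comment> \<open>The point \<gamma>0 supplies a compact set to start from. Away from
    \<open>w\<close> the closed sets \<open>C \<gamma>\<close> have no common point in it, so
    finitely many of them already have none.\<close>
  then have comp: "compact (C \<gamma>0 - ball w e)" by (simp add: compact_diff)
  have "v = w" if "v \<in> (\<Inter>\<gamma>\<in>G. C \<gamma>)" for v
    by (rule sandwich_determined) (use that in \<open>simp add: C_def G_def\<close>)
  then have "(C \<gamma>0 - ball w e) \<inter> (\<Inter>\<gamma>\<in>G. C \<gamma>) = {}" using assms centre_in_ball by blast
  then obtain I where I: "finite I" "I \<subseteq> G" "(C \<gamma>0 - ball w e) \<inter> (\<Inter>\<gamma>\<in>I. C \<gamma>) = {}"
    using compact_imp_fip_image[OF comp, of G C] clC by blast
  show ?thesis
  proof (rule that[of "insert \<gamma>0 I"])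
    show "finite (insert \<gamma>0 I)" using I by simp
    show "insert \<gamma>0 I \<subseteq> Gam \<Sigma>" using I g0 unfolding G_def by blast
    show "star \<Sigma> \<gamma> - w \<in> interior W" if "\<gamma> \<in> insert \<gamma>0 I" for \<gamma> using that I g0 unfolding G_def by blast
    show "norm (v - w) < e" if *: "\<And>\<gamma>. \<gamma> \<in> insert \<gamma>0 I \<Longrightarrow> star \<Sigma> \<gamma> - v \<in> W" for v
    proof -
      have "v \<in> C \<gamma>0" "v \<in> (\<Inter>\<gamma>\<in>I. C \<gamma>)" using * unfolding C_def by auto
      then have "v \<in> ball w e" using I(3) by blast
      then show ?thesis by (simp add: dist_norm norm_minus_commute)
    qed
  qed
qed

end

section \<open>Continuity of the parameter and limits of model sets\<close>

lemma compact_translate: "compact K \<Longrightarrow> compact (translate K x)" for K :: "'a::real_normed_vector set"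
  using compact_translation[of K x] unfolding translate_def by (simp add: add.commute)

context cut_project_window begin

lemma Xi_closure_Xi: "\<Lambda> \<in> Xi_closure \<Sigma> W A \<Longrightarrow> \<Lambda> \<in> Xi \<Sigma> W"
  using in_Xi_closure by blast

lemma Xi_closure_limit:
  assumes "\<Lambda> \<in> Xi \<Sigma> W" "\<And>K. compact K \<Longrightarrow> \<exists>L\<in>Xi_closure \<Sigma> W A. \<Lambda> \<inter> K = L \<inter> K"
  shows "\<Lambda> \<in> Xi_closure \<Sigma> W A"
  unfolding in_Xi_closure
proof (intro conjI allI impI)
  fix K :: "(real^'d) set" assume K: "compact K"
  obtain L where "L \<in> Xi_closure \<Sigma> W A" "\<Lambda> \<inter> K = L \<inter> K" using assms(2)[OF K] by blast
  then show "\<exists>v\<in>A \<inter> NS \<Sigma> W. \<Lambda> \<inter> K = model v \<inter> K" using in_Xi_closure K by metis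
qed (rule assms(1))

lemma translate_Int_eq:
  fixes A :: "'a::ab_group_add set"
  assumes "A \<inter> translate K (- x) = B \<inter> translate K (- x)"
  shows "translate A x \<inter> K = translate B x \<inter> K"
proof -
  have "y \<in> translate A x \<longleftrightarrow> y \<in> translate B x" if "y \<in> K" for y
  proof -
    have "y - x \<in> translate K (- x)" using that by (simp add: mem_translate)
    then have "y - x \<in> A \<longleftrightarrow> y - x \<in> B" using assms by blast
    then show ?thesis by (simp add: mem_translate)
  qed
  then show ?thesis by blast
qed

lemma Xi_closure_translate:
  assumes "\<Lambda> \<in> Xi_closure \<Sigma> W A" "\<gamma> \<in> Gam \<Sigma>"
  shows "translate \<Lambda> \<gamma> \<in> Xi_closure \<Sigma> W (translate A (star \<Sigma> \<gamma>))"
  unfolding in_Xi_closure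
proof (intro conjI allI impI)
  show "translate \<Lambda> \<gamma> \<in> Xi \<Sigma> W" using translate_Xi Xi_closure_Xi assms by blast
  fix K :: "(real^'d) set" assume "compact K"
  then have "compact (translate K (- \<gamma>))" by (rule compact_translate)
  then obtain v where v: "v \<in> A" "v \<in> NS \<Sigma> W" "\<Lambda> \<inter> translate K (- \<gamma>) = model v \<inter> translate K (- \<gamma>)"
    using assms(1) unfolding in_Xi_closure by blast
  then have "translate \<Lambda> \<gamma> \<inter> K = model (v + star \<Sigma> \<gamma>) \<inter> K"
    using translate_Int_eq[OF v(3)] translate_model[OF assms(2)] by metis
  moreover have "v + star \<Sigma> \<gamma> \<in> translate A (star \<Sigma> \<gamma>)" using v(1) by (simp add: mem_translate)
  ultimately show "\<exists>u\<in>translate A (star \<Sigma> \<gamma>) \<inter> NS \<Sigma> W. translate \<Lambda> \<gamma> \<inter> K = model u \<inter> K"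
    using NS_shift[OF v(2) assms(2)] by blast
qed

text \<open>The determining set \<open>F\<close> is contained in \<Lambda>, so agreement on
  \<open>F\<close> puts it into \<open>L\<close> as well, and the upper inclusion for
  \<open>L\<close> does the rest.\<close>

lemma Xi_param_continuous:
  assumes "\<Lambda> \<in> Xi \<Sigma> W" "e > 0"
  obtains F where "finite F"
    "\<And>w L. sandwich w L \<Longrightarrow> \<Lambda> \<inter> F = L \<inter> F \<Longrightarrow> norm (w - Xi_param \<Sigma> W \<Lambda>) < e"
proof -
  obtain F where F: "finite F" "F \<subseteq> Gam \<Sigma>"
    "\<And>\<gamma>. \<gamma> \<in> F \<Longrightarrow> star \<Sigma> \<gamma> - Xi_param \<Sigma> W \<Lambda> \<in> interior W"
    "\<And>v. (\<And>\<gamma>. \<gamma> \<in> F \<Longrightarrow> star \<Sigma> \<gamma> - v \<in> W) \<Longrightarrow> norm (v - Xi_param \<Sigma> W \<Lambda>) < e"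
    using finite_determining_set[OF assms(2), of "Xi_param \<Sigma> W \<Lambda>"] by metis
  have FL: "F \<subseteq> \<Lambda>" using F(2,3) Xi_param_sandwich[OF assms(1)] unfolding sandwich_iff by blast
  show ?thesis
  proof (rule that[OF F(1)])
    fix w L assume L: "sandwich w L" "\<Lambda> \<inter> F = L \<inter> F"
    have "star \<Sigma> \<gamma> - w \<in> W" if "\<gamma> \<in> F" for \<gamma>
      using that L FL unfolding sandwich_iff by blast
    then show "norm (w - Xi_param \<Sigma> W \<Lambda>) < e" by (rule F(4))
  qed
qed

text \<open>The points \<delta> + \<gamma> with \<open>star \<Sigma> \<gamma>\<close> close to the
  parameter of \<open>L\<close> lie in \<open>L\<close>, and \<gamma> can be taken of bounded norm.
  A point in a fixed ball is what later reveals a translation vector to be in \<Gamma>.\<close>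

lemma Xi_meets_ball: obtains R where "\<And>L. L \<in> Xi \<Sigma> W \<Longrightarrow> L \<inter> ball 0 R \<noteq> {}"
proof -
  obtain \<delta> where \<delta>: "\<delta> \<in> Gam \<Sigma>" "star \<Sigma> \<delta> \<in> interior W"
    using star_dense[OF open_interior interior_W] by blast
  then obtain d where d: "d > 0" "ball (star \<Sigma> \<delta>) d \<subseteq> interior W"
    using open_contains_ball open_interior by metis
  obtain k where k: "\<And>w. \<exists>\<gamma>\<in>Gam \<Sigma>. norm \<gamma> < k \<and> norm (star \<Sigma> \<gamma> - w) < d"
    using relatively_dense[OF d(1)] by blast
  have "L \<inter> ball 0 (norm \<delta> + k) \<noteq> {}" if L: "L \<in> Xi \<Sigma> W" for L
  proof -
    obtain \<gamma> where \<gamma>: "\<gamma> \<in> Gam \<Sigma>" "norm \<gamma> < k" "norm (star \<Sigma> \<gamma> - Xi_param \<Sigma> W L) < d" using k by blast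
    have "star \<Sigma> (\<delta> + \<gamma>) - Xi_param \<Sigma> W L \<in> ball (star \<Sigma> \<delta>) d"
      using \<gamma>(3) star_add[OF \<delta>(1) \<gamma>(1)] by (simp add: dist_norm norm_minus_commute algebra_simps)
    then have "\<delta> + \<gamma> \<in> L"
      using d(2) Xi_param_sandwich[OF L] Gam_add[OF \<delta>(1) \<gamma>(1)] unfolding sandwich_iff by blast
    moreover have "norm (\<delta> + \<gamma>) < norm \<delta> + k" using norm_triangle_ineq[of \<delta> \<gamma>] \<gamma>(2) by linarith
    ultimately show ?thesis by auto
  qed
  then show ?thesis using that by blast
qed

text \<open>The determining set found for the parameter 0 is transported to any other parameter by a
  \<gamma> of bounded norm, so its size does not depend on \<open>L\<close>.\<close>

lemma Xi_param_uniform: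
  assumes "e > 0"
  obtains R where "\<And>L L'. L \<in> Xi \<Sigma> W \<Longrightarrow> L' \<in> Xi \<Sigma> W \<Longrightarrow> L \<inter> ball 0 R = L' \<inter> ball 0 R \<Longrightarrow>
    norm (Xi_param \<Sigma> W L - Xi_param \<Sigma> W L') < e"
proof -
  obtain F where F: "finite F" "F \<subseteq> Gam \<Sigma>" "\<And>\<gamma>. \<gamma> \<in> F \<Longrightarrow> star \<Sigma> \<gamma> - 0 \<in> interior W"
    "\<And>v. (\<And>\<gamma>. \<gamma> \<in> F \<Longrightarrow> star \<Sigma> \<gamma> - v \<in> W) \<Longrightarrow> norm (v - 0) < e / 2"
    using finite_determining_set[of "e / 2" 0] assms by (metis half_gt_zero)
  have "\<forall>\<gamma>\<in>F. \<exists>d>0. ball (star \<Sigma> \<gamma>) d \<subseteq> interior W"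
    using F(3) open_contains_ball open_interior by (metis diff_zero)
  then obtain d where d: "\<And>\<gamma>. \<gamma> \<in> F \<Longrightarrow> d \<gamma> > 0 \<and> ball (star \<Sigma> \<gamma>) (d \<gamma>) \<subseteq> interior W" by metis
  \<comment> \<open>The bounds \<open>d \<gamma>\<close> keep the transported set inside the
    interior of the window, so that it belongs to \<open>L\<close>; the bound \<open>e / 2\<close>
    is the share of the transport in the final triangle inequality.\<close>
  define \<eta> where "\<eta> = Min (insert (e / 2) (d ` F))"
  have "\<eta> \<le> e / 2"
    unfolding \<eta>_def using F(1) by (intro Min_le) auto
  moreover have "\<eta> > 0" "\<And>\<gamma>. \<gamma> \<in> F \<Longrightarrow> \<eta> \<le> d \<gamma>"
    unfolding \<eta>_def using F(1) d assms by auto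
  ultimately have \<eta>: "\<eta> > 0" "\<eta> \<le> e / 2" "\<And>\<gamma>. \<gamma> \<in> F \<Longrightarrow> \<eta> \<le> d \<gamma>" by blast+
  obtain k where k: "\<And>w. \<exists>\<gamma>\<in>Gam \<Sigma>. norm \<gamma> < k \<and> norm (star \<Sigma> \<gamma> - w) < \<eta>"
    using relatively_dense[OF \<eta>(1)] by blast
  obtain r where r: "\<And>\<delta>. \<delta> \<in> F \<Longrightarrow> norm \<delta> \<le> r"
    using finite_imp_bounded[OF F(1)] unfolding bounded_iff by blast
  have "norm (Xi_param \<Sigma> W L - Xi_param \<Sigma> W L') < e"
    if L: "L \<in> Xi \<Sigma> W" "L' \<in> Xi \<Sigma> W" "L \<inter> ball 0 (r + k) = L' \<inter> ball 0 (r + k)" for L L'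
  proof -
    let ?w = "Xi_param \<Sigma> W L" and ?w' = "Xi_param \<Sigma> W L'"
    obtain \<gamma> where \<gamma>: "\<gamma> \<in> Gam \<Sigma>" "norm \<gamma> < k" "norm (star \<Sigma> \<gamma> - ?w) < \<eta>" using k by blast
    have "star \<Sigma> \<delta> - (?w' - star \<Sigma> \<gamma>) \<in> W" if \<delta>: "\<delta> \<in> F" for \<delta>
    proof -
      have \<delta>G: "\<delta> \<in> Gam \<Sigma>" using \<delta> F(2) by blast
      have "star \<Sigma> (\<delta> + \<gamma>) - ?w \<in> ball (star \<Sigma> \<delta>) (d \<delta>)"
        using \<gamma>(3) \<eta>(3)[OF \<delta>] star_add[OF \<delta>G \<gamma>(1)] by (simp add: dist_norm norm_minus_commute algebra_simps)
      then have "\<delta> + \<gamma> \<in> L"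
        using d[OF \<delta>] Xi_param_sandwich[OF L(1)] Gam_add[OF \<delta>G \<gamma>(1)] unfolding sandwich_iff by blast
      moreover have "\<delta> + \<gamma> \<in> ball 0 (r + k)" using norm_triangle_ineq[of \<delta> \<gamma>] \<gamma>(2) r[OF \<delta>] by simp
      ultimately have "\<delta> + \<gamma> \<in> L'" using L(3) by blast
      then have "star \<Sigma> (\<delta> + \<gamma>) - ?w' \<in> W" using Xi_param_sandwich[OF L(2)] unfolding sandwich_iff by blast
      then show ?thesis using star_add[OF \<delta>G \<gamma>(1)] by (simp add: algebra_simps)
    qed
    then have "norm (?w' - star \<Sigma> \<gamma> - 0) < e / 2" by (rule F(4))
    moreover have "?w - ?w' = - (star \<Sigma> \<gamma> - ?w) - (?w' - star \<Sigma> \<gamma>)" by simp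
    then have "norm (?w - ?w') \<le> norm (star \<Sigma> \<gamma> - ?w) + norm (?w' - star \<Sigma> \<gamma>)"
      by (metis norm_minus_cancel norm_triangle_ineq4)
    ultimately show ?thesis using \<gamma>(3) \<eta>(2) by simp
  qed
  then show ?thesis using that by blast
qed

text \<open>For use on the hull, where the translation \<open>u\<close> is arbitrary: agreement on a
  large ball forces \<open>u\<close> into \<Gamma>, after which uniform continuity applies.\<close>

lemma Xi_near_translate:
  assumes "e > 0"
  obtains R where "R > 0" "\<And>L L' u. L \<in> Xi \<Sigma> W \<Longrightarrow> L' \<in> Xi \<Sigma> W \<Longrightarrow> L \<inter> ball 0 R = translate L' u \<inter> ball 0 R \<Longrightarrow>
    u \<in> Gam \<Sigma> \<and> norm (Xi_param \<Sigma> W L - Xi_param \<Sigma> W L' - star \<Sigma> u) < e"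
proof -
  obtain R1 where R1: "\<And>L. L \<in> Xi \<Sigma> W \<Longrightarrow> L \<inter> ball 0 R1 \<noteq> {}" using Xi_meets_ball by blast
  obtain R2 where R2: "\<And>L L'. L \<in> Xi \<Sigma> W \<Longrightarrow> L' \<in> Xi \<Sigma> W \<Longrightarrow> L \<inter> ball 0 R2 = L' \<inter> ball 0 R2 \<Longrightarrow>
    norm (Xi_param \<Sigma> W L - Xi_param \<Sigma> W L') < e" using Xi_param_uniform[OF assms] by blast
  define R where "R = max 1 (max R1 R2)"
  have sub: "ball (0::real^'d) R1 \<subseteq> ball 0 R" "ball (0::real^'d) R2 \<subseteq> ball 0 R" unfolding R_def by auto
  show ?thesis
  proof (rule that[of R])
    show "R > 0" unfolding R_def by simp
    fix L L' u assume L: "L \<in> Xi \<Sigma> W" "L' \<in> Xi \<Sigma> W" "L \<inter> ball 0 R = translate L' u \<inter> ball 0 R"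
    obtain x where x: "x \<in> L" "x \<in> ball 0 R" using R1[OF L(1)] sub by blast
    then have "x - u \<in> L'" using L(3) mem_translate by blast
    then have "x \<in> Gam \<Sigma>" "x - u \<in> Gam \<Sigma>" using Xi_Gam L x by blast+
    then have u: "u \<in> Gam \<Sigma>" using Gam_diff[of x "x - u"] by simp
    have "L \<inter> ball 0 R2 = translate L' u \<inter> ball 0 R2" using L(3) sub by blast
    then have "norm (Xi_param \<Sigma> W L - Xi_param \<Sigma> W (translate L' u)) < e"
      using R2 L translate_Xi[OF L(2) u] by blast
    then show "u \<in> Gam \<Sigma> \<and> norm (Xi_param \<Sigma> W L - Xi_param \<Sigma> W L' - star \<Sigma> u) < e"
      using u Xi_param_translate[OF L(2) u] by (simp add: diff_diff_eq)
  qed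
qed

text \<open>A sequential compactness statement. A diagonal subsequence makes all indicators on the
  countable set \<Gamma> converge, hence become constant, and on a ball only finitely many \<gamma>
  are involved.\<close>

lemma Xi_limit_of_models:
  assumes "\<And>k. v k \<in> NS \<Sigma> W" "v \<longlonglongrightarrow> w"
  obtains \<Lambda> r where "strict_mono (r :: nat \<Rightarrow> nat)" "approx w \<Lambda>"
    "\<And>R. \<forall>\<^sub>F k in sequentially. \<Lambda> \<inter> ball 0 R = model (v (r k)) \<inter> ball 0 R"
proof -
  obtain r where r: "strict_mono (r :: nat \<Rightarrow> nat)"
    "\<And>\<gamma>. \<gamma> \<in> Gam \<Sigma> \<Longrightarrow> \<exists>l. (\<lambda>k. indicator (model (v (r k))) \<gamma> :: real) \<longlonglongrightarrow> l"
    using function_convergent_subsequence[OF countable_Gam, of "\<lambda>k \<gamma>. indicator (model (v k)) \<gamma> :: real" 1]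
    by (auto simp: indicator_def)
  define \<Lambda> where "\<Lambda> = {\<gamma> \<in> Gam \<Sigma>. \<forall>\<^sub>F k in sequentially. \<gamma> \<in> model (v (r k))}"
  have ev: "\<forall>\<^sub>F k in sequentially. \<gamma> \<in> \<Lambda> \<longleftrightarrow> \<gamma> \<in> model (v (r k))" if \<gamma>: "\<gamma> \<in> Gam \<Sigma>" for \<gamma>
  proof -
    obtain l where l: "(\<lambda>k. indicator (model (v (r k))) \<gamma> :: real) \<longlonglongrightarrow> l" using r(2)[OF \<gamma>] by blast
    \<comment> \<open>Two indicator values within 1/2 of the same limit differ by less than 1 and
      are therefore equal.\<close>
    have "\<forall>\<^sub>F k in sequentially. dist (indicator (model (v (r k))) \<gamma> :: real) l < 1 / 2"
      using tendstoD[OF l, of "1 / 2"] by simp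
    then obtain N where N: "\<And>k. k \<ge> N \<Longrightarrow> dist (indicator (model (v (r k))) \<gamma> :: real) l < 1 / 2"
      unfolding eventually_sequentially by blast
    have same: "\<gamma> \<in> model (v (r k)) \<longleftrightarrow> \<gamma> \<in> model (v (r N))" if "k \<ge> N" for k
    proof -
      have "dist (indicator (model (v (r k))) \<gamma> :: real) (indicator (model (v (r N))) \<gamma>) < 1"
        using dist_triangle_half_l[of _ l 1] N[OF that] N[of N] by (simp add: dist_commute)
      then show ?thesis by (cases "\<gamma> \<in> model (v (r k))"; cases "\<gamma> \<in> model (v (r N))") (simp_all add: dist_norm)
    qed
    have "\<gamma> \<in> \<Lambda> \<longleftrightarrow> \<gamma> \<in> model (v (r N))"
    proof
      assume "\<gamma> \<in> \<Lambda>"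
      then obtain M where "\<And>k. k \<ge> M \<Longrightarrow> \<gamma> \<in> model (v (r k))"
        unfolding \<Lambda>_def eventually_sequentially by blast
      then show "\<gamma> \<in> model (v (r N))" using same[of "max M N"] by simp
    next
      assume "\<gamma> \<in> model (v (r N))"
      then show "\<gamma> \<in> \<Lambda>" unfolding \<Lambda>_def eventually_sequentially using same \<gamma> by blast
    qed
    then show ?thesis unfolding eventually_sequentially using same by blast
  qed
  have vr: "(\<lambda>k. v (r k)) \<longlonglongrightarrow> w"
    using LIMSEQ_subseq_LIMSEQ[OF assms(2) r(1)] by (simp add: comp_def)
  obtain b where b: "\<And>x. x \<in> W \<Longrightarrow> norm x \<le> b" using bound_W by blast
  have agree: "\<forall>\<^sub>F k in sequentially. \<Lambda> \<inter> ball 0 R = model (v (r k)) \<inter> ball 0 R" for R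
  proof -
    \<comment> \<open>Model sets with parameter within 1 of \<open>w\<close> have no points in the
      ball outside this finite set.\<close>
    define F where "F = {\<gamma> \<in> Gam \<Sigma>. \<gamma> \<in> ball 0 R \<and> star \<Sigma> \<gamma> \<in> cball w (b + 1)}"
    have finF: "finite F" unfolding F_def by (intro finite_Gam_bounded) auto
    have near: "\<forall>\<^sub>F k in sequentially. norm (v (r k) - w) < 1"
      using tendstoD[OF vr zero_less_one] by (simp add: dist_norm)
    have inF: "\<gamma> \<in> F" if "\<gamma> \<in> model u" "norm (u - w) < 1" "\<gamma> \<in> ball 0 R" for \<gamma> u
    proof -
      have "norm (star \<Sigma> \<gamma> - w) \<le> norm (star \<Sigma> \<gamma> - u) + norm (u - w)"
        using norm_triangle_ineq[of "star \<Sigma> \<gamma> - u" "u - w"] by simp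
      then have "norm (star \<Sigma> \<gamma> - w) \<le> b + 1" using b that unfolding mem_model by fastforce
      then show ?thesis unfolding F_def using that by (simp add: mem_model dist_norm norm_minus_commute)
    qed
    have evF: "\<forall>\<^sub>F k in sequentially. \<forall>\<gamma>\<in>F. \<gamma> \<in> \<Lambda> \<longleftrightarrow> \<gamma> \<in> model (v (r k))"
      using finF ev by (intro eventually_ball_finite) (auto simp: F_def)
    have LF: "\<gamma> \<in> F" if \<gamma>: "\<gamma> \<in> \<Lambda>" "\<gamma> \<in> ball 0 R" for \<gamma>
    proof -
      have "\<forall>\<^sub>F k in sequentially. \<gamma> \<in> model (v (r k)) \<and> norm (v (r k) - w) < 1"
        using \<gamma>(1) near unfolding \<Lambda>_def by (simp add: eventually_conj)
      then obtain k where "\<gamma> \<in> model (v (r k))" "norm (v (r k) - w) < 1"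
        using eventually_happens' trivial_limit_sequentially by blast
      then show ?thesis using inF \<gamma>(2) by blast
    qed
    show ?thesis
      using evF near by eventually_elim (use inF LF in blast)
  qed
  have "approx w \<Lambda>"
    unfolding approx_def
  proof (intro conjI allI impI)
    show "\<Lambda> \<subseteq> Gam \<Sigma>" unfolding \<Lambda>_def by blast
    fix R e :: real assume "e > 0"
    then have "\<forall>\<^sub>F k in sequentially. norm (v (r k) - w) < e"
      using tendstoD[OF vr] by (simp add: dist_norm)
    then have "\<forall>\<^sub>F k in sequentially. norm (v (r k) - w) < e \<and> \<Lambda> \<inter> ball 0 R = model (v (r k)) \<inter> ball 0 R"
      using agree by (rule eventually_conj)
    then show "\<exists>u\<in>NS \<Sigma> W. norm (u - w) < e \<and> \<Lambda> \<inter> ball 0 R = model u \<inter> ball 0 R"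
      using eventually_happens' trivial_limit_sequentially assms(1) by blast
  qed
  then show ?thesis using that r(1) agree by blast
qed

text \<open>Produces elements with a singular parameter on the boundary of \<open>A\<close> and on a
  prescribed side of it; they become the test points for cone types.\<close>

lemma Xi_closure_exists:
  assumes "open A" "w \<in> closure A"
  obtains \<Lambda> where "\<Lambda> \<in> Xi_closure \<Sigma> W A" "Xi_param \<Sigma> W \<Lambda> = w"
proof -
  have "\<exists>v\<in>A \<inter> NS \<Sigma> W. norm (v - w) < 1 / real (Suc k)" for k
  proof -
    have "open (A \<inter> ball w (1 / real (Suc k)))" using assms by auto
    moreover obtain y where "y \<in> A" "dist y w < 1 / real (Suc k)"
      using assms(2)[unfolded closure_approachable, rule_format, of "1 / real (Suc k)"] by auto
    then have "A \<inter> ball w (1 / real (Suc k)) \<noteq> {}" by (auto simp: dist_commute)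
    ultimately obtain v where "v \<in> NS \<Sigma> W" "v \<in> A \<inter> ball w (1 / real (Suc k))" using NS_dense by blast
    then show ?thesis by (intro bexI[of _ v]) (simp_all add: dist_norm norm_minus_commute)
  qed
  then obtain v where v: "\<And>k. v k \<in> A" "\<And>k. v k \<in> NS \<Sigma> W" "\<And>k. norm (v k - w) < 1 / real (Suc k)"
    by (metis IntE)
  have "(\<lambda>k. v k - w) \<longlonglongrightarrow> 0"
  proof (rule Lim_null_comparison[OF always_eventually LIMSEQ_inverse_real_of_nat], intro allI)
    show "norm (v k - w) \<le> inverse (real (Suc k))" for k
      using v(3)[of k] by (simp add: inverse_eq_divide)
  qed
  then have "v \<longlonglongrightarrow> w" by (rule LIM_zero_cancel)
  then obtain \<Lambda> r where L: "approx w \<Lambda>"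
    "\<And>R. \<forall>\<^sub>F k in sequentially. \<Lambda> \<inter> ball 0 R = model (v (r k)) \<inter> ball 0 R"
    using Xi_limit_of_models[of v w] v(2) by metis
  have "\<Lambda> \<in> Xi_closure \<Sigma> W A"
    unfolding in_Xi_closure
  proof (intro conjI allI impI)
    show "\<Lambda> \<in> Xi \<Sigma> W" using approx_Xi L(1) .
    fix K :: "(real^'d) set" assume "compact K"
    then obtain R where R: "K \<subseteq> ball 0 R" using compact_imp_bounded bounded_subset_ballD by blast
    obtain k where "\<Lambda> \<inter> ball 0 R = model (v (r k)) \<inter> ball 0 R"
      using L(2) eventually_happens' trivial_limit_sequentially by blast
    then show "\<exists>v\<in>A \<inter> NS \<Sigma> W. \<Lambda> \<inter> K = model v \<inter> K" using R v(1,2) by blast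
  qed
  then show ?thesis using that Xi_param_eq[OF approx_sandwich[OF L(1)]] by blast
qed

end

section \<open>Cut types\<close>

locale almost_canonical_window = cut_project_window \<Sigma> W
  for \<Sigma> :: "((real^'n) \<times> (real^'d)) set" and W +
  fixes \<nu> :: "(real^'n) set \<Rightarrow> real^'n"
  assumes ori: "orientation \<nu>" and canon: "almost_canonical \<Sigma> W \<nu>"
begin

section \<open>Facets, their hyperplanes and nonsingularity\<close>

lemma facet_nonempty: "f \<in> window_facets W \<Longrightarrow> f \<noteq> {}"
  unfolding window_facets_def facet_of_def by auto

lemma mem_facet_dir:
  assumes "a \<in> affine hull f" shows "x - a \<in> facet_dir f \<longleftrightarrow> x \<in> affine hull f"
proof
  assume "x - a \<in> facet_dir f"
  then obtain y z where yz: "x - a = y - z" "y \<in> affine hull f" "z \<in> affine hull f" unfolding facet_dir_def by blast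
  then have "x = 1 *\<^sub>R a + 1 *\<^sub>R (y - z)" by (simp add: algebra_simps)
  then show "x \<in> affine hull f" using mem_affine_3_minus[OF affine_affine_hull assms yz(2,3), of 1] by simp
next
  assume "x \<in> affine hull f" then show "x - a \<in> facet_dir f" unfolding facet_dir_def using assms by blast
qed

lemma facet_dir_eq:
  assumes "a \<in> affine hull f" shows "facet_dir f = (\<lambda>x. x - a) ` (affine hull f)"
proof -
  have "y \<in> (\<lambda>x. x - a) ` (affine hull f) \<longleftrightarrow> y + a \<in> affine hull f" for y
    by (force simp: image_iff)
  then show ?thesis using mem_facet_dir[OF assms, of "_ + a"] by auto
qed

text \<open>\<open>orientation\<close> speaks only of linear hyperplanes, so the dimension must be
  computed: a facet of \<open>- W\<close> has affine dimension n - 1, and \<open>facet_dir\<close>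
  is its affine hull moved to the origin.\<close>

lemma orientation_facet_dir:
  assumes "f \<in> window_facets W"
  shows "\<nu> (facet_dir f) \<noteq> 0" "facet_dir f = {x. \<nu> (facet_dir f) \<bullet> x = 0}"
proof -
  obtain a where a: "a \<in> affine hull f" using facet_nonempty[OF assms] hull_inc by fastforce
  have sub: "subspace (facet_dir f)"
    unfolding facet_dir_eq[OF a] by (rule affine_diffs_subspace_subtract[OF affine_affine_hull a])
  have "aff_dim (uminus ` W) = aff_dim W"
    by (rule aff_dim_injective_linear_image) (simp_all add: linear_uminus)
  then have "aff_dim f = int CARD('n) - 1"
    using assms aff_dim_W unfolding window_facets_def facet_of_def by simp
  moreover have "aff_dim f = int (dim (facet_dir f))"
    using aff_dim_eq_dim[of a "affine hull f"] a unfolding facet_dir_eq[OF a] by (simp add: image_def hull_hull)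
  ultimately have "dim (facet_dir f) + 1 = CARD('n)" by simp
  then show "\<nu> (facet_dir f) \<noteq> 0" "facet_dir f = {x. \<nu> (facet_dir f) \<bullet> x = 0}"
    using ori sub unfolding orientation_def by blast+
qed

lemma hyperplane_orientation:
  assumes "H \<in> hyperplanes W" shows "\<nu> H \<noteq> 0" "H = {x. \<nu> H \<bullet> x = 0}"
  using assms orientation_facet_dir unfolding hyperplanes_def by auto

text \<open>A proper face of a convex set misses its interior.\<close>

lemma facet_subset_frontier: assumes "f \<in> window_facets W" shows "f \<subseteq> uminus ` frontier W"
proof
  fix x assume x: "x \<in> f"
  have f: "f face_of (uminus ` W)" "aff_dim f = aff_dim (uminus ` W) - 1"
    using assms unfolding window_facets_def facet_of_def by auto
  then have "f \<noteq> uminus ` W" by auto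
  then have "f \<inter> interior (uminus ` W) = {}" by (rule face_of_disjoint_interior[OF f(1)])
  then have "x \<in> uminus ` W" "x \<notin> uminus ` interior W"
    using x face_of_imp_subset[OF f(1)] unfolding interior_negations by blast+
  then show "x \<in> uminus ` frontier W" unfolding frontier_W by blast
qed

lemma cuts_iff: "H \<in> cuts \<Sigma> W w \<longleftrightarrow>
  (\<exists>f\<in>window_facets W. facet_dir f = H \<and> (\<exists>\<gamma>\<in>Gam \<Sigma>. w - star \<Sigma> \<gamma> \<in> affine hull f))"
proof -
  have "w \<in> {x + a |x a. x \<in> Gam_star \<Sigma> \<and> a \<in> affine hull f} \<longleftrightarrow> (\<exists>\<gamma>\<in>Gam \<Sigma>. w - star \<Sigma> \<gamma> \<in> affine hull f)" for f
    unfolding Gam_star_def by (force intro: exI[of _ "w - star \<Sigma> _"])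
  then show ?thesis unfolding cuts_def hyperplanes_def by blast
qed

lemma cuts_hyperplane: "H \<in> cuts \<Sigma> W w \<Longrightarrow> H \<in> hyperplanes W"
  unfolding cuts_def by blast

lemma cuts_shift: assumes "H \<in> cuts \<Sigma> W w" "\<gamma> \<in> Gam \<Sigma>" shows "H \<in> cuts \<Sigma> W (w + star \<Sigma> \<gamma>)"
proof -
  obtain f \<delta> where f: "f \<in> window_facets W" "facet_dir f = H" "\<delta> \<in> Gam \<Sigma>" "w - star \<Sigma> \<delta> \<in> affine hull f"
    using assms(1) cuts_iff by blast
  then have "w + star \<Sigma> \<gamma> - star \<Sigma> (\<delta> + \<gamma>) \<in> affine hull f" using star_add[OF f(3) assms(2)] by simp
  then show ?thesis using f Gam_add[OF f(3) assms(2)] cuts_iff by blast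
qed

lemma cuts_shift_iff: "\<gamma> \<in> Gam \<Sigma> \<Longrightarrow> H \<in> cuts \<Sigma> W (w + star \<Sigma> \<gamma>) \<longleftrightarrow> H \<in> cuts \<Sigma> W w"
  using cuts_shift[of H w \<gamma>] cuts_shift[of H "w + star \<Sigma> \<gamma>" "- \<gamma>"] star_minus by auto

lemma cuts_add_hyperplane: assumes "H \<in> cuts \<Sigma> W w" "h \<in> H" shows "H \<in> cuts \<Sigma> W (w + h)"
proof -
  obtain f \<delta> where f: "f \<in> window_facets W" "facet_dir f = H" "\<delta> \<in> Gam \<Sigma>" "w - star \<Sigma> \<delta> \<in> affine hull f"
    using assms(1) cuts_iff by blast
  have "(w + h - star \<Sigma> \<delta>) - (w - star \<Sigma> \<delta>) \<in> facet_dir f" using f(2) assms(2) by simp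
  then have "w + h - star \<Sigma> \<delta> \<in> affine hull f" using mem_facet_dir[OF f(4)] by blast
  then show ?thesis using f cuts_iff by blast
qed

text \<open>Otherwise \<open>v\<close> would lie in a \<Gamma>-translate of the affine span of a
  facet. The first condition of \<open>almost_canonical\<close> shrinks the span to a translate of
  the facet itself, which is part of the boundary of \<open>- W\<close>, so \<open>v\<close> would
  be singular.\<close>

lemma NS_off_cuts: assumes "H \<in> cuts \<Sigma> W w" "v \<in> NS \<Sigma> W" shows "v - w \<notin> H"
proof
  assume "v - w \<in> H"
  then have "H \<in> cuts \<Sigma> W v" using cuts_add_hyperplane[OF assms(1)] by fastforce
  then obtain f \<gamma> where f: "f \<in> window_facets W" "\<gamma> \<in> Gam \<Sigma>" "v - star \<Sigma> \<gamma> \<in> affine hull f"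
    using cuts_iff by blast
  have "affine hull f \<subseteq> {star \<Sigma> \<delta> + x |\<delta> x. \<delta> \<in> Stab \<Sigma> f \<and> x \<in> f}"
    using canon f(1) unfolding almost_canonical_def by blast
  then obtain \<delta> x where \<delta>: "v - star \<Sigma> \<gamma> = star \<Sigma> \<delta> + x" "\<delta> \<in> Gam \<Sigma>" "x \<in> f" using f(3) unfolding Stab_def by blast
  obtain y where y: "y \<in> frontier W" "x = - y" using facet_subset_frontier[OF f(1)] \<delta>(3) by blast
  have "star \<Sigma> (\<gamma> + \<delta>) - v = y" using \<delta>(1) y(2) star_add[OF f(2) \<delta>(2)] by (simp add: algebra_simps)
  then show False using assms(2) y(1) Gam_add[OF f(2) \<delta>(2)] NS_iff by metis
qed

section \<open>The two sides of a cut\<close>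

lemma open_half: "s \<in> {S_minus, S_plus} \<Longrightarrow> open (half \<nu> H s)"
  by (auto simp: open_halfspace_lt open_halfspace_gt)

lemma open_translate_half: "s \<in> {S_minus, S_plus} \<Longrightarrow> open (translate (half \<nu> H s) w)"
  using open_translation[OF open_half, of s w H] unfolding translate_def by (simp add: add.commute)

lemma half_cases: assumes "H \<in> hyperplanes W"
  obtains s where "s \<in> {S_minus, S_zero, S_plus}" "x \<in> half \<nu> H s"
proof -
  consider "\<nu> H \<bullet> x < 0" | "\<nu> H \<bullet> x = 0" | "\<nu> H \<bullet> x > 0" by linarith
  then show ?thesis
  proof cases
    case 2
    then have "x \<in> half \<nu> H S_zero" using hyperplane_orientation(2)[OF assms] by auto
    then show ?thesis using that by blast
  qed (use that[of S_minus] that[of S_plus] in auto)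
qed

lemma half_disjoint: "half \<nu> H S_minus \<inter> half \<nu> H S_plus = {}"
  by auto

lemma half_add_hyperplane:
  assumes "H \<in> hyperplanes W" "h \<in> H" "s \<in> {S_minus, S_plus}" shows "x + h \<in> half \<nu> H s \<longleftrightarrow> x \<in> half \<nu> H s"
proof -
  have "\<nu> H \<bullet> h = 0" using hyperplane_orientation(2)[OF assms(1)] assms(2) by blast
  then show ?thesis using assms(3) by (auto simp: inner_add_right)
qed

text \<open>Carries the second condition of \<open>almost_canonical\<close>, stated for affine
  half-spaces at star images, over to half-spaces based at a parameter \<open>w\<close> on the same
  affine hyperplane.\<close>

lemma translate_affine_half:
  assumes "f \<in> window_facets W" "w - c \<in> affine hull f" "s \<in> {S_minus, S_plus}"
  shows "translate (affine_half \<nu> f s) c = translate (half \<nu> (facet_dir f) s) w"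
proof -
  have H: "facet_dir f \<in> hyperplanes W" using assms(1) unfolding hyperplanes_def by blast
  have "y \<in> affine_half \<nu> f s \<longleftrightarrow> y - (w - c) \<in> half \<nu> (facet_dir f) s" for y
  proof
    assume "y \<in> affine_half \<nu> f s"
    then obtain a x where a: "y = a + x" "a \<in> affine hull f" "x \<in> half \<nu> (facet_dir f) s"
      unfolding affine_half_def by blast
    have "a - (w - c) \<in> facet_dir f" using mem_facet_dir[OF assms(2)] a(2) by blast
    moreover have "y - (w - c) = x + (a - (w - c))" using a(1) by simp
    ultimately show "y - (w - c) \<in> half \<nu> (facet_dir f) s" using half_add_hyperplane[OF H _ assms(3)] a(3) by metis
  next
    assume "y - (w - c) \<in> half \<nu> (facet_dir f) s"
    moreover have "y = (w - c) + (y - (w - c))" by simp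
    ultimately show "y \<in> affine_half \<nu> f s" unfolding affine_half_def using assms(2) by blast
  qed
  then show ?thesis by (simp add: set_eq_iff mem_translate algebra_simps)
qed

lemma cut_open:
  assumes "H \<in> cuts \<Sigma> W w" "s \<in> {S_minus, S_plus}"
  shows "openin (Xi_topology \<Sigma> W) (Xi_closure \<Sigma> W (translate (half \<nu> H s) w))"
proof -
  obtain f \<gamma> where f: "f \<in> window_facets W" "facet_dir f = H" "\<gamma> \<in> Gam \<Sigma>" "w - star \<Sigma> \<gamma> \<in> affine hull f"
    using assms(1) cuts_iff by blast
  have "openin (Xi_topology \<Sigma> W) (Xi_closure \<Sigma> W (translate (affine_half \<nu> f s) (star \<Sigma> \<gamma>)))"
    using canon f assms(2) unfolding almost_canonical_def by blast
  then show ?thesis using translate_affine_half[OF f(1,4) assms(2)] f(2) by simp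
qed

text \<open>The nonsingular parameters approximating \<Lambda> avoid \<open>w + H\<close>. A ball
  large enough to contain both witnesses against membership therefore meets a contradiction on
  whichever side the approximant lies.\<close>

lemma cut_exhaustive:
  assumes "\<Lambda> \<in> Xi \<Sigma> W" "H \<in> cuts \<Sigma> W w"
  obtains s where "s \<in> {S_minus, S_plus}" "\<Lambda> \<in> Xi_closure \<Sigma> W (translate (half \<nu> H s) w)"
proof (rule ccontr)
  assume "\<not> thesis"
  then have "\<Lambda> \<notin> Xi_closure \<Sigma> W (translate (half \<nu> H S_minus) w)"
    "\<Lambda> \<notin> Xi_closure \<Sigma> W (translate (half \<nu> H S_plus) w)" using that by blast+
  then obtain K1 K2 where K: "compact K1" "compact K2"
    "\<And>v. v \<in> translate (half \<nu> H S_minus) w \<Longrightarrow> v \<in> NS \<Sigma> W \<Longrightarrow> \<Lambda> \<inter> K1 \<noteq> model v \<inter> K1"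
    "\<And>v. v \<in> translate (half \<nu> H S_plus) w \<Longrightarrow> v \<in> NS \<Sigma> W \<Longrightarrow> \<Lambda> \<inter> K2 \<noteq> model v \<inter> K2"
    unfolding in_Xi_closure using assms(1) by blast
  have "bounded (K1 \<union> K2)" using K(1,2) compact_imp_bounded by auto
  then obtain R where R: "K1 \<union> K2 \<subseteq> ball 0 R" using bounded_subset_ballD by blast
  obtain v where v: "v \<in> NS \<Sigma> W" "\<Lambda> \<inter> ball 0 R = model v \<inter> ball 0 R"
    using Xi_param_approx[OF assms(1)] unfolding approx_def by (metis zero_less_one)
  then have "\<Lambda> \<inter> K1 = model v \<inter> K1" "\<Lambda> \<inter> K2 = model v \<inter> K2" using R by blast+
  then have n: "v - w \<notin> half \<nu> H S_minus" "v - w \<notin> half \<nu> H S_plus"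
    using K(3,4) v(1) mem_translate by blast+
  have "v - w \<notin> half \<nu> H S_zero" using NS_off_cuts[OF assms(2) v(1)] by simp
  then show False using half_cases[OF cuts_hyperplane[OF assms(2)], of "v - w"] n by blast
qed

text \<open>If \<Lambda> were on both sides, openness of the minus closure would put some
  \<open>model v\<close> with \<open>v\<close> strictly on the plus side into it. Continuity of the
  parameter at \<open>model v\<close> keeps nearby model sets on the plus side.\<close>

lemma cut_disjoint:
  assumes "H \<in> cuts \<Sigma> W w"
  shows "Xi_closure \<Sigma> W (translate (half \<nu> H S_minus) w) \<inter> Xi_closure \<Sigma> W (translate (half \<nu> H S_plus) w) = {}"
proof (rule equals0I)
  fix \<Lambda> assume "\<Lambda> \<in> Xi_closure \<Sigma> W (translate (half \<nu> H S_minus) w) \<inter> Xi_closure \<Sigma> W (translate (half \<nu> H S_plus) w)"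
  then have L: "\<Lambda> \<in> Xi_closure \<Sigma> W (translate (half \<nu> H S_minus) w)" "\<Lambda> \<in> Xi_closure \<Sigma> W (translate (half \<nu> H S_plus) w)"
    by auto
  obtain K where K: "compact K"
    "{\<Lambda>' \<in> Xi \<Sigma> W. \<Lambda> \<inter> K = \<Lambda>' \<inter> K} \<subseteq> Xi_closure \<Sigma> W (translate (half \<nu> H S_minus) w)"
    using cut_open[OF assms, of S_minus] L(1) unfolding openin_Xi_topology Xi_nbhds_def by auto
  obtain v where v: "v \<in> translate (half \<nu> H S_plus) w" "v \<in> NS \<Sigma> W" "\<Lambda> \<inter> K = model v \<inter> K"
    using L(2) K(1) unfolding in_Xi_closure by blast
  then have mv: "model v \<in> Xi_closure \<Sigma> W (translate (half \<nu> H S_minus) w)"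
    using subsetD[OF K(2), of "model v"] model_Xi by simp
  obtain e where e: "e > 0" "ball v e \<subseteq> translate (half \<nu> H S_plus) w"
    using open_translate_half[of S_plus H w] v(1) open_contains_ball by blast
  obtain F where F: "finite F" "\<And>w L. sandwich w L \<Longrightarrow> model v \<inter> F = L \<inter> F \<Longrightarrow> norm (w - v) < e"
    using Xi_param_continuous[OF model_Xi[OF v(2)] e(1)] Xi_param_model[OF v(2)] by metis
  obtain u where u: "u \<in> translate (half \<nu> H S_minus) w" "model v \<inter> F = model u \<inter> F"
    using mv finite_imp_compact[OF F(1)] unfolding in_Xi_closure by blast
  have "u \<in> ball v e" using F(2)[OF sandwich_model u(2)] by (simp add: dist_norm norm_minus_commute)
  then show False using e(2) u(1) half_disjoint[of H] by (auto simp: mem_translate)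
qed

lemma Xi_cut_type_eq:
  assumes "H \<in> cuts \<Sigma> W (Xi_param \<Sigma> W \<Lambda>)" "s \<in> {S_minus, S_plus}"
    "\<Lambda> \<in> Xi_closure \<Sigma> W (translate (half \<nu> H s) (Xi_param \<Sigma> W \<Lambda>))"
  shows "Xi_cut_type \<Sigma> W \<nu> \<Lambda> H = s"
proof -
  have "(THE s. s \<in> {S_minus, S_plus} \<and>
             \<Lambda> \<in> Xi_closure \<Sigma> W (translate (half \<nu> H s) (Xi_param \<Sigma> W \<Lambda>))) = s"
  proof (rule the_equality)
    fix s'
    assume "s' \<in> {S_minus, S_plus} \<and> \<Lambda> \<in> Xi_closure \<Sigma> W (translate (half \<nu> H s') (Xi_param \<Sigma> W \<Lambda>))"
    then show "s' = s" using assms(2,3) cut_disjoint[OF assms(1)] by blast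
  qed (use assms(2,3) in blast)
  then show ?thesis unfolding Xi_cut_type_def using assms(1) by simp
qed

lemma Xi_cut_type_cases:
  assumes "\<Lambda> \<in> Xi \<Sigma> W" "H \<in> cuts \<Sigma> W (Xi_param \<Sigma> W \<Lambda>)"
  obtains s where "s \<in> {S_minus, S_plus}" "\<Lambda> \<in> Xi_closure \<Sigma> W (translate (half \<nu> H s) (Xi_param \<Sigma> W \<Lambda>))"
    "Xi_cut_type \<Sigma> W \<nu> \<Lambda> H = s"
  using cut_exhaustive[OF assms] Xi_cut_type_eq[OF assms(2)] by metis

lemma Xi_cut_type_translate:
  assumes "\<Lambda> \<in> Xi \<Sigma> W" "\<gamma> \<in> Gam \<Sigma>"
  shows "Xi_cut_type \<Sigma> W \<nu> (translate \<Lambda> \<gamma>) H = Xi_cut_type \<Sigma> W \<nu> \<Lambda> H"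
proof (cases "H \<in> cuts \<Sigma> W (Xi_param \<Sigma> W \<Lambda>)")
  case True
  obtain s where s: "s \<in> {S_minus, S_plus}" "\<Lambda> \<in> Xi_closure \<Sigma> W (translate (half \<nu> H s) (Xi_param \<Sigma> W \<Lambda>))"
    "Xi_cut_type \<Sigma> W \<nu> \<Lambda> H = s" using Xi_cut_type_cases[OF assms(1) True] by blast
  have "translate \<Lambda> \<gamma> \<in> Xi_closure \<Sigma> W (translate (half \<nu> H s) (Xi_param \<Sigma> W (translate \<Lambda> \<gamma>)))"
    using Xi_closure_translate[OF s(2) assms(2)] by (simp add: Xi_param_translate[OF assms])
  moreover have "H \<in> cuts \<Sigma> W (Xi_param \<Sigma> W (translate \<Lambda> \<gamma>))"
    using cuts_shift[OF True assms(2)] by (simp add: Xi_param_translate[OF assms])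
  ultimately show ?thesis using Xi_cut_type_eq[OF _ s(1)] s(3) by simp
next
  case False
  then have "H \<notin> cuts \<Sigma> W (Xi_param \<Sigma> W (translate \<Lambda> \<gamma>))"
    using cuts_shift_iff[OF assms(2)] by (simp add: Xi_param_translate[OF assms])
  then show ?thesis unfolding Xi_cut_type_def using False by simp
qed

lemma Xi_with_cut_type:
  assumes "H \<in> hyperplanes W" "s \<in> {S_minus, S_plus}"
  obtains \<Lambda> where "\<Lambda> \<in> Xi_closure \<Sigma> W (translate (half \<nu> H s) w)" "Xi_param \<Sigma> W \<Lambda> = w"
proof -
  \<comment> \<open>The sign of \<open>s\<close>; the sequence below runs into \<open>w\<close>
    along the normal from that side.\<close>
  define \<sigma> :: real where "\<sigma> = (if s = S_plus then 1 else - 1)"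
  have "w \<in> closure (translate (half \<nu> H s) w)"
    unfolding closure_sequential
  proof (intro exI conjI allI)
    show "w + (\<sigma> * inverse (real (Suc k))) *\<^sub>R \<nu> H \<in> translate (half \<nu> H s) w" for k
      using assms(2) hyperplane_orientation(1)[OF assms(1)]
      by (auto simp: mem_translate \<sigma>_def mult_pos_pos mult_neg_pos)
    have "(\<lambda>k. w + (\<sigma> * inverse (real (Suc k))) *\<^sub>R \<nu> H) \<longlonglongrightarrow> w + (\<sigma> * 0) *\<^sub>R \<nu> H"
      by (intro tendsto_intros LIMSEQ_inverse_real_of_nat)
    then show "(\<lambda>k. w + (\<sigma> * inverse (real (Suc k))) *\<^sub>R \<nu> H) \<longlonglongrightarrow> w" by simp
  qed
  then show ?thesis using Xi_closure_exists[OF open_translate_half[OF assms(2)]] that by blast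
qed

end

section \<open>The Ellis semigroup of the internal system\<close>

lemma product_closure_of_obtain:
  assumes "f \<in> product_topology (\<lambda>_. X) I closure_of T" "finite S" "S \<subseteq> I"
    and "\<And>i. i \<in> S \<Longrightarrow> openin X (U i)" "\<And>i. i \<in> S \<Longrightarrow> f i \<in> U i"
  obtains y where "y \<in> T" "\<And>i. i \<in> S \<Longrightarrow> y i \<in> U i"
proof -
  define V where "V i = (if i \<in> S then U i else topspace X)" for i
  have "{i \<in> I. V i \<noteq> topspace X} \<subseteq> S" unfolding V_def by auto
  then have "finite {i \<in> I. V i \<noteq> topspace X}" using assms(2) finite_subset by blast
  then have "openin (product_topology (\<lambda>_. X) I) (Pi\<^sub>E I V)"
    unfolding openin_PiE_gen using assms(4) by (auto simp: V_def)
  moreover have "f \<in> Pi\<^sub>E I (\<lambda>_. topspace X)"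
    using assms(1) unfolding in_closure_of by (simp add: PiE_iff)
  then have "f \<in> Pi\<^sub>E I V" using assms(5) unfolding PiE_iff V_def by simp
  ultimately obtain y where "y \<in> T" "y \<in> Pi\<^sub>E I V" using assms(1) unfolding in_closure_of by blast
  moreover from this have "y i \<in> U i" if "i \<in> S" for i
    using that assms(3) unfolding PiE_iff V_def by (metis subsetD)
  ultimately show ?thesis using that by blast
qed

lemma in_product_closure_ofI:
  assumes f: "f \<in> Pi\<^sub>E I (\<lambda>_. topspace X)" and T: "T \<subseteq> Pi\<^sub>E I (\<lambda>_. topspace X)"
    and "\<And>S U. finite S \<Longrightarrow> S \<subseteq> I \<Longrightarrow> (\<And>i. i \<in> S \<Longrightarrow> openin X (U i) \<and> f i \<in> U i) \<Longrightarrow>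
      \<exists>y\<in>T. \<forall>i\<in>S. y i \<in> U i"
  shows "f \<in> product_topology (\<lambda>_. X) I closure_of T"
  unfolding in_closure_of
proof (intro conjI allI impI)
  show "f \<in> topspace (product_topology (\<lambda>_. X) I)" using f by (simp add: PiE_iff)
  fix V assume V: "f \<in> V \<and> openin (product_topology (\<lambda>_. X) I) V"
  have "\<exists>U. finite {i \<in> I. U i \<noteq> topspace X} \<and> (\<forall>i\<in>I. openin X (U i)) \<and> f \<in> Pi\<^sub>E I U \<and> Pi\<^sub>E I U \<subseteq> V"
    using bspec[OF V[THEN conjunct2, unfolded openin_product_topology_alt] V[THEN conjunct1]] .
  then obtain U where U: "finite {i \<in> I. U i \<noteq> topspace X}" "\<And>i. i \<in> I \<Longrightarrow> openin X (U i)"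
    "f \<in> Pi\<^sub>E I U" "Pi\<^sub>E I U \<subseteq> V" by blast
  have "\<exists>y\<in>T. \<forall>i\<in>{i \<in> I. U i \<noteq> topspace X}. y i \<in> U i"
    by (rule assms(3)[OF U(1)]) (use U(2) PiE_mem[OF U(3)] in auto)
  then obtain y where y: "y \<in> T" "\<And>i. i \<in> I \<Longrightarrow> U i \<noteq> topspace X \<Longrightarrow> y i \<in> U i" by blast
  have "y \<in> Pi\<^sub>E I (\<lambda>_. topspace X)" using y(1) T by blast
  then have "y \<in> Pi\<^sub>E I U" using y(2) unfolding PiE_iff by metis
  then show "\<exists>y. y \<in> T \<and> y \<in> V" using y(1) U(4) by blast
qed

context cut_project_window begin

lemma translation_PiE:
  "\<gamma> \<in> Gam \<Sigma> \<Longrightarrow> restrict (\<lambda>\<Lambda>. translate \<Lambda> \<gamma>) (Xi \<Sigma> W) \<in> Pi\<^sub>E (Xi \<Sigma> W) (\<lambda>_. Xi \<Sigma> W)"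
  using translate_Xi by auto

lemma in_Xi_product_closure:
  assumes "G \<subseteq> Gam \<Sigma>"
  shows "h \<in> product_topology (\<lambda>_. Xi_topology \<Sigma> W) (Xi \<Sigma> W) closure_of
      ((\<lambda>\<gamma>. restrict (\<lambda>\<Lambda>. translate \<Lambda> \<gamma>) (Xi \<Sigma> W)) ` G) \<longleftrightarrow>
    h \<in> Pi\<^sub>E (Xi \<Sigma> W) (\<lambda>_. Xi \<Sigma> W) \<and>
    (\<forall>S K. finite S \<longrightarrow> S \<subseteq> Xi \<Sigma> W \<longrightarrow> compact K \<longrightarrow> (\<exists>\<gamma>\<in>G. \<forall>\<Lambda>\<in>S. h \<Lambda> \<inter> K = translate \<Lambda> \<gamma> \<inter> K))"
    (is "h \<in> ?C \<longleftrightarrow> ?R")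
proof
  assume h: "h \<in> ?C"
  then have hX: "h \<in> Pi\<^sub>E (Xi \<Sigma> W) (\<lambda>_. Xi \<Sigma> W)"
    unfolding in_closure_of by (simp add: PiE_iff topspace_Xi_topology)
  moreover have "\<exists>\<gamma>\<in>G. \<forall>\<Lambda>\<in>S. h \<Lambda> \<inter> K = translate \<Lambda> \<gamma> \<inter> K"
    if S: "finite S" "S \<subseteq> Xi \<Sigma> W" and K: "compact K" for S K
  proof -
    define U where "U \<Lambda> = {\<Lambda>' \<in> Xi \<Sigma> W. h \<Lambda> \<inter> K = \<Lambda>' \<inter> K}" for \<Lambda>
    have "openin (Xi_topology \<Sigma> W) (U \<Lambda>)" for \<Lambda>
      unfolding openin_Xi_topology Xi_nbhds_def U_def using K by blast
    moreover have "h \<Lambda> \<in> U \<Lambda>" if "\<Lambda> \<in> S" for \<Lambda>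
      unfolding U_def using PiE_mem[OF hX] S(2) that by blast
    ultimately obtain y where y: "y \<in> (\<lambda>\<gamma>. restrict (\<lambda>\<Lambda>. translate \<Lambda> \<gamma>) (Xi \<Sigma> W)) ` G" "\<And>\<Lambda>. \<Lambda> \<in> S \<Longrightarrow> y \<Lambda> \<in> U \<Lambda>"
      using product_closure_of_obtain[OF h S, of U] by blast
    obtain \<gamma> where \<gamma>: "\<gamma> \<in> G" "y = restrict (\<lambda>\<Lambda>. translate \<Lambda> \<gamma>) (Xi \<Sigma> W)" using y(1) by blast
    have "h \<Lambda> \<inter> K = translate \<Lambda> \<gamma> \<inter> K" if "\<Lambda> \<in> S" for \<Lambda>
      using y(2)[OF that] subsetD[OF S(2) that] unfolding U_def \<gamma>(2) by simp
    then show ?thesis using \<gamma>(1) by blast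
  qed
  ultimately show ?R by blast
next
  assume R: ?R
  show "h \<in> ?C"
  proof (rule in_product_closure_ofI)
    show "h \<in> Pi\<^sub>E (Xi \<Sigma> W) (\<lambda>_. topspace (Xi_topology \<Sigma> W))" using R by (simp add: topspace_Xi_topology)
    show "(\<lambda>\<gamma>. restrict (\<lambda>\<Lambda>. translate \<Lambda> \<gamma>) (Xi \<Sigma> W)) ` G \<subseteq> Pi\<^sub>E (Xi \<Sigma> W) (\<lambda>_. topspace (Xi_topology \<Sigma> W))"
      unfolding topspace_Xi_topology using translation_PiE assms by blast
    fix S U
    assume S: "finite S" "S \<subseteq> Xi \<Sigma> W"
      and U: "\<And>\<Lambda>. \<Lambda> \<in> S \<Longrightarrow> openin (Xi_topology \<Sigma> W) (U \<Lambda>) \<and> h \<Lambda> \<in> U \<Lambda>"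
    have "\<forall>\<Lambda>\<in>S. \<exists>K. compact K \<and> {\<Lambda>' \<in> Xi \<Sigma> W. h \<Lambda> \<inter> K = \<Lambda>' \<inter> K} \<subseteq> U \<Lambda>"
    proof
      fix \<Lambda> assume "\<Lambda> \<in> S"
      then have "\<exists>B\<in>Xi_nbhds \<Sigma> W (h \<Lambda>). B \<subseteq> U \<Lambda>" using U unfolding openin_Xi_topology by blast
      then show "\<exists>K. compact K \<and> {\<Lambda>' \<in> Xi \<Sigma> W. h \<Lambda> \<inter> K = \<Lambda>' \<inter> K} \<subseteq> U \<Lambda>"
        unfolding Xi_nbhds_def by blast
    qed
    from bchoice[OF this] obtain K where "\<forall>\<Lambda>\<in>S. compact (K \<Lambda>) \<and> {\<Lambda>' \<in> Xi \<Sigma> W. h \<Lambda> \<inter> K \<Lambda> = \<Lambda>' \<inter> K \<Lambda>} \<subseteq> U \<Lambda>" ..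
    then have K: "\<And>\<Lambda>. \<Lambda> \<in> S \<Longrightarrow> compact (K \<Lambda>)"
      "\<And>\<Lambda>. \<Lambda> \<in> S \<Longrightarrow> {\<Lambda>' \<in> Xi \<Sigma> W. h \<Lambda> \<inter> K \<Lambda> = \<Lambda>' \<inter> K \<Lambda>} \<subseteq> U \<Lambda>" by blast+
    \<comment> \<open>One compact set serves all coordinates in \<open>S\<close>, because a basic
      neighbourhood restricts only finitely many.\<close>
    have "compact (\<Union>\<Lambda>\<in>S. K \<Lambda>)" using S(1) K(1) by (rule compact_UN)
    then obtain \<gamma> where \<gamma>: "\<gamma> \<in> G" "\<And>\<Lambda>. \<Lambda> \<in> S \<Longrightarrow> h \<Lambda> \<inter> (\<Union>\<Lambda>\<in>S. K \<Lambda>) = translate \<Lambda> \<gamma> \<inter> (\<Union>\<Lambda>\<in>S. K \<Lambda>)"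
      using R S by meson
    have "translate \<Lambda> \<gamma> \<in> U \<Lambda>" if L: "\<Lambda> \<in> S" for \<Lambda>
    proof -
      have "h \<Lambda> \<inter> K \<Lambda> = translate \<Lambda> \<gamma> \<inter> K \<Lambda>" using \<gamma>(2)[OF L] L by blast
      moreover have "translate \<Lambda> \<gamma> \<in> Xi \<Sigma> W" using translate_Xi L S(2) \<gamma>(1) assms by blast
      ultimately show ?thesis using K(2)[OF L] by blast
    qed
    then show "\<exists>y\<in>(\<lambda>\<gamma>. restrict (\<lambda>\<Lambda>. translate \<Lambda> \<gamma>) (Xi \<Sigma> W)) ` G. \<forall>\<Lambda>\<in>S. y \<Lambda> \<in> U \<Lambda>"
      using \<gamma>(1) S(2) by (intro bexI[OF _ imageI[OF \<gamma>(1)]]) auto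
  qed
qed

lemma in_Xi_ellis: "h \<in> Xi_ellis \<Sigma> W \<longleftrightarrow>
    h \<in> Pi\<^sub>E (Xi \<Sigma> W) (\<lambda>_. Xi \<Sigma> W) \<and>
    (\<forall>S K. finite S \<longrightarrow> S \<subseteq> Xi \<Sigma> W \<longrightarrow> compact K \<longrightarrow> (\<exists>\<gamma>\<in>Gam \<Sigma>. \<forall>\<Lambda>\<in>S. h \<Lambda> \<inter> K = translate \<Lambda> \<gamma> \<inter> K))"
  unfolding Xi_ellis_def ellis_semigroup_def topspace_Xi_topology by (rule in_Xi_product_closure) simp

lemma in_ellis_closure: "h \<in> ellis_closure \<Sigma> W A \<longleftrightarrow>
    h \<in> Pi\<^sub>E (Xi \<Sigma> W) (\<lambda>_. Xi \<Sigma> W) \<and>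
    (\<forall>S K. finite S \<longrightarrow> S \<subseteq> Xi \<Sigma> W \<longrightarrow> compact K \<longrightarrow>
      (\<exists>\<gamma>\<in>{\<gamma> \<in> Gam \<Sigma>. star \<Sigma> \<gamma> \<in> A}. \<forall>\<Lambda>\<in>S. h \<Lambda> \<inter> K = translate \<Lambda> \<gamma> \<inter> K))"
proof -
  let ?P = "product_topology (\<lambda>_. Xi_topology \<Sigma> W) (Xi \<Sigma> W)"
  let ?tr = "\<lambda>\<gamma>. restrict (\<lambda>\<Lambda>. translate \<Lambda> \<gamma>) (Xi \<Sigma> W)"
  let ?G = "{\<gamma> \<in> Gam \<Sigma>. star \<Sigma> \<gamma> \<in> A}"
  have "?tr ` Gam \<Sigma> \<subseteq> topspace ?P"
    unfolding topspace_product_topology o_def topspace_Xi_topology using translation_PiE by blast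
  then have "?tr ` Gam \<Sigma> \<subseteq> ?P closure_of (?tr ` Gam \<Sigma>)" by (rule closure_of_subset)
  \<comment> \<open>The closure is taken inside the Ellis semigroup. As the generating translations
    lie in the semigroup and it contains their closure in the product, nothing changes when the
    ambient space is the product.\<close>
  then have 1: "?P closure_of (?tr ` Gam \<Sigma>) \<inter> ?tr ` ?G = ?tr ` ?G" by blast
  have 2: "?P closure_of (?tr ` ?G) \<subseteq> ?P closure_of (?tr ` Gam \<Sigma>)"
    by (rule closure_of_mono) blast
  have "ellis_closure \<Sigma> W A = ?P closure_of (?tr ` ?G)"
    unfolding ellis_closure_def ellis_topology_def ellis_semigroup_def topspace_Xi_topology closure_of_subtopology 1
    using 2 by blast
  moreover have "?G \<subseteq> Gam \<Sigma>" by blast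
  ultimately show ?thesis using in_Xi_product_closure[of ?G h] by (simp only:)
qed

lemma ellis_closure_obtain:
  assumes "h \<in> ellis_closure \<Sigma> W A" "finite S" "S \<subseteq> Xi \<Sigma> W" "compact K"
  obtains \<gamma> where "\<gamma> \<in> Gam \<Sigma>" "star \<Sigma> \<gamma> \<in> A" "\<And>\<Lambda>. \<Lambda> \<in> S \<Longrightarrow> h \<Lambda> \<inter> K = translate \<Lambda> \<gamma> \<inter> K"
proof -
  have "\<exists>\<gamma>\<in>{\<gamma> \<in> Gam \<Sigma>. star \<Sigma> \<gamma> \<in> A}. \<forall>\<Lambda>\<in>S. h \<Lambda> \<inter> K = translate \<Lambda> \<gamma> \<inter> K"
    using assms(1)[unfolded in_ellis_closure, THEN conjunct2, rule_format, OF assms(2-4)] .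
  then show ?thesis using that by blast
qed

lemma Xi_ellis_obtain:
  assumes "h \<in> Xi_ellis \<Sigma> W" "finite S" "S \<subseteq> Xi \<Sigma> W" "compact K"
  obtains \<gamma> where "\<gamma> \<in> Gam \<Sigma>" "\<And>\<Lambda>. \<Lambda> \<in> S \<Longrightarrow> h \<Lambda> \<inter> K = translate \<Lambda> \<gamma> \<inter> K"
proof -
  have "\<exists>\<gamma>\<in>Gam \<Sigma>. \<forall>\<Lambda>\<in>S. h \<Lambda> \<inter> K = translate \<Lambda> \<gamma> \<inter> K"
    using assms(1)[unfolded in_Xi_ellis, THEN conjunct2, rule_format, OF assms(2-4)] .
  then show ?thesis using that by blast
qed

lemma ellis_closure_subset: assumes "h \<in> ellis_closure \<Sigma> W A" shows "h \<in> Xi_ellis \<Sigma> W"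
  unfolding in_Xi_ellis
proof (intro conjI allI impI)
  show "h \<in> Pi\<^sub>E (Xi \<Sigma> W) (\<lambda>_. Xi \<Sigma> W)" using assms[unfolded in_ellis_closure] by (rule conjunct1)
  fix S and K :: "(real^'d) set" assume "finite S" "S \<subseteq> Xi \<Sigma> W" "compact K"
  from ellis_closure_obtain[OF assms this] obtain \<gamma>
    where "\<gamma> \<in> Gam \<Sigma>" "\<And>\<Lambda>. \<Lambda> \<in> S \<Longrightarrow> h \<Lambda> \<inter> K = translate \<Lambda> \<gamma> \<inter> K" by metis
  then show "\<exists>\<gamma>\<in>Gam \<Sigma>. \<forall>\<Lambda>\<in>S. h \<Lambda> \<inter> K = translate \<Lambda> \<gamma> \<inter> K" by (intro bexI ballI)
qed

lemma Xi_ellis_Xi: "h \<in> Xi_ellis \<Sigma> W \<Longrightarrow> \<Lambda> \<in> Xi \<Sigma> W \<Longrightarrow> h \<Lambda> \<in> Xi \<Sigma> W"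
  using PiE_mem[OF in_Xi_ellis[THEN iffD1, THEN conjunct1]] .

text \<open>Membership of a single point \<open>x\<close> is decided by one \<gamma> imitating
  \<open>h\<close> at both \<Lambda> and its translate on \<open>{x, x - \<delta>}\<close>, and
  translations commute.\<close>

lemma Xi_ellis_translate:
  assumes "h \<in> Xi_ellis \<Sigma> W" "\<Lambda> \<in> Xi \<Sigma> W" "\<delta> \<in> Gam \<Sigma>"
  shows "h (translate \<Lambda> \<delta>) = translate (h \<Lambda>) \<delta>"
proof -
  have "x \<in> h (translate \<Lambda> \<delta>) \<longleftrightarrow> x \<in> translate (h \<Lambda>) \<delta>" for x
  proof -
    have "finite {\<Lambda>, translate \<Lambda> \<delta>}" "{\<Lambda>, translate \<Lambda> \<delta>} \<subseteq> Xi \<Sigma> W" "compact {x, x - \<delta>}"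
      using assms translate_Xi by auto
    from Xi_ellis_obtain[OF assms(1) this] obtain \<gamma>
      where "\<And>L. L \<in> {\<Lambda>, translate \<Lambda> \<delta>} \<Longrightarrow> h L \<inter> {x, x - \<delta>} = translate L \<gamma> \<inter> {x, x - \<delta>}" by metis
    from this[of \<Lambda>] this[of "translate \<Lambda> \<delta>"] have "x - \<delta> \<in> h \<Lambda> \<longleftrightarrow> x - \<delta> \<in> translate \<Lambda> \<gamma>"
      "x \<in> h (translate \<Lambda> \<delta>) \<longleftrightarrow> x \<in> translate (translate \<Lambda> \<delta>) \<gamma>" by blast+
    then show ?thesis by (simp add: mem_translate algebra_simps)
  qed
  then show ?thesis by blast
qed

lemma Xi_exists: obtains \<Lambda> where "\<Lambda> \<in> Xi \<Sigma> W"
  using NS_dense[OF open_UNIV] model_Xi by blast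

text \<open>One \<gamma> imitates \<open>h\<close> at both points, so both displacements of the
  parameter are close to the same \<open>star \<Sigma> \<gamma>\<close>; errors below
  \<open>norm D / 2\<close> contradict a discrepancy \<open>D\<close>.\<close>

lemma Xi_ellis_param_difference:
  assumes "h \<in> Xi_ellis \<Sigma> W" "\<Lambda> \<in> Xi \<Sigma> W" "\<Lambda>' \<in> Xi \<Sigma> W"
  shows "Xi_param \<Sigma> W (h \<Lambda>) - Xi_param \<Sigma> W \<Lambda> = Xi_param \<Sigma> W (h \<Lambda>') - Xi_param \<Sigma> W \<Lambda>'"
proof (rule ccontr)
  let ?p = "Xi_param \<Sigma> W"
  define D where "D = (?p (h \<Lambda>) - ?p \<Lambda>) - (?p (h \<Lambda>') - ?p \<Lambda>')"
  assume "\<not> ?thesis"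
  then have e: "norm D / 2 > 0" unfolding D_def by simp
  obtain F where F: "finite F" "\<And>w L. sandwich w L \<Longrightarrow> h \<Lambda> \<inter> F = L \<inter> F \<Longrightarrow> norm (w - ?p (h \<Lambda>)) < norm D / 2"
    using Xi_param_continuous[OF Xi_ellis_Xi[OF assms(1,2)] e] by metis
  obtain F' where F': "finite F'" "\<And>w L. sandwich w L \<Longrightarrow> h \<Lambda>' \<inter> F' = L \<inter> F' \<Longrightarrow> norm (w - ?p (h \<Lambda>')) < norm D / 2"
    using Xi_param_continuous[OF Xi_ellis_Xi[OF assms(1,3)] e] by metis
  have "finite {\<Lambda>, \<Lambda>'}" "{\<Lambda>, \<Lambda>'} \<subseteq> Xi \<Sigma> W" "compact (F \<union> F')"
    using assms F(1) F'(1) finite_imp_compact by auto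
  from Xi_ellis_obtain[OF assms(1) this] obtain \<gamma> where \<gamma>: "\<gamma> \<in> Gam \<Sigma>"
    "h \<Lambda> \<inter> (F \<union> F') = translate \<Lambda> \<gamma> \<inter> (F \<union> F')" "h \<Lambda>' \<inter> (F \<union> F') = translate \<Lambda>' \<gamma> \<inter> (F \<union> F')"
    by (metis insertCI)
  have "norm (?p \<Lambda> + star \<Sigma> \<gamma> - ?p (h \<Lambda>)) < norm D / 2"
    by (rule F(2)[OF translate_sandwich[OF Xi_param_sandwich[OF assms(2)] \<gamma>(1)]]) (use \<gamma>(2) in blast)
  moreover have "norm (?p \<Lambda>' + star \<Sigma> \<gamma> - ?p (h \<Lambda>')) < norm D / 2"
    by (rule F'(2)[OF translate_sandwich[OF Xi_param_sandwich[OF assms(3)] \<gamma>(1)]]) (use \<gamma>(3) in blast)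
  moreover have "D = (?p \<Lambda>' + star \<Sigma> \<gamma> - ?p (h \<Lambda>')) - (?p \<Lambda> + star \<Sigma> \<gamma> - ?p (h \<Lambda>))"
    unfolding D_def by simp
  then have "norm D \<le> norm (?p \<Lambda>' + star \<Sigma> \<gamma> - ?p (h \<Lambda>')) + norm (?p \<Lambda> + star \<Sigma> \<gamma> - ?p (h \<Lambda>))"
    by (metis norm_triangle_ineq4)
  ultimately show False by simp
qed

lemma Xi_ellis_param_eqI:
  assumes "\<And>\<Lambda>. \<Lambda> \<in> Xi \<Sigma> W \<Longrightarrow> Xi_param \<Sigma> W (h \<Lambda>) = Xi_param \<Sigma> W \<Lambda> + w"
  shows "Xi_ellis_param \<Sigma> W h = w"
  unfolding Xi_ellis_param_def
proof (rule the_equality)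
  fix w' assume "\<forall>\<Lambda>\<in>Xi \<Sigma> W. Xi_param \<Sigma> W (h \<Lambda>) = Xi_param \<Sigma> W \<Lambda> + w'"
  then show "w' = w" using assms Xi_exists by (metis add_left_cancel)
qed (use assms in blast)

lemma Xi_param_ellis:
  assumes "h \<in> Xi_ellis \<Sigma> W" "\<Lambda> \<in> Xi \<Sigma> W"
  shows "Xi_param \<Sigma> W (h \<Lambda>) = Xi_param \<Sigma> W \<Lambda> + Xi_ellis_param \<Sigma> W h"
proof -
  have "Xi_ellis_param \<Sigma> W h = Xi_param \<Sigma> W (h \<Lambda>) - Xi_param \<Sigma> W \<Lambda>"
  proof (rule Xi_ellis_param_eqI)
    fix L assume "L \<in> Xi \<Sigma> W"
    then show "Xi_param \<Sigma> W (h L) = Xi_param \<Sigma> W L + (Xi_param \<Sigma> W (h \<Lambda>) - Xi_param \<Sigma> W \<Lambda>)"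
      using Xi_ellis_param_difference[OF assms, of L] by (simp add: algebra_simps)
  qed
  then show ?thesis by simp
qed

lemma ellis_closure_translate:
  assumes "h \<in> ellis_closure \<Sigma> W A" "\<delta> \<in> Gam \<Sigma>"
  shows "(\<lambda>\<Lambda>\<in>Xi \<Sigma> W. translate (h \<Lambda>) \<delta>) \<in> ellis_closure \<Sigma> W (translate A (star \<Sigma> \<delta>))"
  unfolding in_ellis_closure
proof (intro conjI allI impI)
  have hX: "h \<Lambda> \<in> Xi \<Sigma> W" if "\<Lambda> \<in> Xi \<Sigma> W" for \<Lambda>
    using that Xi_ellis_Xi ellis_closure_subset[OF assms(1)] by blast
  then show "(\<lambda>\<Lambda>\<in>Xi \<Sigma> W. translate (h \<Lambda>) \<delta>) \<in> Pi\<^sub>E (Xi \<Sigma> W) (\<lambda>_. Xi \<Sigma> W)"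
    using translate_Xi assms(2) by auto
  fix S and K :: "(real^'d) set" assume S: "finite S" "S \<subseteq> Xi \<Sigma> W" "compact K"
  obtain \<gamma> where \<gamma>: "\<gamma> \<in> Gam \<Sigma>" "star \<Sigma> \<gamma> \<in> A"
    "\<And>\<Lambda>. \<Lambda> \<in> S \<Longrightarrow> h \<Lambda> \<inter> translate K (- \<delta>) = translate \<Lambda> \<gamma> \<inter> translate K (- \<delta>)"
    using ellis_closure_obtain[OF assms(1) S(1,2) compact_translate[OF S(3)]] by metis
  have "(\<lambda>\<Lambda>\<in>Xi \<Sigma> W. translate (h \<Lambda>) \<delta>) \<Lambda> \<inter> K = translate \<Lambda> (\<gamma> + \<delta>) \<inter> K" if "\<Lambda> \<in> S" for \<Lambda>
    using translate_Int_eq[OF \<gamma>(3)[OF that]] subsetD[OF S(2) that] by simp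
  moreover have "\<gamma> + \<delta> \<in> Gam \<Sigma>" "star \<Sigma> (\<gamma> + \<delta>) \<in> translate A (star \<Sigma> \<delta>)"
    using \<gamma>(1,2) assms(2) star_add by (simp_all add: mem_translate)
  ultimately show "\<exists>\<gamma>\<in>{\<gamma> \<in> Gam \<Sigma>. star \<Sigma> \<gamma> \<in> translate A (star \<Sigma> \<delta>)}.
      \<forall>\<Lambda>\<in>S. (\<lambda>\<Lambda>\<in>Xi \<Sigma> W. translate (h \<Lambda>) \<delta>) \<Lambda> \<inter> K = translate \<Lambda> \<gamma> \<inter> K" by blast
qed

end

context almost_canonical_window begin

section \<open>Action of cone types on cut types\<close>

lemma ellis_cut_type_open:
  assumes "h \<in> ellis_closure \<Sigma> W (translate (half \<nu> H s) (Xi_ellis_param \<Sigma> W h))" "s \<in> {S_minus, S_plus}"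
    "\<Lambda> \<in> Xi \<Sigma> W" "H \<in> cuts \<Sigma> W (Xi_param \<Sigma> W (h \<Lambda>))"
  shows "Xi_cut_type \<Sigma> W \<nu> (h \<Lambda>) H = s"
proof -
  have h: "h \<in> Xi_ellis \<Sigma> W" using ellis_closure_subset assms(1) by blast
  have "h \<Lambda> \<in> Xi_closure \<Sigma> W (translate (half \<nu> H s) (Xi_param \<Sigma> W (h \<Lambda>)))"
  proof (rule Xi_closure_limit[OF Xi_ellis_Xi[OF h assms(3)]])
    fix K :: "(real^'d) set" assume K: "compact K"
    have "finite {\<Lambda>}" "{\<Lambda>} \<subseteq> Xi \<Sigma> W" using assms(3) by auto
    from ellis_closure_obtain[OF assms(1) this K]
    obtain \<gamma> where \<gamma>: "\<gamma> \<in> Gam \<Sigma>" "star \<Sigma> \<gamma> \<in> translate (half \<nu> H s) (Xi_ellis_param \<Sigma> W h)"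
      "h \<Lambda> \<inter> K = translate \<Lambda> \<gamma> \<inter> K" by (metis singletonI)
    have "Xi_param \<Sigma> W (translate \<Lambda> \<gamma>) \<in> translate (half \<nu> H s) (Xi_param \<Sigma> W (h \<Lambda>))"
      using \<gamma>(2) Xi_param_ellis[OF h assms(3)] Xi_param_translate[OF assms(3) \<gamma>(1)]
      unfolding mem_translate by simp
    then have "translate \<Lambda> \<gamma> \<in> Xi_closure \<Sigma> W (translate (half \<nu> H s) (Xi_param \<Sigma> W (h \<Lambda>)))"
      using open_param_Xi_closure[OF translate_Xi[OF assms(3) \<gamma>(1)] open_translate_half[OF assms(2)]] by blast
    then show "\<exists>L\<in>Xi_closure \<Sigma> W (translate (half \<nu> H s) (Xi_param \<Sigma> W (h \<Lambda>))). h \<Lambda> \<inter> K = L \<inter> K"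
      using \<gamma>(3) by blast
  qed
  then show ?thesis using Xi_cut_type_eq[OF assms(4,2)] by blast
qed

lemma ellis_cut_type_zero:
  assumes "h \<in> ellis_closure \<Sigma> W (translate (half \<nu> H S_zero) (Xi_ellis_param \<Sigma> W h))"
    "\<Lambda> \<in> Xi \<Sigma> W" "H \<in> cuts \<Sigma> W (Xi_param \<Sigma> W (h \<Lambda>))"
  shows "H \<in> cuts \<Sigma> W (Xi_param \<Sigma> W \<Lambda>)" "Xi_cut_type \<Sigma> W \<nu> (h \<Lambda>) H = Xi_cut_type \<Sigma> W \<nu> \<Lambda> H"
proof -
  have h: "h \<in> Xi_ellis \<Sigma> W" using ellis_closure_subset assms(1) by blast
  have Hh: "H \<in> hyperplanes W" using cuts_hyperplane assms(3) by blast
  have approxh: "\<exists>\<gamma>\<in>Gam \<Sigma>. star \<Sigma> \<gamma> - Xi_ellis_param \<Sigma> W h \<in> H \<and> h \<Lambda> \<inter> K = translate \<Lambda> \<gamma> \<inter> K"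
    if K: "compact K" for K
  proof -
    have "finite {\<Lambda>}" "{\<Lambda>} \<subseteq> Xi \<Sigma> W" using assms(2) by auto
    from ellis_closure_obtain[OF assms(1) this K]
    obtain \<gamma> where "\<gamma> \<in> Gam \<Sigma>" "star \<Sigma> \<gamma> \<in> translate (half \<nu> H S_zero) (Xi_ellis_param \<Sigma> W h)"
      "h \<Lambda> \<inter> K = translate \<Lambda> \<gamma> \<inter> K" by (metis singletonI)
    then show ?thesis unfolding mem_translate by auto
  qed
  have neg: "- x \<in> H" if "x \<in> H" for x
    using that hyperplane_orientation(2)[OF Hh] by (metis (mono_tags) inner_minus_right mem_Collect_eq neg_equal_0_iff_equal)
  \<comment> \<open>The empty compact set extracts just one \<gamma> with star image in
    \<open>w + H\<close>, \<open>w\<close> the parameter of \<open>h\<close>. Hence the parameters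
    of \<Lambda> and of \<open>h \<Lambda>\<close> differ by a star image up to a vector of
    \<open>H\<close>, and a cut at the latter is a cut at the former.\<close>
  obtain \<gamma> where \<gamma>: "\<gamma> \<in> Gam \<Sigma>" "star \<Sigma> \<gamma> - Xi_ellis_param \<Sigma> W h \<in> H" using approxh[OF compact_empty] by blast
  have "H \<in> cuts \<Sigma> W (Xi_param \<Sigma> W (h \<Lambda>) + (star \<Sigma> \<gamma> - Xi_ellis_param \<Sigma> W h))"
    by (rule cuts_add_hyperplane[OF assms(3) \<gamma>(2)])
  then have "H \<in> cuts \<Sigma> W (Xi_param \<Sigma> W \<Lambda> + star \<Sigma> \<gamma>)"
    using Xi_param_ellis[OF h assms(2)] by simp
  then show c: "H \<in> cuts \<Sigma> W (Xi_param \<Sigma> W \<Lambda>)" using cuts_shift_iff[OF \<gamma>(1)] by blast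
  obtain s where s: "s \<in> {S_minus, S_plus}" "\<Lambda> \<in> Xi_closure \<Sigma> W (translate (half \<nu> H s) (Xi_param \<Sigma> W \<Lambda>))"
    "Xi_cut_type \<Sigma> W \<nu> \<Lambda> H = s" using Xi_cut_type_cases[OF assms(2) c] by blast
  have "h \<Lambda> \<in> Xi_closure \<Sigma> W (translate (half \<nu> H s) (Xi_param \<Sigma> W (h \<Lambda>)))"
  proof (rule Xi_closure_limit[OF Xi_ellis_Xi[OF h assms(2)]])
    fix K :: "(real^'d) set" assume "compact K"
    then obtain \<delta> where \<delta>: "\<delta> \<in> Gam \<Sigma>" "star \<Sigma> \<delta> - Xi_ellis_param \<Sigma> W h \<in> H" "h \<Lambda> \<inter> K = translate \<Lambda> \<delta> \<inter> K"
      using approxh by blast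
    \<comment> \<open>The base points of the two half-spaces differ by a vector of \<open>H\<close>,
      which a half-space bounded by \<open>H\<close> does not notice.\<close>
    have "translate (translate (half \<nu> H s) (Xi_param \<Sigma> W \<Lambda>)) (star \<Sigma> \<delta>)
      = translate (half \<nu> H s) (Xi_param \<Sigma> W (h \<Lambda>))"
    proof -
      have "y - (Xi_param \<Sigma> W \<Lambda> + star \<Sigma> \<delta>) \<in> half \<nu> H s \<longleftrightarrow> y - Xi_param \<Sigma> W (h \<Lambda>) \<in> half \<nu> H s" for y
      proof -
        have "y - (Xi_param \<Sigma> W \<Lambda> + star \<Sigma> \<delta>) = y - Xi_param \<Sigma> W (h \<Lambda>) + - (star \<Sigma> \<delta> - Xi_ellis_param \<Sigma> W h)"
          using Xi_param_ellis[OF h assms(2)] by simp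
        then show ?thesis using half_add_hyperplane[OF Hh neg[OF \<delta>(2)] s(1)] by metis
      qed
      then show ?thesis by (simp add: set_eq_iff mem_translate)
    qed
    then have "translate \<Lambda> \<delta> \<in> Xi_closure \<Sigma> W (translate (half \<nu> H s) (Xi_param \<Sigma> W (h \<Lambda>)))"
      using Xi_closure_translate[OF s(2) \<delta>(1)] by metis
    then show "\<exists>L\<in>Xi_closure \<Sigma> W (translate (half \<nu> H s) (Xi_param \<Sigma> W (h \<Lambda>))). h \<Lambda> \<inter> K = L \<inter> K"
      using \<delta>(3) by blast
  qed
  then show "Xi_cut_type \<Sigma> W \<nu> (h \<Lambda>) H = Xi_cut_type \<Sigma> W \<nu> \<Lambda> H"
    using Xi_cut_type_eq[OF assms(3) s(1)] s(3) by simp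
qed

text \<open>The two half-spaces and the hyperplane through \<open>w\<close> cover the space, so
  every \<gamma> imitating \<open>h\<close> falls into one of three classes, and by pigeonhole one
  class suffices.\<close>

lemma cone_type_exists:
  assumes "h \<in> Xi_ellis \<Sigma> W" "H \<in> hyperplanes W"
  obtains s where "s \<in> {S_minus, S_zero, S_plus}" "h \<in> ellis_closure \<Sigma> W (translate (half \<nu> H s) w)"
proof (rule ccontr)
  note thesisI = that
  assume no: "\<not> thesis"
  have hP: "h \<in> Pi\<^sub>E (Xi \<Sigma> W) (\<lambda>_. Xi \<Sigma> W)" using assms(1)[unfolded in_Xi_ellis] by (rule conjunct1)
  define bad where "bad s S K \<longleftrightarrow> finite S \<and> S \<subseteq> Xi \<Sigma> W \<and> compact K \<and>
      \<not> (\<exists>\<gamma>\<in>{\<gamma> \<in> Gam \<Sigma>. star \<Sigma> \<gamma> \<in> translate (half \<nu> H s) w}. \<forall>\<Lambda>\<in>S. h \<Lambda> \<inter> K = translate \<Lambda> \<gamma> \<inter> K)" for s S K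
  have "\<exists>S K. bad s S K" if "s \<in> {S_minus, S_zero, S_plus}" for s
  proof (rule ccontr)
    assume "\<nexists>S K. bad s S K"
    then have "h \<in> ellis_closure \<Sigma> W (translate (half \<nu> H s) w)"
      unfolding in_ellis_closure bad_def not_ex de_Morgan_conj not_not imp_conv_disj[symmetric]
      by (intro conjI hP)
    then show False using no thesisI that by blast
  qed
  then obtain S K where "\<And>s. s \<in> {S_minus, S_zero, S_plus} \<Longrightarrow> bad s (S s) (K s)" by metis
  then have SK: "\<And>s. s \<in> {S_minus, S_zero, S_plus} \<Longrightarrow> finite (S s) \<and> S s \<subseteq> Xi \<Sigma> W \<and> compact (K s)"
    "\<And>s \<gamma>. s \<in> {S_minus, S_zero, S_plus} \<Longrightarrow> \<gamma> \<in> Gam \<Sigma> \<Longrightarrow> star \<Sigma> \<gamma> \<in> translate (half \<nu> H s) w \<Longrightarrow>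
      \<exists>\<Lambda>\<in>S s. h \<Lambda> \<inter> K s \<noteq> translate \<Lambda> \<gamma> \<inter> K s"
    unfolding bad_def by blast+
  let ?I = "{S_minus, S_zero, S_plus}"
  \<comment> \<open>Merging the three hypothetical counterexamples gives one test that no imitating
    \<gamma> could pass.\<close>
  define S' K' where "S' = (\<Union>s\<in>?I. S s)" and "K' = (\<Union>s\<in>?I. K s)"
  have S': "finite S'" "S' \<subseteq> Xi \<Sigma> W" "compact K'"
    unfolding S'_def K'_def using SK(1) by (auto intro!: compact_Un)
  obtain \<gamma> where \<gamma>: "\<gamma> \<in> Gam \<Sigma>" "\<And>\<Lambda>. \<Lambda> \<in> S' \<Longrightarrow> h \<Lambda> \<inter> K' = translate \<Lambda> \<gamma> \<inter> K'"
    using Xi_ellis_obtain[OF assms(1) S'] by metis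
  obtain s where s: "s \<in> ?I" "star \<Sigma> \<gamma> - w \<in> half \<nu> H s" using half_cases[OF assms(2)] by blast
  then obtain \<Lambda> where L: "\<Lambda> \<in> S s" "h \<Lambda> \<inter> K s \<noteq> translate \<Lambda> \<gamma> \<inter> K s"
    using SK(2)[OF s(1) \<gamma>(1)] mem_translate by blast
  have "K s \<subseteq> K'" "\<Lambda> \<in> S'" unfolding S'_def K'_def using s(1) L(1) by blast+
  then have "h \<Lambda> \<inter> K s = translate \<Lambda> \<gamma> \<inter> K s" using \<gamma>(2)[of \<Lambda>] by blast
  then show False using L(2) by simp
qed

text \<open>A cone type is recognized by its action on a point whose image has \<open>H\<close> as a cut and which
  has the opposite sign at \<open>H\<close>.\<close>

lemma cone_type_unique:
  assumes "H \<in> hyperplanes W" "s \<in> {S_minus, S_zero, S_plus}" "s' \<in> {S_minus, S_zero, S_plus}"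
    "h \<in> ellis_closure \<Sigma> W (translate (half \<nu> H s) (Xi_ellis_param \<Sigma> W h))"
    "h \<in> ellis_closure \<Sigma> W (translate (half \<nu> H s') (Xi_ellis_param \<Sigma> W h))"
  shows "s' = s"
proof -
  have h: "h \<in> Xi_ellis \<Sigma> W" using ellis_closure_subset assms(4) by blast
  obtain f where f: "f \<in> window_facets W" "facet_dir f = H" using assms(1) unfolding hyperplanes_def by blast
  obtain a where a: "a \<in> affine hull f" using facet_nonempty[OF f(1)] hull_inc by fastforce
  \<comment> \<open>The point \<open>a\<close> is on the affine span of a facet itself, so \<gamma>
    = 0 witnesses the cut.\<close>
  have c: "H \<in> cuts \<Sigma> W a" unfolding cuts_iff using f a by (intro bexI[OF _ f(1)] conjI bexI[of _ 0]) auto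
  have key: False if t: "t \<in> {S_minus, S_plus}" and t': "t' \<in> {S_minus, S_zero, S_plus}" "t' \<noteq> t"
    "h \<in> ellis_closure \<Sigma> W (translate (half \<nu> H t) (Xi_ellis_param \<Sigma> W h))"
    "h \<in> ellis_closure \<Sigma> W (translate (half \<nu> H t') (Xi_ellis_param \<Sigma> W h))" for t t'
  proof -
    \<comment> \<open>The test point carries the sign opposite to \<open>t\<close>, and its
      parameter is chosen so that \<open>h\<close> moves it to \<open>a\<close>. The type
      \<open>t\<close> turns the sign into \<open>t\<close>, the zero type would keep
      \<open>u\<close>, and the other sign would produce itself.\<close>
    obtain u where u: "u \<in> {S_minus, S_plus}" "u \<noteq> t" using t by auto
    obtain \<Lambda> where L: "\<Lambda> \<in> Xi_closure \<Sigma> W (translate (half \<nu> H u) (a - Xi_ellis_param \<Sigma> W h))"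
      "Xi_param \<Sigma> W \<Lambda> = a - Xi_ellis_param \<Sigma> W h"
      using Xi_with_cut_type[OF assms(1) u(1)] by blast
    have LX: "\<Lambda> \<in> Xi \<Sigma> W" using Xi_closure_Xi L(1) by blast
    have ca: "H \<in> cuts \<Sigma> W (Xi_param \<Sigma> W (h \<Lambda>))" using Xi_param_ellis[OF h LX] L(2) c by simp
    have 1: "Xi_cut_type \<Sigma> W \<nu> (h \<Lambda>) H = t" using ellis_cut_type_open[OF t'(3) t LX ca] .
    show False
    proof (cases "t' = S_zero")
      case True
      then have z: "h \<in> ellis_closure \<Sigma> W (translate (half \<nu> H S_zero) (Xi_ellis_param \<Sigma> W h))" using t'(4) by simp
      have "Xi_cut_type \<Sigma> W \<nu> \<Lambda> H = u"
        using Xi_cut_type_eq[OF ellis_cut_type_zero(1)[OF z LX ca] u(1)] L by simp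
      then show False using ellis_cut_type_zero(2)[OF z LX ca] 1 u(2) by simp
    next
      case False
      then have "t' \<in> {S_minus, S_plus}" using t'(1) by blast
      then show False using ellis_cut_type_open[OF t'(4) _ LX ca] 1 t'(2) by simp
    qed
  qed
  show ?thesis
  proof (rule ccontr)
    assume ne: "s' \<noteq> s"
    then consider "s \<in> {S_minus, S_plus}" | "s' \<in> {S_minus, S_plus}" using assms(2,3) by blast
    then show False
    proof cases
      case 1 show False using key[OF 1 assms(3) ne assms(4,5)] .
    next
      case 2 show False using key[OF 2 assms(2) ne[symmetric] assms(5,4)] .
    qed
  qed
qed

lemma Xi_cone_type_eq:
  assumes "H \<in> hyperplanes W" "s \<in> {S_minus, S_zero, S_plus}"
    "h \<in> ellis_closure \<Sigma> W (translate (half \<nu> H s) (Xi_ellis_param \<Sigma> W h))"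
  shows "Xi_cone_type \<Sigma> W \<nu> h H = s"
  unfolding Xi_cone_type_def
  by (rule the_equality) (use assms cone_type_unique in blast)+

lemma Xi_cone_type_cases:
  assumes "h \<in> Xi_ellis \<Sigma> W" "H \<in> hyperplanes W"
  obtains s where "s \<in> {S_minus, S_zero, S_plus}"
    "h \<in> ellis_closure \<Sigma> W (translate (half \<nu> H s) (Xi_ellis_param \<Sigma> W h))" "Xi_cone_type \<Sigma> W \<nu> h H = s"
  using cone_type_exists[OF assms] Xi_cone_type_eq[OF assms(2)] by metis

lemma Xi_cut_type_ellis:
  assumes "h \<in> Xi_ellis \<Sigma> W" "\<Lambda> \<in> Xi \<Sigma> W" "H \<in> cuts \<Sigma> W (Xi_param \<Sigma> W (h \<Lambda>))"
  shows "Xi_cut_type \<Sigma> W \<nu> (h \<Lambda>) H = symb_mult (Xi_cut_type \<Sigma> W \<nu> \<Lambda>) (Xi_cone_type \<Sigma> W \<nu> h) H"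
proof -
  obtain s where s: "s \<in> {S_minus, S_zero, S_plus}"
    "h \<in> ellis_closure \<Sigma> W (translate (half \<nu> H s) (Xi_ellis_param \<Sigma> W h))" "Xi_cone_type \<Sigma> W \<nu> h H = s"
    using Xi_cone_type_cases[OF assms(1) cuts_hyperplane[OF assms(3)]] by blast
  show ?thesis
  proof (cases "s = S_zero")
    case True
    then have "h \<in> ellis_closure \<Sigma> W (translate (half \<nu> H S_zero) (Xi_ellis_param \<Sigma> W h))" using s(2) by simp
    from ellis_cut_type_zero(2)[OF this assms(2,3)] show ?thesis unfolding symb_mult_def using s(3) True by simp
  next
    case False
    then have "s \<in> {S_minus, S_plus}" using s(1) by blast
    from ellis_cut_type_open[OF s(2) this assms(2,3)] show ?thesis unfolding symb_mult_def using s(3) False by simp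
  qed
qed

text \<open>Needed because the splitting of an element of the hull semigroup is unique only up to
  \<Gamma>.\<close>

lemma Xi_cone_type_translate:
  assumes "h \<in> Xi_ellis \<Sigma> W" "\<delta> \<in> Gam \<Sigma>" "H \<in> hyperplanes W"
  shows "Xi_cone_type \<Sigma> W \<nu> (\<lambda>\<Lambda>\<in>Xi \<Sigma> W. translate (h \<Lambda>) \<delta>) H = Xi_cone_type \<Sigma> W \<nu> h H"
proof -
  let ?h = "\<lambda>\<Lambda>\<in>Xi \<Sigma> W. translate (h \<Lambda>) \<delta>"
  obtain s where s: "s \<in> {S_minus, S_zero, S_plus}"
    "h \<in> ellis_closure \<Sigma> W (translate (half \<nu> H s) (Xi_ellis_param \<Sigma> W h))" "Xi_cone_type \<Sigma> W \<nu> h H = s"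
    using Xi_cone_type_cases[OF assms(1,3)] by blast
  have "Xi_ellis_param \<Sigma> W ?h = Xi_ellis_param \<Sigma> W h + star \<Sigma> \<delta>"
  proof (rule Xi_ellis_param_eqI)
    fix \<Lambda> assume L: "\<Lambda> \<in> Xi \<Sigma> W"
    then show "Xi_param \<Sigma> W (?h \<Lambda>) = Xi_param \<Sigma> W \<Lambda> + (Xi_ellis_param \<Sigma> W h + star \<Sigma> \<delta>)"
      using Xi_param_ellis[OF assms(1) L] Xi_param_translate[OF Xi_ellis_Xi[OF assms(1) L] assms(2)] by simp
  qed
  then have "?h \<in> ellis_closure \<Sigma> W (translate (half \<nu> H s) (Xi_ellis_param \<Sigma> W ?h))"
    using ellis_closure_translate[OF s(2) assms(2)] by simp
  then show ?thesis using Xi_cone_type_eq[OF assms(3) s(1)] s(3) by simp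
qed

end

section \<open>The Ellis semigroup of the hull\<close>

context cut_project_window begin

section \<open>Neighbourhoods in the hull and approximation by translations\<close>

lemma translate_Int_ball:
  fixes A B :: "'a::real_normed_vector set"
  assumes "A \<inter> ball 0 R' = B \<inter> ball 0 R'" "R + norm q \<le> R'"
  shows "translate A q \<inter> ball 0 R = translate B q \<inter> ball 0 R"
proof (rule translate_Int_eq)
  have "translate (ball 0 R) (- q) \<subseteq> ball 0 R'"
  proof
    fix y assume "y \<in> translate (ball 0 R) (- q)"
    then have "norm (y + q) < R" by (simp add: mem_translate)
    then show "y \<in> ball 0 R'" using norm_triangle_ineq4[of "y + q" q] assms(2) by simp
  qed
  then show "A \<inter> translate (ball 0 R) (- q) = B \<inter> translate (ball 0 R) (- q)" using assms(1) by blast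
qed

definition hull_nbhd :: "(real^'d) set \<Rightarrow> (real^'d) set \<Rightarrow> real \<Rightarrow> (real^'d) set set" where
  "hull_nbhd \<Lambda> K e = {\<Lambda>' \<in> hull_space \<Sigma> W. \<exists>t t'. norm t < e \<and> norm t' < e \<and>
         translate \<Lambda> (- t) \<inter> K = translate \<Lambda>' (- t') \<inter> K}"

text \<open>\<open>nbhd_topology\<close> does not make the sets of its bases open; this has to be
  checked by finding a smaller basic set around each member.\<close>

lemma openin_hull_nbhd:
  assumes "compact K" shows "openin (hull_topology \<Sigma> W) (hull_nbhd \<Lambda> K e)"
  unfolding openin_hull_topology
proof (intro conjI ballI)
  show "hull_nbhd \<Lambda> K e \<subseteq> hull_space \<Sigma> W" unfolding hull_nbhd_def by blast
  fix \<Lambda>' assume "\<Lambda>' \<in> hull_nbhd \<Lambda> K e"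
  then obtain t t' where t: "norm t < e" "norm t' < e" "translate \<Lambda> (- t) \<inter> K = translate \<Lambda>' (- t') \<inter> K"
    unfolding hull_nbhd_def by blast
  \<comment> \<open>Passing to \<open>L\<close> replaces \<open>t'\<close> by
    \<open>t' - s + s'\<close>; half of the slack is reserved for each of \<open>s\<close> and
    \<open>s'\<close>.\<close>
  define e' where "e' = (e - norm t') / 2"
  have e': "e' > 0" "norm t' + e' + e' = e" unfolding e'_def using t(2) by (simp_all add: field_simps)
  obtain b where b: "\<And>y. y \<in> K \<Longrightarrow> norm y \<le> b"
    using compact_imp_bounded[OF assms] unfolding bounded_iff by blast
  \<comment> \<open>Points of \<open>K\<close> displaced by \<open>t' - s\<close>, of norm below
    \<open>e\<close>, must still be compared.\<close>
  let ?K' = "cball (0::real^'d) (b + e)"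
  have "hull_nbhd \<Lambda>' ?K' e' \<subseteq> hull_nbhd \<Lambda> K e"
  proof
    fix L assume "L \<in> hull_nbhd \<Lambda>' ?K' e'"
    then obtain s s' where L: "L \<in> hull_space \<Sigma> W" and s: "norm s < e'" "norm s' < e'"
      "translate \<Lambda>' (- s) \<inter> ?K' = translate L (- s') \<inter> ?K'"
      unfolding hull_nbhd_def by blast
    have eq: "y \<in> translate \<Lambda>' (- t') \<longleftrightarrow> y \<in> translate L (- (t' - s + s'))" if "y \<in> K" for y
    proof -
      have "norm (y + t' - s) \<le> norm y + norm t' + norm s"
        using norm_triangle_ineq4[of "y + t'" s] norm_triangle_ineq[of y t'] by simp
      then have "y + t' - s \<in> ?K'" using b[OF that] s(1) e' by simp
      then have "y + t' - s \<in> translate \<Lambda>' (- s) \<longleftrightarrow> y + t' - s \<in> translate L (- s')" using s(3) by blast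
      then show ?thesis by (simp add: mem_translate algebra_simps)
    qed
    have "norm (t' - s + s') \<le> norm t' + norm s + norm s'"
      using norm_triangle_ineq[of "t' - s" s'] norm_triangle_ineq4[of t' s] by simp
    then have "norm (t' - s + s') < e" using s(1,2) e'(2) by linarith
    moreover have "translate \<Lambda> (- t) \<inter> K = translate L (- (t' - s + s')) \<inter> K" using t(3) eq by blast
    ultimately show "L \<in> hull_nbhd \<Lambda> K e" unfolding hull_nbhd_def using L t(1) by blast
  qed
  moreover have "hull_nbhd \<Lambda>' ?K' e' \<in> hull_nbhds \<Sigma> W \<Lambda>'"
    unfolding hull_nbhds_def hull_nbhd_def using e'(1) compact_cball by blast
  ultimately show "\<exists>B\<in>hull_nbhds \<Sigma> W \<Lambda>'. B \<subseteq> hull_nbhd \<Lambda> K e" by blast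
qed

lemma hull_ellis_PiE: "g \<in> hull_ellis \<Sigma> W \<Longrightarrow> g \<in> Pi\<^sub>E (hull_space \<Sigma> W) (\<lambda>_. hull_space \<Sigma> W)"
  unfolding hull_ellis_def ellis_semigroup_def in_closure_of topspace_product_topology o_def topspace_hull_topology
  by (rule conjunct1)

text \<open>The topology of the hull tolerates small shifts, so a common \<open>t\<close> comes with
  a separate error vector for each \<Lambda> in \<open>S\<close>.\<close>

lemma hull_ellis_approx:
  assumes g: "g \<in> hull_ellis \<Sigma> W" and S: "finite S" "S \<subseteq> hull_space \<Sigma> W" and "\<epsilon> > 0"
  obtains t where "\<And>\<Lambda>. \<Lambda> \<in> S \<Longrightarrow> \<exists>e. norm e < \<epsilon> \<and> g \<Lambda> \<inter> ball 0 R = translate \<Lambda> (e - t) \<inter> ball 0 R"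
proof -
  \<comment> \<open>Two shifts below \<epsilon>/2 merge into one error below \<epsilon>; the
    enlarged radius leaves room for moving points of \<open>ball 0 R\<close> by the first.\<close>
  let ?K = "cball (0::real^'d) (R + \<epsilon>)"
  have "g \<Lambda> \<in> hull_nbhd (g \<Lambda>) ?K (\<epsilon> / 2)" if "\<Lambda> \<in> S" for \<Lambda>
  proof -
    have "g \<Lambda> \<in> hull_space \<Sigma> W" using PiE_mem[OF hull_ellis_PiE[OF g]] S(2) that by blast
    then show ?thesis unfolding hull_nbhd_def using \<open>\<epsilon> > 0\<close> by (auto intro!: exI[of _ "0::real^'d"])
  qed
  then obtain y where y: "y \<in> (\<lambda>t. restrict (\<lambda>\<Lambda>. translate \<Lambda> (- t)) (hull_space \<Sigma> W)) ` UNIV"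
    "\<And>\<Lambda>. \<Lambda> \<in> S \<Longrightarrow> y \<Lambda> \<in> hull_nbhd (g \<Lambda>) ?K (\<epsilon> / 2)"
    using product_closure_of_obtain[OF g[unfolded hull_ellis_def ellis_semigroup_def topspace_hull_topology] S,
        of "\<lambda>\<Lambda>. hull_nbhd (g \<Lambda>) ?K (\<epsilon> / 2)"] openin_hull_nbhd[OF compact_cball] by metis
  obtain t where t: "y = restrict (\<lambda>\<Lambda>. translate \<Lambda> (- t)) (hull_space \<Sigma> W)" using y(1) by blast
  have "\<exists>e. norm e < \<epsilon> \<and> g \<Lambda> \<inter> ball 0 R = translate \<Lambda> (e - t) \<inter> ball 0 R" if L: "\<Lambda> \<in> S" for \<Lambda>
  proof -
    have "y \<Lambda> = translate \<Lambda> (- t)" unfolding t using subsetD[OF S(2) L] by simp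
    then have "translate \<Lambda> (- t) \<in> hull_nbhd (g \<Lambda>) ?K (\<epsilon> / 2)" using y(2)[OF L] by simp
    then obtain s s' where s: "norm s < \<epsilon> / 2" "norm s' < \<epsilon> / 2"
      "translate (g \<Lambda>) (- s) \<inter> ?K = translate (translate \<Lambda> (- t)) (- s') \<inter> ?K"
      unfolding hull_nbhd_def by blast
    have eq: "x \<in> g \<Lambda> \<longleftrightarrow> x \<in> translate \<Lambda> (s - s' - t)" if "x \<in> ball 0 R" for x
    proof -
      have "x - s \<in> ?K" using that s(1) norm_triangle_ineq4[of x s] \<open>\<epsilon> > 0\<close> by simp
      then have "x - s \<in> translate (g \<Lambda>) (- s) \<longleftrightarrow> x - s \<in> translate (translate \<Lambda> (- t)) (- s')" using s(3) by blast
      then show ?thesis by (simp add: mem_translate algebra_simps)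
    qed
    have "norm (s - s') < \<epsilon>" using norm_triangle_ineq4[of s s'] s(1,2) by simp
    moreover have "g \<Lambda> \<inter> ball 0 R = translate \<Lambda> (s - s' - t) \<inter> ball 0 R" using eq by blast
    ultimately show ?thesis by blast
  qed
  then show ?thesis using that by blast
qed

lemma finite_hull_ball: assumes "\<Lambda> \<in> hull_space \<Sigma> W" shows "finite (\<Lambda> \<inter> ball 0 R)"
proof -
  obtain L t where L: "L \<in> Xi \<Sigma> W" "\<Lambda> = translate L (- t)" using hull_decomp[OF assms] by blast
  have "L \<subseteq> model (Xi_param \<Sigma> W L)" using Xi_param_sandwich[OF L(1)] unfolding sandwich_def model_def by blast
  then have "\<Lambda> \<inter> ball 0 R \<subseteq> (\<lambda>y. y - t) ` (model (Xi_param \<Sigma> W L) \<inter> ball 0 (R + norm t))"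
  proof (intro subsetI)
    fix x assume LM: "L \<subseteq> model (Xi_param \<Sigma> W L)" and "x \<in> \<Lambda> \<inter> ball 0 R"
    then have "x + t \<in> L" "norm x < R" using L(2) by (simp_all add: mem_translate)
    moreover have "norm (x + t) \<le> norm x + norm t" by (rule norm_triangle_ineq)
    ultimately have "x + t \<in> model (Xi_param \<Sigma> W L) \<inter> ball 0 (R + norm t)" using LM by auto
    then show "x \<in> (\<lambda>y. y - t) ` (model (Xi_param \<Sigma> W L) \<inter> ball 0 (R + norm t))"
      by (rule rev_image_eqI) simp
  qed
  then show ?thesis using finite_model_ball finite_surj by blast
qed

text \<open>Elements of the hull are locally finite, hence closed. Restricting to
  \<open>e \<le> 1\<close> lets callers absorb the error by adding 1 to a radius.\<close>

lemma hull_mem_limit: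
  assumes "\<Lambda> \<in> hull_space \<Sigma> W" "\<And>e. e > 0 \<Longrightarrow> e \<le> 1 \<Longrightarrow> \<exists>y\<in>\<Lambda>. norm (x - y) \<le> e"
  shows "x \<in> \<Lambda>"
proof -
  have "x \<in> closure (\<Lambda> \<inter> ball 0 (norm x + 2))"
    unfolding closure_approachable
  proof (intro allI impI)
    fix e :: real assume "e > 0"
    then obtain y where y: "y \<in> \<Lambda>" "norm (x - y) \<le> min (e / 2) 1" using assms(2)[of "min (e / 2) 1"] by auto
    then have "norm y < norm x + 2" using norm_triangle_ineq4[of x "x - y"] by simp
    then show "\<exists>y\<in>\<Lambda> \<inter> ball 0 (norm x + 2). dist y x < e"
      using y \<open>e > 0\<close> by (intro bexI[of _ y]) (simp_all add: dist_norm norm_minus_commute)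
  qed
  moreover have "closed (\<Lambda> \<inter> ball 0 (norm x + 2))" using finite_hull_ball[OF assms(1)] finite_imp_closed by blast
  ultimately show ?thesis by (simp add: closure_closed)
qed

lemma hull_ellis_hull: "g \<in> hull_ellis \<Sigma> W \<Longrightarrow> \<Lambda> \<in> hull_space \<Sigma> W \<Longrightarrow> g \<Lambda> \<in> hull_space \<Sigma> W"
  using PiE_mem[OF hull_ellis_PiE] .

text \<open>Imitating \<open>g\<close> at both sets with one \<open>t\<close> gives equality only up
  to a shift by the difference of two small errors. The errors tend to 0, and closedness of both
  sides turns this into the two inclusions.\<close>

lemma hull_ellis_translate:
  assumes g: "g \<in> hull_ellis \<Sigma> W" and L: "\<Lambda> \<in> hull_space \<Sigma> W"
  shows "g (translate \<Lambda> u) = translate (g \<Lambda>) u"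
proof -
  have Lu: "translate \<Lambda> u \<in> hull_space \<Sigma> W" using L hull_translate by blast
  have near: "\<exists>t c d. norm c < e / 2 \<and> norm d < e / 2 \<and>
      g \<Lambda> \<inter> ball 0 R = translate \<Lambda> (c - t) \<inter> ball 0 R \<and>
      g (translate \<Lambda> u) \<inter> ball 0 R = translate \<Lambda> (u + d - t) \<inter> ball 0 R" if e: "e > 0" for e R :: real
  proof -
    have "finite {\<Lambda>, translate \<Lambda> u}" "{\<Lambda>, translate \<Lambda> u} \<subseteq> hull_space \<Sigma> W" "e / 2 > 0" using L Lu e by auto
    from hull_ellis_approx[OF g this, of R] obtain t
      where t: "\<And>L. L \<in> {\<Lambda>, translate \<Lambda> u} \<Longrightarrow> \<exists>c. norm c < e / 2 \<and> g L \<inter> ball 0 R = translate L (c - t) \<inter> ball 0 R"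
      by blast
    show ?thesis using t[of \<Lambda>] t[of "translate \<Lambda> u"] by (simp add: add_diff_eq) blast
  qed
  have sub1: "x \<in> translate (g \<Lambda>) u" if x: "x \<in> g (translate \<Lambda> u)" for x
  proof (rule hull_mem_limit)
    show "translate (g \<Lambda>) u \<in> hull_space \<Sigma> W" using hull_ellis_hull[OF g L] hull_translate by blast
    fix e :: real assume e: "e > 0" "e \<le> 1"
    \<comment> \<open>Large enough to contain \<open>x\<close> and also \<open>x - u\<close>
      displaced by less than 1.\<close>
    define R where "R = norm x + norm u + 1"
    obtain t c d where t: "norm c < e / 2" "norm d < e / 2"
      "g \<Lambda> \<inter> ball 0 R = translate \<Lambda> (c - t) \<inter> ball 0 R"
      "g (translate \<Lambda> u) \<inter> ball 0 R = translate \<Lambda> (u + d - t) \<inter> ball 0 R" using near[OF e(1), of R] by blast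
    have cd: "norm (c - d) < e" using norm_triangle_ineq4[of c d] t(1,2) by simp
    have "x \<in> ball 0 R" unfolding R_def by (simp add: add_nonneg_pos)
    then have "x \<in> translate \<Lambda> (u + d - t)" using x t(4) by blast
    then have "(x - u) + (c - d) \<in> translate \<Lambda> (c - t)" by (simp add: mem_translate algebra_simps)
    moreover have "(x - u) + (c - d) \<in> ball 0 R"
      unfolding R_def using norm_triangle_ineq[of "x - u" "c - d"] norm_triangle_ineq4[of x u] cd e(2) by simp
    ultimately have "(x - u) + (c - d) \<in> g \<Lambda>" using t(3) by blast
    then have "x + (c - d) \<in> translate (g \<Lambda>) u" by (simp add: mem_translate algebra_simps)
    moreover have "norm (x - (x + (c - d))) \<le> e" using cd by (simp add: norm_minus_commute)
    ultimately show "\<exists>y\<in>translate (g \<Lambda>) u. norm (x - y) \<le> e" by blast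
  qed
  have sub2: "x \<in> g (translate \<Lambda> u)" if x: "x \<in> translate (g \<Lambda>) u" for x
  proof (rule hull_mem_limit)
    show "g (translate \<Lambda> u) \<in> hull_space \<Sigma> W" using hull_ellis_hull[OF g Lu] .
    fix e :: real assume e: "e > 0" "e \<le> 1"
    define R where "R = norm x + norm u + 1"
    obtain t c d where t: "norm c < e / 2" "norm d < e / 2"
      "g \<Lambda> \<inter> ball 0 R = translate \<Lambda> (c - t) \<inter> ball 0 R"
      "g (translate \<Lambda> u) \<inter> ball 0 R = translate \<Lambda> (u + d - t) \<inter> ball 0 R" using near[OF e(1), of R] by blast
    have cd: "norm (d - c) < e" using norm_triangle_ineq4[of d c] t(1,2) by simp
    have "x - u \<in> ball 0 R" unfolding R_def using norm_triangle_ineq4[of x u] by simp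
    moreover have "x - u \<in> g \<Lambda>" using x by (simp add: mem_translate)
    ultimately have "x - u \<in> translate \<Lambda> (c - t)" using t(3) by blast
    then have "x + (d - c) \<in> translate \<Lambda> (u + d - t)" by (simp add: mem_translate algebra_simps)
    moreover have "x + (d - c) \<in> ball 0 R"
      unfolding R_def mem_ball_0 using norm_triangle_ineq[of x "d - c"] cd e(2) norm_ge_zero[of u] by linarith
    ultimately have "x + (d - c) \<in> g (translate \<Lambda> u)" using t(4) by blast
    moreover have "norm (x - (x + (d - c))) \<le> e" using cd by (simp add: norm_minus_commute)
    ultimately show "\<exists>y\<in>g (translate \<Lambda> u). norm (x - y) \<le> e" by blast
  qed
  show ?thesis using sub1 sub2 by blast
qed

text \<open>The translations \<open>-t\<close> approximating \<open>g\<close> have the form \<open>\<gamma> - r\<close> up to small errors, and the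
  parameters of the images show that these errors do not accumulate: \<open>\<Sigma>\<close> is closed and uniformly
  discrete.\<close>

lemma hull_ellis_decomp:
  assumes g: "g \<in> hull_ellis \<Sigma> W"
  obtains h r where "h \<in> Xi_ellis \<Sigma> W" "\<And>\<Lambda>. \<Lambda> \<in> Xi \<Sigma> W \<Longrightarrow> g \<Lambda> = translate (h \<Lambda>) (- r)"
proof -
  let ?p = "Xi_param \<Sigma> W"
  obtain \<Lambda>0 where \<Lambda>0: "\<Lambda>0 \<in> Xi \<Sigma> W" using Xi_exists by blast
  obtain L0 r where L0: "L0 \<in> Xi \<Sigma> W" "g \<Lambda>0 = translate L0 (- r)"
    using hull_decomp[OF hull_ellis_hull[OF g Xi_hull[OF \<Lambda>0]]] by blast
  \<comment> \<open>The displacement at one reference point. Taking \<open>r\<close> from the same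
    point fixes the splitting once and for all; every other \<Lambda> is compared with it.\<close>
  define w where "w = ?p L0 - ?p \<Lambda>0"
  define h where "h = (\<lambda>\<Lambda>\<in>Xi \<Sigma> W. translate (g \<Lambda>) r)"
  have h: "translate (g \<Lambda>) r \<in> Xi \<Sigma> W \<and> ?p (translate (g \<Lambda>) r) = ?p \<Lambda> + w" if \<Lambda>: "\<Lambda> \<in> Xi \<Sigma> W" for \<Lambda>
  proof -
    obtain L q where L: "L \<in> Xi \<Sigma> W" "g \<Lambda> = translate L (- q)"
      using hull_decomp[OF hull_ellis_hull[OF g Xi_hull[OF \<Lambda>]]] by blast
    \<comment> \<open>This pair compares the displacements of \<Lambda> and of the reference point
      in both spaces at once. Modulo \<Sigma> they should agree, and the imitating translations show
      it up to an arbitrarily small error.\<close>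
    have "(?p L - ?p \<Lambda> - w, q - r) \<in> closure \<Sigma>"
      unfolding closure_approachable
    proof (intro allI impI)
      fix e :: real assume "e > 0"
      \<comment> \<open>Each of the two components collects two errors below \<eta>.\<close>
      define \<eta> where "\<eta> = e / 4"
      have \<eta>: "\<eta> > 0" "4 * \<eta> = e" unfolding \<eta>_def using \<open>e > 0\<close> by auto
      obtain R where R: "\<And>L L' u. L \<in> Xi \<Sigma> W \<Longrightarrow> L' \<in> Xi \<Sigma> W \<Longrightarrow> L \<inter> ball 0 R = translate L' u \<inter> ball 0 R \<Longrightarrow>
        u \<in> Gam \<Sigma> \<and> norm (?p L - ?p L' - star \<Sigma> u) < \<eta>"
        using Xi_near_translate[OF \<eta>(1)] by metis
      have "finite {\<Lambda>0, \<Lambda>}" "{\<Lambda>0, \<Lambda>} \<subseteq> hull_space \<Sigma> W" using \<Lambda>0 \<Lambda> Xi_hull by auto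
      \<comment> \<open>The radius leaves agreement on \<open>ball 0 R\<close> after undoing the
        shift by \<open>r\<close> or by \<open>q\<close>.\<close>
      from hull_ellis_approx[OF g this \<eta>(1), of "R + norm r + norm q"] obtain t
        where t: "\<And>L. L \<in> {\<Lambda>0, \<Lambda>} \<Longrightarrow>
          \<exists>c. norm c < \<eta> \<and> g L \<inter> ball 0 (R + norm r + norm q) = translate L (c - t) \<inter> ball 0 (R + norm r + norm q)"
        by blast
      obtain c where c: "norm c < \<eta>"
        "translate L (- q) \<inter> ball 0 (R + norm r + norm q) = translate \<Lambda> (c - t) \<inter> ball 0 (R + norm r + norm q)"
        using t[of \<Lambda>] L(2) by auto
      obtain c0 where c0: "norm c0 < \<eta>"
        "translate L0 (- r) \<inter> ball 0 (R + norm r + norm q) = translate \<Lambda>0 (c0 - t) \<inter> ball 0 (R + norm r + norm q)"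
        using t[of \<Lambda>0] L0(2) by auto
      have u: "c - t + q \<in> Gam \<Sigma>" "norm (?p L - ?p \<Lambda> - star \<Sigma> (c - t + q)) < \<eta>"
        using R[OF L(1) \<Lambda>] translate_Int_ball[OF c(2), of R q] by auto
      have u0: "c0 - t + r \<in> Gam \<Sigma>" "norm (?p L0 - ?p \<Lambda>0 - star \<Sigma> (c0 - t + r)) < \<eta>"
        using R[OF L0(1) \<Lambda>0] translate_Int_ball[OF c0(2), of R r] by auto
      let ?\<gamma> = "(c - t + q) - (c0 - t + r)"
      have "(star \<Sigma> ?\<gamma>, ?\<gamma>) \<in> \<Sigma>" using Gam_diff[OF u(1) u0(1)] Gam_iff by blast
      moreover have "dist (star \<Sigma> ?\<gamma>, ?\<gamma>) (?p L - ?p \<Lambda> - w, q - r) < e"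
      proof -
        have eq: "star \<Sigma> ?\<gamma> - (?p L - ?p \<Lambda> - w) =
          (?p L0 - ?p \<Lambda>0 - star \<Sigma> (c0 - t + r)) - (?p L - ?p \<Lambda> - star \<Sigma> (c - t + q))"
          unfolding star_diff[OF u(1) u0(1)] w_def by simp
        have "norm (star \<Sigma> ?\<gamma> - (?p L - ?p \<Lambda> - w)) < 2 * \<eta>"
          unfolding eq
          using norm_triangle_ineq4[of "?p L0 - ?p \<Lambda>0 - star \<Sigma> (c0 - t + r)" "?p L - ?p \<Lambda> - star \<Sigma> (c - t + q)"]
            u(2) u0(2) by linarith
        moreover have "?\<gamma> - (q - r) = c - c0" by simp
        then have "norm (?\<gamma> - (q - r)) < 2 * \<eta>" using norm_triangle_ineq4[of c c0] c(1) c0(1) by simp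
        ultimately show ?thesis
          using norm_Pair_le[of "star \<Sigma> ?\<gamma> - (?p L - ?p \<Lambda> - w)" "?\<gamma> - (q - r)"] \<eta>(2)
          unfolding dist_norm diff_Pair by linarith
      qed
      ultimately show "\<exists>y\<in>\<Sigma>. dist y (?p L - ?p \<Lambda> - w, q - r) < e" by blast
    qed
    \<comment> \<open>Since \<Sigma> is closed, the discrepancy is exactly a lattice vector; so
      \<open>r\<close> brings \<open>g \<Lambda>\<close> into the internal system, with displacement
      exactly \<open>w\<close>.\<close>
    then have S: "(?p L - ?p \<Lambda> - w, q - r) \<in> \<Sigma>" using closed_Sigma closure_closed by metis
    then have st: "star \<Sigma> (q - r) = ?p L - ?p \<Lambda> - w" by (rule star_eq)
    then have qr: "q - r \<in> Gam \<Sigma>" using S Gam_iff by simp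
    have "translate (g \<Lambda>) r = translate L (- (q - r))" unfolding L(2) by simp
    then show ?thesis
      using translate_Xi[OF L(1) Gam_minus[OF qr]] Xi_param_translate[OF L(1) Gam_minus[OF qr]]
        star_minus[OF qr] st by simp
  qed
  have "h \<in> Xi_ellis \<Sigma> W"
    unfolding in_Xi_ellis
  proof (intro conjI allI impI)
    show "h \<in> Pi\<^sub>E (Xi \<Sigma> W) (\<lambda>_. Xi \<Sigma> W)" unfolding h_def using h by auto
    fix S and K :: "(real^'d) set" assume S: "finite S" "S \<subseteq> Xi \<Sigma> W" and K: "compact K"
    obtain RK where RK: "K \<subseteq> ball 0 RK" using compact_imp_bounded[OF K] bounded_subset_ballD by blast
    \<comment> \<open>Now the separation of \<Sigma> is used: the approximating elements of \<Gamma>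
      for different \<Lambda> differ by lattice vectors, and these are made shorter than
      \<open>e\<close>.\<close>
    obtain e where e: "e > 0" "\<And>x. x \<in> \<Sigma> \<Longrightarrow> norm x < e \<Longrightarrow> x = 0" using Sigma_separated by blast
    define \<eta> where "\<eta> = e / 4"
    have \<eta>: "\<eta> > 0" "4 * \<eta> = e" unfolding \<eta>_def using \<open>e > 0\<close> by auto
    obtain R1 where R1: "\<And>L L' u. L \<in> Xi \<Sigma> W \<Longrightarrow> L' \<in> Xi \<Sigma> W \<Longrightarrow> L \<inter> ball 0 R1 = translate L' u \<inter> ball 0 R1 \<Longrightarrow>
      u \<in> Gam \<Sigma> \<and> norm (?p L - ?p L' - star \<Sigma> u) < \<eta>"
      using Xi_near_translate[OF \<eta>(1)] by metis
    define R where "R = max R1 RK"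
    \<comment> \<open>The reference point is added so that its \<gamma> can serve as the common
      choice, even for empty \<open>S\<close>.\<close>
    have "finite (insert \<Lambda>0 S)" "insert \<Lambda>0 S \<subseteq> hull_space \<Sigma> W" using \<Lambda>0 S Xi_hull by auto
    from hull_ellis_approx[OF g this \<eta>(1), of "R + norm r"] obtain t
      where t: "\<And>\<Lambda>. \<Lambda> \<in> insert \<Lambda>0 S \<Longrightarrow>
        \<exists>c. norm c < \<eta> \<and> g \<Lambda> \<inter> ball 0 (R + norm r) = translate \<Lambda> (c - t) \<inter> ball 0 (R + norm r)" by blast
    have u: "\<exists>c. norm c < \<eta> \<and> c - t + r \<in> Gam \<Sigma> \<and> norm (w - star \<Sigma> (c - t + r)) < \<eta> \<and>
        h \<Lambda> \<inter> K = translate \<Lambda> (c - t + r) \<inter> K" if \<Lambda>: "\<Lambda> \<in> insert \<Lambda>0 S" for \<Lambda>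
    proof -
      have \<Lambda>X: "\<Lambda> \<in> Xi \<Sigma> W" using \<Lambda> \<Lambda>0 S(2) by blast
      obtain c where c: "norm c < \<eta>" "g \<Lambda> \<inter> ball 0 (R + norm r) = translate \<Lambda> (c - t) \<inter> ball 0 (R + norm r)"
        using t[OF \<Lambda>] by blast
      have eq: "translate (g \<Lambda>) r \<inter> ball 0 R = translate \<Lambda> (c - t + r) \<inter> ball 0 R"
        using translate_Int_ball[OF c(2), of R r] by simp
      have sub: "ball (0::real^'d) R1 \<subseteq> ball 0 R" "K \<subseteq> ball 0 R" using RK unfolding R_def by auto
      have "translate (g \<Lambda>) r \<inter> ball 0 R1 = translate \<Lambda> (c - t + r) \<inter> ball 0 R1" using eq sub(1) by blast
      then have "c - t + r \<in> Gam \<Sigma> \<and> norm (?p (translate (g \<Lambda>) r) - ?p \<Lambda> - star \<Sigma> (c - t + r)) < \<eta>"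
        using R1 h[OF \<Lambda>X] \<Lambda>X by blast
      moreover have "h \<Lambda> \<inter> K = translate \<Lambda> (c - t + r) \<inter> K"
        unfolding h_def using \<Lambda>X eq sub(2) by auto
      ultimately show ?thesis using c(1) h[OF \<Lambda>X] by auto
    qed
    obtain c0 where c0: "norm c0 < \<eta>" "c0 - t + r \<in> Gam \<Sigma>" "norm (w - star \<Sigma> (c0 - t + r)) < \<eta>"
      using u[of \<Lambda>0] by auto
    have "h \<Lambda> \<inter> K = translate \<Lambda> (c0 - t + r) \<inter> K" if \<Lambda>: "\<Lambda> \<in> S" for \<Lambda>
    proof -
      obtain c where c: "norm c < \<eta>" "c - t + r \<in> Gam \<Sigma>" "norm (w - star \<Sigma> (c - t + r)) < \<eta>"
        "h \<Lambda> \<inter> K = translate \<Lambda> (c - t + r) \<inter> K" using u[of \<Lambda>] \<Lambda> by auto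
      let ?\<gamma> = "(c - t + r) - (c0 - t + r)"
      have S: "(star \<Sigma> ?\<gamma>, ?\<gamma>) \<in> \<Sigma>" using Gam_diff[OF c(2) c0(2)] Gam_iff by blast
      have eq: "star \<Sigma> ?\<gamma> = (w - star \<Sigma> (c0 - t + r)) - (w - star \<Sigma> (c - t + r))"
        unfolding star_diff[OF c(2) c0(2)] by simp
      have "norm (star \<Sigma> ?\<gamma>) < 2 * \<eta>"
        unfolding eq
        using norm_triangle_ineq4[of "w - star \<Sigma> (c0 - t + r)" "w - star \<Sigma> (c - t + r)"] c(3) c0(3) by linarith
      moreover have "norm ?\<gamma> < 2 * \<eta>" using norm_triangle_ineq4[of c c0] c(1) c0(1) by simp
      ultimately have "norm (star \<Sigma> ?\<gamma>, ?\<gamma>) < e"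
        using norm_Pair_le[of "star \<Sigma> ?\<gamma>" ?\<gamma>] \<eta>(2) by linarith
      \<comment> \<open>The individual errors coincide, so a single \<gamma> imitates
        \<open>h\<close> exactly on all of \<open>S\<close>.\<close>
      then have "c = c0" using e(2)[OF S] by (simp add: zero_prod_def)
      then show ?thesis using c(4) by simp
    qed
    then show "\<exists>\<gamma>\<in>Gam \<Sigma>. \<forall>\<Lambda>\<in>S. h \<Lambda> \<inter> K = translate \<Lambda> \<gamma> \<inter> K" using c0(2) by blast
  qed
  moreover have "g \<Lambda> = translate (h \<Lambda>) (- r)" if "\<Lambda> \<in> Xi \<Sigma> W" for \<Lambda>
    unfolding h_def using that by simp
  ultimately show ?thesis using that by blast
qed

end

context cut_project_window begin

section \<open>Transfer from the internal system to the hull\<close>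

lemma ellis_extend_eq:
  assumes "h \<in> Xi_ellis \<Sigma> W" "\<Lambda> \<in> Xi \<Sigma> W"
  shows "ellis_extend \<Sigma> W h (translate \<Lambda> (- t)) = translate (h \<Lambda>) (- t)"
proof -
  have "translate \<Lambda> (- t) \<in> hull_space \<Sigma> W" using Xi_hull[OF assms(2)] hull_translate by blast
  moreover have "(THE \<Lambda>1. \<exists>L\<in>Xi \<Sigma> W. \<exists>s. translate \<Lambda> (- t) = translate L (- s) \<and> \<Lambda>1 = translate (h L) (- s))
    = translate (h \<Lambda>) (- t)"
  proof (rule the_equality)
    fix \<Lambda>1 assume "\<exists>L\<in>Xi \<Sigma> W. \<exists>s. translate \<Lambda> (- t) = translate L (- s) \<and> \<Lambda>1 = translate (h L) (- s)"
    then obtain L s where L: "L \<in> Xi \<Sigma> W" "translate \<Lambda> (- t) = translate L (- s)" "\<Lambda>1 = translate (h L) (- s)" by blast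
    have eq: "L = translate \<Lambda> (s - t)" using arg_cong[OF L(2), of "\<lambda>A. translate A s"] by simp
    have "s - t \<in> Gam \<Sigma>" using translate_eq_Gam[OF assms(2) L(1) eq] .
    then have "h L = translate (h \<Lambda>) (s - t)" unfolding eq using Xi_ellis_translate[OF assms] by blast
    then show "\<Lambda>1 = translate (h \<Lambda>) (- t)" unfolding L(3) by simp
  qed (use assms(2) in blast)
  ultimately show ?thesis unfolding ellis_extend_def by simp
qed

lemma hull_ellis_param_eq:
  assumes g: "g \<in> hull_ellis \<Sigma> W" and h: "h \<in> Xi_ellis \<Sigma> W"
    and gh: "\<And>\<Lambda>. \<Lambda> \<in> Xi \<Sigma> W \<Longrightarrow> g \<Lambda> = translate (h \<Lambda>) (- r)"
  shows "hull_ellis_param \<Sigma> W g = torus_class \<Sigma> (Xi_ellis_param \<Sigma> W h) r"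
    and "\<And>\<Lambda> t. \<Lambda> \<in> Xi \<Sigma> W \<Longrightarrow> g (translate \<Lambda> (- t)) = translate (h \<Lambda>) (- (r + t))"
    and "\<Lambda>' \<in> hull_space \<Sigma> W \<Longrightarrow>
      hull_param \<Sigma> W (g \<Lambda>') = torus_add (hull_param \<Sigma> W \<Lambda>') (torus_class \<Sigma> (Xi_ellis_param \<Sigma> W h) r)"
proof -
  show img: "g (translate \<Lambda> (- t)) = translate (h \<Lambda>) (- (r + t))" if "\<Lambda> \<in> Xi \<Sigma> W" for \<Lambda> t
    using hull_ellis_translate[OF g Xi_hull[OF that], of "- t"] gh[OF that] by simp
  show par: "hull_param \<Sigma> W (g \<Lambda>') = torus_add (hull_param \<Sigma> W \<Lambda>') (torus_class \<Sigma> (Xi_ellis_param \<Sigma> W h) r)"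
    if "\<Lambda>' \<in> hull_space \<Sigma> W" for \<Lambda>'
  proof -
    obtain \<Lambda> t where L: "\<Lambda> \<in> Xi \<Sigma> W" "\<Lambda>' = translate \<Lambda> (- t)" using hull_decomp \<open>\<Lambda>' \<in> _\<close> by blast
    show ?thesis
      unfolding L(2) img[OF L(1)] hull_param_eq[OF L(1)] hull_param_eq[OF Xi_ellis_Xi[OF h L(1)]]
        torus_add_class Xi_param_ellis[OF h L(1)] by (simp add: add.commute)
  qed
  show "hull_ellis_param \<Sigma> W g = torus_class \<Sigma> (Xi_ellis_param \<Sigma> W h) r"
    unfolding hull_ellis_param_def
  proof (rule the_equality)
    show "torus_class \<Sigma> (Xi_ellis_param \<Sigma> W h) r \<in> torus \<Sigma> \<and> (\<forall>\<Lambda>\<in>hull_space \<Sigma> W.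
      hull_param \<Sigma> W (g \<Lambda>) = torus_add (hull_param \<Sigma> W \<Lambda>) (torus_class \<Sigma> (Xi_ellis_param \<Sigma> W h) r))"
      using par unfolding torus_def by blast
    fix z assume z: "z \<in> torus \<Sigma> \<and> (\<forall>\<Lambda>\<in>hull_space \<Sigma> W. hull_param \<Sigma> W (g \<Lambda>) = torus_add (hull_param \<Sigma> W \<Lambda>) z)"
    then obtain a b where ab: "z = torus_class \<Sigma> a b" unfolding torus_def by blast
    obtain \<Lambda> where L: "\<Lambda> \<in> Xi \<Sigma> W" using Xi_exists by blast
    \<comment> \<open>Addition in the torus cancels, so one point of the hull determines
      \<open>z\<close>.\<close>
    have "torus_add (hull_param \<Sigma> W \<Lambda>) z =
        torus_add (hull_param \<Sigma> W \<Lambda>) (torus_class \<Sigma> (Xi_ellis_param \<Sigma> W h) r)"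
      using z par Xi_hull[OF L] by simp
    then show "z = torus_class \<Sigma> (Xi_ellis_param \<Sigma> W h) r"
      using hull_param_eq[OF L, of 0] unfolding ab by (simp add: torus_add_class torus_class_eq_iff)
  qed
qed

lemma hull_ellis_eq_extend:
  assumes g: "g \<in> hull_ellis \<Sigma> W" and h: "h \<in> Xi_ellis \<Sigma> W"
    and gh: "\<And>\<Lambda>. \<Lambda> \<in> Xi \<Sigma> W \<Longrightarrow> g \<Lambda> = translate (h \<Lambda>) (- r)"
  shows "g = (\<lambda>\<Lambda>\<in>hull_space \<Sigma> W. translate (ellis_extend \<Sigma> W h \<Lambda>) (- r))"
proof (rule extensionalityI)
  show "g \<in> extensional (hull_space \<Sigma> W)" using hull_ellis_PiE[OF g] by (simp add: PiE_iff)
  fix \<Lambda>' assume "\<Lambda>' \<in> hull_space \<Sigma> W"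
  moreover from this obtain \<Lambda> t where L: "\<Lambda> \<in> Xi \<Sigma> W" "\<Lambda>' = translate \<Lambda> (- t)" using hull_decomp by blast
  ultimately show "g \<Lambda>' = (\<lambda>\<Lambda>\<in>hull_space \<Sigma> W. translate (ellis_extend \<Sigma> W h \<Lambda>) (- r)) \<Lambda>'"
    using hull_ellis_param_eq(2)[OF g h gh L(1), of t] ellis_extend_eq[OF h L(1), of t] by (simp add: algebra_simps)
qed simp

end

context almost_canonical_window begin

lemma hull_cut_type_eq:
  assumes "\<Lambda> \<in> Xi \<Sigma> W" shows "hull_cut_type \<Sigma> W \<nu> (translate \<Lambda> (- t)) H = Xi_cut_type \<Sigma> W \<nu> \<Lambda> H"
  unfolding hull_cut_type_def
proof (rule the_equality)
  fix s assume "\<exists>L\<in>Xi \<Sigma> W. \<exists>t'. translate \<Lambda> (- t) = translate L (- t') \<and> s = Xi_cut_type \<Sigma> W \<nu> L H"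
  then obtain L t' where L: "L \<in> Xi \<Sigma> W" "translate \<Lambda> (- t) = translate L (- t')" "s = Xi_cut_type \<Sigma> W \<nu> L H" by blast
  have eq: "L = translate \<Lambda> (t' - t)" using arg_cong[OF L(2), of "\<lambda>A. translate A t'"] by simp
  have "t' - t \<in> Gam \<Sigma>" using translate_eq_Gam[OF assms L(1) eq] .
  then show "s = Xi_cut_type \<Sigma> W \<nu> \<Lambda> H" unfolding L(3) eq by (rule Xi_cut_type_translate[OF assms])
qed (use assms in blast)

lemma torus_cuts_class: "torus_cuts \<Sigma> W (torus_class \<Sigma> w t) = cuts \<Sigma> W w"
  unfolding torus_cuts_def
proof (rule the_equality)
  fix C assume "\<exists>w' t'. torus_class \<Sigma> w t = torus_class \<Sigma> w' t' \<and> C = cuts \<Sigma> W w'"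
  then obtain w' t' where w': "torus_class \<Sigma> w t = torus_class \<Sigma> w' t'" "C = cuts \<Sigma> W w'" by blast
  then have S: "(w - w', t - t') \<in> \<Sigma>" using torus_class_eq_iff by blast
  then have st: "star \<Sigma> (t - t') = w - w'" by (rule star_eq)
  then have "t - t' \<in> Gam \<Sigma>" using S Gam_iff by simp
  then have "H \<in> cuts \<Sigma> W w \<longleftrightarrow> H \<in> cuts \<Sigma> W w'" for H
    using cuts_shift_iff[of "t - t'" H w'] st by simp
  then show "C = cuts \<Sigma> W w" unfolding w'(2) by blast
qed blast

text \<open>Two splittings of \<open>g\<close> differ by an element of \<Gamma>, as seen from the
  image of any point of \<open>Xi\<close>, and the cone type is invariant under such a
  change.\<close>

lemma hull_cone_type_eq:
  assumes h: "h \<in> Xi_ellis \<Sigma> W" and H: "H \<in> hyperplanes W"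
    and g: "g = (\<lambda>\<Lambda>\<in>hull_space \<Sigma> W. translate (ellis_extend \<Sigma> W h \<Lambda>) (- r))"
  shows "hull_cone_type \<Sigma> W \<nu> g H = Xi_cone_type \<Sigma> W \<nu> h H"
  unfolding hull_cone_type_def
proof (rule the_equality)
  show "\<exists>h'\<in>Xi_ellis \<Sigma> W. \<exists>r'. g = (\<lambda>\<Lambda>\<in>hull_space \<Sigma> W. translate (ellis_extend \<Sigma> W h' \<Lambda>) (- r')) \<and>
      Xi_cone_type \<Sigma> W \<nu> h H = Xi_cone_type \<Sigma> W \<nu> h' H" using h g by blast
  fix s assume "\<exists>h'\<in>Xi_ellis \<Sigma> W. \<exists>r'. g = (\<lambda>\<Lambda>\<in>hull_space \<Sigma> W. translate (ellis_extend \<Sigma> W h' \<Lambda>) (- r')) \<and>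
      s = Xi_cone_type \<Sigma> W \<nu> h' H"
  then obtain h' r' where h': "h' \<in> Xi_ellis \<Sigma> W" and s: "s = Xi_cone_type \<Sigma> W \<nu> h' H"
    and g': "g = (\<lambda>\<Lambda>\<in>hull_space \<Sigma> W. translate (ellis_extend \<Sigma> W h' \<Lambda>) (- r'))" by blast
  have shift: "h' \<Lambda> = translate (h \<Lambda>) (r' - r)" if L: "\<Lambda> \<in> Xi \<Sigma> W" for \<Lambda>
  proof -
    have "translate (h \<Lambda>) (- r) = translate (h' \<Lambda>) (- r')"
      using fun_cong[OF g, of \<Lambda>] fun_cong[OF g', of \<Lambda>] Xi_hull[OF L]
        ellis_extend_eq[OF h L, of 0] ellis_extend_eq[OF h' L, of 0] by simp
    from arg_cong[OF this, of "\<lambda>A. translate A r'"] show ?thesis by simp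
  qed
  obtain \<Lambda> where L: "\<Lambda> \<in> Xi \<Sigma> W" using Xi_exists by blast
  have \<delta>: "r' - r \<in> Gam \<Sigma>"
    using translate_eq_Gam[OF Xi_ellis_Xi[OF h L] Xi_ellis_Xi[OF h' L] shift[OF L]] .
  have "h' = (\<lambda>\<Lambda>\<in>Xi \<Sigma> W. translate (h \<Lambda>) (r' - r))"
  proof (rule extensionalityI)
    show "h' \<in> extensional (Xi \<Sigma> W)" using h'[unfolded in_Xi_ellis] by (simp add: PiE_iff)
  qed (use shift in simp_all)
  then show "s = Xi_cone_type \<Sigma> W \<nu> h H" unfolding s using Xi_cone_type_translate[OF h \<delta> H] by simp
qed

lemma hull_ellis_action:
  assumes \<Lambda>': "\<Lambda>' \<in> hull_space \<Sigma> W" and g: "g \<in> hull_ellis \<Sigma> W"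
  defines "z \<equiv> torus_add (hull_param \<Sigma> W \<Lambda>') (hull_ellis_param \<Sigma> W g)"
  shows "hull_param \<Sigma> W (g \<Lambda>') = z"
    and "H \<in> hyperplanes W \<Longrightarrow> hull_cut_type \<Sigma> W \<nu> (g \<Lambda>') H =
      (if H \<in> torus_cuts \<Sigma> W z then symb_mult (hull_cut_type \<Sigma> W \<nu> \<Lambda>') (hull_cone_type \<Sigma> W \<nu> g) H else S_inf)"
proof -
  obtain h r where h: "h \<in> Xi_ellis \<Sigma> W" and gh: "\<And>\<Lambda>. \<Lambda> \<in> Xi \<Sigma> W \<Longrightarrow> g \<Lambda> = translate (h \<Lambda>) (- r)"
    using hull_ellis_decomp[OF g] by blast
  note ep = hull_ellis_param_eq[OF g h gh]
  show par: "hull_param \<Sigma> W (g \<Lambda>') = z" unfolding z_def using ep(1) ep(3)[OF _ \<Lambda>'] by simp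
  assume H: "H \<in> hyperplanes W"
  obtain \<Lambda> t where L: "\<Lambda> \<in> Xi \<Sigma> W" "\<Lambda>' = translate \<Lambda> (- t)" using hull_decomp[OF \<Lambda>'] by blast
  have img: "g \<Lambda>' = translate (h \<Lambda>) (- (r + t))" unfolding L(2) using ep(2)[OF _ L(1)] by blast
  have z: "z = torus_class \<Sigma> (Xi_param \<Sigma> W (h \<Lambda>)) (r + t)"
    using par unfolding img hull_param_eq[OF Xi_ellis_Xi[OF h L(1)]] by simp
  have c: "hull_cut_type \<Sigma> W \<nu> (g \<Lambda>') H = Xi_cut_type \<Sigma> W \<nu> (h \<Lambda>) H"
    unfolding img by (rule hull_cut_type_eq[OF Xi_ellis_Xi[OF h L(1)]])
  have k: "hull_cone_type \<Sigma> W \<nu> g H = Xi_cone_type \<Sigma> W \<nu> h H"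
    by (rule hull_cone_type_eq[OF h H], rule hull_ellis_eq_extend[OF g h], rule gh)
  have m: "symb_mult (hull_cut_type \<Sigma> W \<nu> \<Lambda>') (hull_cone_type \<Sigma> W \<nu> g) H =
      symb_mult (Xi_cut_type \<Sigma> W \<nu> \<Lambda>) (Xi_cone_type \<Sigma> W \<nu> h) H"
    unfolding symb_mult_def L(2) hull_cut_type_eq[OF L(1)] k by simp
  show "hull_cut_type \<Sigma> W \<nu> (g \<Lambda>') H =
      (if H \<in> torus_cuts \<Sigma> W z then symb_mult (hull_cut_type \<Sigma> W \<nu> \<Lambda>') (hull_cone_type \<Sigma> W \<nu> g) H else S_inf)"
    \<comment> \<open>The class \<open>z\<close> has the parameter of \<open>h \<Lambda>\<close> as
      representative, so both sides refer to the same cuts; off the cuts the cut type is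
      \<open>S_inf\<close> by definition.\<close>
    unfolding c m z torus_cuts_class
    using Xi_cut_type_ellis[OF h L(1)] by (auto simp: Xi_cut_type_def)
qed

end

theorem proposition8p2:
  fixes \<Sigma> :: "((real^'n) \<times> (real^'d)) set"
    and W :: "(real^'n) set"
    and \<nu> :: "(real^'n) set \<Rightarrow> real^'n"
    and \<Lambda> :: "(real^'d) set"
    and g :: "(real^'d) set \<Rightarrow> (real^'d) set"
  assumes "cut_and_project \<Sigma>"
    and "window W"
    and "orientation \<nu>"
    and "almost_canonical \<Sigma> W \<nu>"
    and "\<Lambda> \<in> hull_space \<Sigma> W"
    and "g \<in> hull_ellis \<Sigma> W"
  shows "g \<Lambda> \<in> hull_space \<Sigma> W \<and>
     hull_param \<Sigma> W (g \<Lambda>) = torus_add (hull_param \<Sigma> W \<Lambda>) (hull_ellis_param \<Sigma> W g) \<and>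
     (\<forall>H\<in>hyperplanes W. hull_cut_type \<Sigma> W \<nu> (g \<Lambda>) H =
           (if H \<in> torus_cuts \<Sigma> W (torus_add (hull_param \<Sigma> W \<Lambda>) (hull_ellis_param \<Sigma> W g))
            then symb_mult (hull_cut_type \<Sigma> W \<nu> \<Lambda>) (hull_cone_type \<Sigma> W \<nu> g) H
            else S_inf))"
proof -
  interpret almost_canonical_window \<Sigma> W \<nu>
    by unfold_locales (fact assms)+
  show ?thesis
    using hull_ellis_hull[OF assms(6,5)] hull_ellis_action[OF assms(5,6)] by blast
qed

end
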